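(* Let $M(f,Q,\xi_i,\eta^i,g)$ be a weak $K$-manifold, i.e. a smooth manifold $M^{2n+p}$ with a metric weak $f$-structure $(f,Q,\xi_i,\eta^i,g)$, $1\le i\le p$, that is normal and whose fundamental $2$-form $\Phi$ satisfies $d\Phi=0$. Then the vector fields $\xi_1,\ldots,\xi_p$ are Killing; moreover, $\nabla_{\xi_k}\,\xi_j=0$ for all $1\le k,j\le p$, and the characteristic distribution $\ker f$ is integrable and defines a totally geodesic foliation.
   Context: A metric weak $f$-structure $(f,Q,\xi_i,\eta^i,g)$, $1\le i\le p$, on a smooth manifold $M$ of dimension $2n+p$ consists of: a $(1,1)$-tensor field $f$ of constant rank $2n$ and a nonsingular $(1,1)$-tensor field $Q$ with $f^3+fQ=0$ and $Q\xi=\xi$ for $\xi\in\ker f$; global vector fields $\xi_1,\dots,\xi_p$ spanning $\ker f$ (assumed parallelizable) and dual one-forms $\eta^1,\dots,\eta^p$ with $f^2=-Q+\sum_i\eta^i\otimes\xi_i$, $\eta^i(\xi_j)=\delta^i_j$; and a Riemannian metric $g$ with $g(\xi_i,\xi_i)=1$ and $g(fX,fY)=g(X,QY)-\sum_i\eta^i(X)\,\eta^i(QY)$ for all vector fields $X,Y$. Then $g(X,\xi_i)=\eta^i(X)$, $f(TM)=\bigcap_i\ker\eta^i$ and $f(TM)\perp\ker f$. Notation: $\nabla$ is the Levi-Civita connection of $g$; $2\,d\eta^i(X,Y)=X(\eta^i(Y))-Y(\eta^i(X))-\eta^i([X,Y])$; $[f,f](X,Y)=f^2[X,Y]+[fX,fY]-f[fX,Y]-f[X,fY]$;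 the structure is normal if $N^{(1)}:=[f,f]+2\sum_i d\eta^i\otimes\xi_i=0$. The fundamental $2$-form is $\Phi(X,Y)=g(X,fY)$, with $3\,d\Phi(X,Y,Z)=X\Phi(Y,Z)+Y\Phi(Z,X)+Z\Phi(X,Y)-\Phi([X,Y],Z)-\Phi([Z,X],Y)-\Phi([Y,Z],X)$. The characteristic distribution is $\ker f$. A distribution $\mathcal D$ is totally geodesic if $\nabla_XY+\nabla_YX\in\mathcal D$ for all vector fields $X,Y$ in $\mathcal D$; an integrable totally geodesic distribution defines a totally geodesic foliation. *)

theory Defs
  imports "HOL-Analysis.Analysis" "HOL-Library.Function_Algebras"
begin

section \<open>Pointwise real vector space structure on functions\<close>

text \<open>Together with the additive structure from Function-Algebras this makes \<open>+\<close>, \<open>0\<close>, \<open>*\<^sub>R\<close>,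
  \<open>span\<close>, \<open>dim\<close> available for tangent vectors, which are represented as functionals.\<close>

instantiation "fun" :: (type, real_vector) real_vector
begin

definition scaleR_fun :: "real \<Rightarrow> ('a \<Rightarrow> 'b) \<Rightarrow> 'a \<Rightarrow> 'b" where
  "scaleR_fun c f = (\<lambda>x. c *\<^sub>R f x)"

instance
  by standard (auto simp: scaleR_fun_def plus_fun_def scaleR_add_left scaleR_add_right)

end

section \<open>Smooth functions between vector spaces\<close>

primrec C_k_on :: "nat \<Rightarrow> 'a::real_normed_vector set \<Rightarrow> ('a \<Rightarrow> 'b::real_normed_vector) \<Rightarrow> bool" where
  "C_k_on 0 S f \<longleftrightarrow> continuous_on S f"
| "C_k_on (Suc k) S f \<longleftrightarrow>
     (\<forall>x\<in>S. f differentiable (at x)) \<and> (\<forall>v. C_k_on k S (\<lambda>x. frechet_derivative f (at x) v))"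

text \<open>Only used for open \<open>S\<close>.\<close>

definition smooth_on :: "'a::real_normed_vector set \<Rightarrow> ('a \<Rightarrow> 'b::real_normed_vector) \<Rightarrow> bool" where
  "smooth_on S f \<longleftrightarrow> (\<forall>k. C_k_on k S f)"

section \<open>Smooth manifolds\<close>

text \<open>The manifold is the whole type \<open>'a\<close> (Hausdorff and second countable in the theorem), modelled
  on the Euclidean space \<open>'e\<close>, so its dimension is \<open>DIM('e)\<close>. The atlas need not be maximal.\<close>

type_synonym ('a, 'e) atlas = "('a set \<times> ('a \<Rightarrow> 'e)) set"

definition is_chart :: "'a::topological_space set \<Rightarrow> ('a \<Rightarrow> 'e::euclidean_space) \<Rightarrow> bool" where
  "is_chart U \<phi> \<longleftrightarrow> open U \<and> open (\<phi> ` U) \<and> homeomorphism U (\<phi> ` U) \<phi> (inv_into U \<phi>)"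

definition smooth_atlas :: "('a::topological_space, 'e::euclidean_space) atlas \<Rightarrow> bool" where
  "smooth_atlas A \<longleftrightarrow>
     (\<forall>(U, \<phi>)\<in>A. is_chart U \<phi>) \<and>
     (\<Union>(U, \<phi>)\<in>A. U) = UNIV \<and>
     (\<forall>(U, \<phi>)\<in>A. \<forall>(V, \<psi>)\<in>A. smooth_on (\<phi> ` (U \<inter> V)) (\<psi> \<circ> inv_into U \<phi>))"

definition smooth_fun :: "('a, 'e::euclidean_space) atlas \<Rightarrow> ('a \<Rightarrow> real) \<Rightarrow> bool" where
  "smooth_fun A h \<longleftrightarrow> (\<forall>(U, \<phi>)\<in>A. smooth_on (\<phi> ` U) (h \<circ> inv_into U \<phi>))"

text \<open>Smooth maps from an open subset of a Euclidean space into the manifold.\<close>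

definition smooth_map_into ::
  "('a::topological_space, 'e::euclidean_space) atlas \<Rightarrow> 'd::euclidean_space set \<Rightarrow> ('d \<Rightarrow> 'a) \<Rightarrow> bool" where
  "smooth_map_into A S F \<longleftrightarrow>
     continuous_on S F \<and> (\<forall>(U, \<phi>)\<in>A. smooth_on (S \<inter> F -` U) (\<phi> \<circ> F))"

section \<open>Tangent vectors, vector fields, Lie bracket\<close>

text \<open>Tangent vectors at \<open>x\<close> are the derivations at \<open>x\<close> of the algebra of smooth functions. As HOL
  functions are total, they are normalised to \<open>0\<close> on non-smooth arguments; this makes equality
  of tangent vectors the intended one.\<close>

type_synonym 'a tangent = "('a \<Rightarrow> real) \<Rightarrow> real"
type_synonym 'a vfield = "'a \<Rightarrow> 'a tangent"
type_synonym 'a tensor11 = "'a \<Rightarrow> 'a tangent \<Rightarrow> 'a tangent"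
type_synonym 'a oneform = "'a \<Rightarrow> 'a tangent \<Rightarrow> real"
type_synonym 'a tensor02 = "'a \<Rightarrow> 'a tangent \<Rightarrow> 'a tangent \<Rightarrow> real"

definition tangent_space :: "('a, 'e::euclidean_space) atlas \<Rightarrow> 'a \<Rightarrow> 'a tangent set" where
  "tangent_space A x = {v.
     (\<forall>h. \<not> smooth_fun A h \<longrightarrow> v h = 0) \<and>
     (\<forall>h k. smooth_fun A h \<longrightarrow> smooth_fun A k \<longrightarrow> v (\<lambda>y. h y + k y) = v h + v k) \<and>
     (\<forall>c h. smooth_fun A h \<longrightarrow> v (\<lambda>y. c * h y) = c * v h) \<and>
     (\<forall>h k. smooth_fun A h \<longrightarrow> smooth_fun A k \<longrightarrow> v (\<lambda>y. h y * k y) = v h * k x + h x * v k)}"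

definition vfield_app :: "'a vfield \<Rightarrow> ('a \<Rightarrow> real) \<Rightarrow> 'a \<Rightarrow> real" where
  "vfield_app X h = (\<lambda>x. X x h)"

definition vector_field :: "('a, 'e::euclidean_space) atlas \<Rightarrow> 'a vfield \<Rightarrow> bool" where
  "vector_field A X \<longleftrightarrow>
     (\<forall>x. X x \<in> tangent_space A x) \<and> (\<forall>h. smooth_fun A h \<longrightarrow> smooth_fun A (vfield_app X h))"

definition lie_bracket :: "('a, 'e::euclidean_space) atlas \<Rightarrow> 'a vfield \<Rightarrow> 'a vfield \<Rightarrow> 'a vfield" where
  "lie_bracket A X Y = (\<lambda>x h. if smooth_fun A h
     then X x (vfield_app Y h) - Y x (vfield_app X h) else 0)"

definition differential ::
  "('a, 'e::euclidean_space) atlas \<Rightarrow> ('d::euclidean_space \<Rightarrow> 'a) \<Rightarrow> 'd \<Rightarrow> 'd \<Rightarrow> 'a tangent" where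
  "differential A F t w =
     (\<lambda>h. if smooth_fun A h then frechet_derivative (h \<circ> F) (at t) w else 0)"

section \<open>Tensor fields\<close>

text \<open>Pointwise linear on tangent spaces; smooth in the sense that smooth vector fields are mapped
  to smooth objects. Values outside the tangent spaces are irrelevant.\<close>

definition tensor_app :: "'a tensor11 \<Rightarrow> 'a vfield \<Rightarrow> 'a vfield" where
  "tensor_app f X = (\<lambda>x. f x (X x))"

definition oneform_app :: "'a oneform \<Rightarrow> 'a vfield \<Rightarrow> 'a \<Rightarrow> real" where
  "oneform_app \<omega> X = (\<lambda>x. \<omega> x (X x))"

definition tensor02_app :: "'a tensor02 \<Rightarrow> 'a vfield \<Rightarrow> 'a vfield \<Rightarrow> 'a \<Rightarrow> real" where
  "tensor02_app B X Y = (\<lambda>x. B x (X x) (Y x))"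

definition tensor11_field :: "('a, 'e::euclidean_space) atlas \<Rightarrow> 'a tensor11 \<Rightarrow> bool" where
  "tensor11_field A f \<longleftrightarrow>
     (\<forall>x. \<forall>v\<in>tangent_space A x. f x v \<in> tangent_space A x) \<and>
     (\<forall>x. \<forall>u\<in>tangent_space A x. \<forall>v\<in>tangent_space A x. f x (u + v) = f x u + f x v) \<and>
     (\<forall>x c. \<forall>v\<in>tangent_space A x. f x (c *\<^sub>R v) = c *\<^sub>R f x v) \<and>
     (\<forall>X. vector_field A X \<longrightarrow> vector_field A (tensor_app f X))"

definition oneform_field :: "('a, 'e::euclidean_space) atlas \<Rightarrow> 'a oneform \<Rightarrow> bool" where
  "oneform_field A \<omega> \<longleftrightarrow>
     (\<forall>x. \<forall>u\<in>tangent_space A x. \<forall>v\<in>tangent_space A x. \<omega> x (u + v) = \<omega> x u + \<omega> x v) \<and>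
     (\<forall>x c. \<forall>v\<in>tangent_space A x. \<omega> x (c *\<^sub>R v) = c * \<omega> x v) \<and>
     (\<forall>X. vector_field A X \<longrightarrow> smooth_fun A (oneform_app \<omega> X))"

definition riemannian_metric :: "('a, 'e::euclidean_space) atlas \<Rightarrow> 'a tensor02 \<Rightarrow> bool" where
  "riemannian_metric A g \<longleftrightarrow>
     (\<forall>x. \<forall>u\<in>tangent_space A x. \<forall>v\<in>tangent_space A x. \<forall>w\<in>tangent_space A x.
        g x (u + v) w = g x u w + g x v w) \<and>
     (\<forall>x c. \<forall>u\<in>tangent_space A x. \<forall>w\<in>tangent_space A x. g x (c *\<^sub>R u) w = c * g x u w) \<and>
     (\<forall>x. \<forall>u\<in>tangent_space A x. \<forall>v\<in>tangent_space A x. g x u v = g x v u) \<and>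
     (\<forall>x. \<forall>u\<in>tangent_space A x. u \<noteq> 0 \<longrightarrow> g x u u > 0) \<and>
     (\<forall>X Y. vector_field A X \<longrightarrow> vector_field A Y \<longrightarrow> smooth_fun A (tensor02_app g X Y))"

section \<open>Levi-Civita connection and Killing fields\<close>

text \<open>\<open>nabla X Y\<close> is the covariant derivative of \<open>Y\<close> in direction \<open>X\<close>; it is only constrained on
  (smooth) vector fields.\<close>

definition affine_connection ::
  "('a, 'e::euclidean_space) atlas \<Rightarrow> ('a vfield \<Rightarrow> 'a vfield \<Rightarrow> 'a vfield) \<Rightarrow> bool" where
  "affine_connection A nabla \<longleftrightarrow>
     (\<forall>X Y. vector_field A X \<longrightarrow> vector_field A Y \<longrightarrow> vector_field A (nabla X Y)) \<and>
     (\<forall>X X' Y. vector_field A X \<longrightarrow> vector_field A X' \<longrightarrow> vector_field A Y \<longrightarrow>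
        nabla (X + X') Y = nabla X Y + nabla X' Y) \<and>
     (\<forall>h X Y. smooth_fun A h \<longrightarrow> vector_field A X \<longrightarrow> vector_field A Y \<longrightarrow>
        nabla (\<lambda>x. h x *\<^sub>R X x) Y = (\<lambda>x. h x *\<^sub>R nabla X Y x)) \<and>
     (\<forall>X Y Y'. vector_field A X \<longrightarrow> vector_field A Y \<longrightarrow> vector_field A Y' \<longrightarrow>
        nabla X (Y + Y') = nabla X Y + nabla X Y') \<and>
     (\<forall>h X Y. smooth_fun A h \<longrightarrow> vector_field A X \<longrightarrow> vector_field A Y \<longrightarrow>
        nabla X (\<lambda>x. h x *\<^sub>R Y x) = (\<lambda>x. vfield_app X h x *\<^sub>R Y x + h x *\<^sub>R nabla X Y x))"

definition levi_civita_connection ::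
  "('a, 'e::euclidean_space) atlas \<Rightarrow> 'a tensor02 \<Rightarrow> ('a vfield \<Rightarrow> 'a vfield \<Rightarrow> 'a vfield) \<Rightarrow> bool" where
  "levi_civita_connection A g nabla \<longleftrightarrow>
     affine_connection A nabla \<and>
     (\<forall>X Y. vector_field A X \<longrightarrow> vector_field A Y \<longrightarrow> nabla X Y - nabla Y X = lie_bracket A X Y) \<and>
     (\<forall>X Y Z. vector_field A X \<longrightarrow> vector_field A Y \<longrightarrow> vector_field A Z \<longrightarrow>
        vfield_app X (tensor02_app g Y Z) =
          (\<lambda>x. tensor02_app g (nabla X Y) Z x + tensor02_app g Y (nabla X Z) x))"

definition lie_derivative_metric ::
  "('a, 'e::euclidean_space) atlas \<Rightarrow> 'a vfield \<Rightarrow> 'a tensor02 \<Rightarrow> 'a vfield \<Rightarrow> 'a vfield \<Rightarrow> 'a \<Rightarrow> real" where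
  "lie_derivative_metric A Z g X Y = (\<lambda>x.
     vfield_app Z (tensor02_app g X Y) x
     - tensor02_app g (lie_bracket A Z X) Y x - tensor02_app g X (lie_bracket A Z Y) x)"

definition killing_field :: "('a, 'e::euclidean_space) atlas \<Rightarrow> 'a tensor02 \<Rightarrow> 'a vfield \<Rightarrow> bool" where
  "killing_field A g Z \<longleftrightarrow> vector_field A Z \<and>
     (\<forall>X Y. vector_field A X \<longrightarrow> vector_field A Y \<longrightarrow> (\<forall>x. lie_derivative_metric A Z g X Y x = 0))"

section \<open>Distributions\<close>

text \<open>An injectively immersed piece of an integral manifold of the distribution \<open>D\<close>, given by a
  parametrisation \<open>F\<close> on an open set \<open>S\<close>: its tangent spaces are exactly the spaces of \<open>D\<close>.\<close>

definition integral_manifold ::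
  "('a::topological_space, 'e::euclidean_space) atlas \<Rightarrow> ('a \<Rightarrow> 'a tangent set) \<Rightarrow>
   'd::euclidean_space set \<Rightarrow> ('d \<Rightarrow> 'a) \<Rightarrow> bool" where
  "integral_manifold A D S F \<longleftrightarrow>
     open S \<and> smooth_map_into A S F \<and> inj_on F S \<and>
     (\<forall>t\<in>S. inj (differential A F t) \<and> range (differential A F t) = D (F t))"

text \<open>Integrability: every point lies on an integral manifold. This is the geometric notion, not
  closure of \<open>D\<close> under the Lie bracket (equivalent to it by the Frobenius theorem). The argument
  of type \<open>'d itself\<close> only fixes the parameter space, whose dimension is the rank of \<open>D\<close>.\<close>

definition integrable_distribution ::
  "'d::euclidean_space itself \<Rightarrow> ('a::topological_space, 'e::euclidean_space) atlas \<Rightarrow>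
   ('a \<Rightarrow> 'a tangent set) \<Rightarrow> bool" where
  "integrable_distribution T A D \<longleftrightarrow>
     (\<forall>x. \<exists>(S :: 'd set) F. integral_manifold A D S F \<and> x \<in> F ` S)"

definition totally_geodesic ::
  "('a, 'e::euclidean_space) atlas \<Rightarrow> ('a vfield \<Rightarrow> 'a vfield \<Rightarrow> 'a vfield) \<Rightarrow>
   ('a \<Rightarrow> 'a tangent set) \<Rightarrow> bool" where
  "totally_geodesic A nabla D \<longleftrightarrow>
     (\<forall>X Y. vector_field A X \<longrightarrow> vector_field A Y \<longrightarrow> (\<forall>x. X x \<in> D x) \<longrightarrow> (\<forall>x. Y x \<in> D x) \<longrightarrow>
        (\<forall>x. (nabla X Y + nabla Y X) x \<in> D x))"

definition totally_geodesic_foliation ::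
  "'d::euclidean_space itself \<Rightarrow> ('a::topological_space, 'e::euclidean_space) atlas \<Rightarrow>
   ('a vfield \<Rightarrow> 'a vfield \<Rightarrow> 'a vfield) \<Rightarrow> ('a \<Rightarrow> 'a tangent set) \<Rightarrow> bool" where
  "totally_geodesic_foliation T A nabla D \<longleftrightarrow>
     integrable_distribution T A D \<and> totally_geodesic A nabla D"

section \<open>Metric weak f-structures\<close>

definition char_distribution ::
  "('a, 'e::euclidean_space) atlas \<Rightarrow> 'a tensor11 \<Rightarrow> 'a \<Rightarrow> 'a tangent set" where
  "char_distribution A f x = {v \<in> tangent_space A x. f x v = 0}"

text \<open>The indices \<open>1, \<dots>, p\<close> are the elements of a finite type \<open>'p\<close> with \<open>p = CARD('p)\<close>.
  The tensor identities are stated for tangent vectors.\<close>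

definition metric_weak_f_structure ::
  "('a, 'e::euclidean_space) atlas \<Rightarrow> nat \<Rightarrow> 'a tensor11 \<Rightarrow> 'a tensor11 \<Rightarrow>
   ('p::finite \<Rightarrow> 'a vfield) \<Rightarrow> ('p \<Rightarrow> 'a oneform) \<Rightarrow> 'a tensor02 \<Rightarrow> bool" where
  "metric_weak_f_structure A n f Q \<xi> \<eta> g \<longleftrightarrow>
     DIM('e) = 2 * n + CARD('p) \<and>
     tensor11_field A f \<and> tensor11_field A Q \<and>
     (\<forall>x. dim (f x ` tangent_space A x) = 2 * n) \<and>
     (\<forall>x. bij_betw (Q x) (tangent_space A x) (tangent_space A x)) \<and>
     (\<forall>x. \<forall>v\<in>tangent_space A x. f x (f x (f x v)) + f x (Q x v) = 0) \<and>
     (\<forall>x. \<forall>v\<in>char_distribution A f x. Q x v = v) \<and>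
     (\<forall>i. vector_field A (\<xi> i)) \<and>
     (\<forall>x. span (range (\<lambda>i. \<xi> i x)) = char_distribution A f x) \<and>
     (\<forall>i. oneform_field A (\<eta> i)) \<and>
     (\<forall>x. \<forall>v\<in>tangent_space A x. f x (f x v) = - Q x v + (\<Sum>i\<in>UNIV. \<eta> i x v *\<^sub>R \<xi> i x)) \<and>
     (\<forall>i j x. \<eta> i x (\<xi> j x) = (if i = j then 1 else 0)) \<and>
     riemannian_metric A g \<and>
     (\<forall>i x. g x (\<xi> i x) (\<xi> i x) = 1) \<and>
     (\<forall>x. \<forall>u\<in>tangent_space A x. \<forall>v\<in>tangent_space A x.
        g x (f x u) (f x v) = g x u (Q x v) - (\<Sum>i\<in>UNIV. \<eta> i x u * \<eta> i x (Q x v)))"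

text \<open>Exterior derivatives with the normalising factors \<open>1/2\<close> and \<open>1/3\<close>.\<close>

definition d_oneform ::
  "('a, 'e::euclidean_space) atlas \<Rightarrow> 'a oneform \<Rightarrow> 'a vfield \<Rightarrow> 'a vfield \<Rightarrow> 'a \<Rightarrow> real" where
  "d_oneform A \<omega> X Y = (\<lambda>x.
     (vfield_app X (oneform_app \<omega> Y) x - vfield_app Y (oneform_app \<omega> X) x
       - oneform_app \<omega> (lie_bracket A X Y) x) / 2)"

definition d_twoform ::
  "('a, 'e::euclidean_space) atlas \<Rightarrow> 'a tensor02 \<Rightarrow> 'a vfield \<Rightarrow> 'a vfield \<Rightarrow> 'a vfield \<Rightarrow> 'a \<Rightarrow> real" where
  "d_twoform A B X Y Z = (\<lambda>x.
     (vfield_app X (tensor02_app B Y Z) x + vfield_app Y (tensor02_app B Z X) x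
       + vfield_app Z (tensor02_app B X Y) x
       - tensor02_app B (lie_bracket A X Y) Z x - tensor02_app B (lie_bracket A Z X) Y x
       - tensor02_app B (lie_bracket A Y Z) X x) / 3)"

definition nijenhuis_torsion ::
  "('a, 'e::euclidean_space) atlas \<Rightarrow> 'a tensor11 \<Rightarrow> 'a vfield \<Rightarrow> 'a vfield \<Rightarrow> 'a vfield" where
  "nijenhuis_torsion A f X Y =
     tensor_app f (tensor_app f (lie_bracket A X Y))
     + lie_bracket A (tensor_app f X) (tensor_app f Y)
     - tensor_app f (lie_bracket A (tensor_app f X) Y)
     - tensor_app f (lie_bracket A X (tensor_app f Y))"

definition normal_structure ::
  "('a, 'e::euclidean_space) atlas \<Rightarrow> 'a tensor11 \<Rightarrow> ('p::finite \<Rightarrow> 'a vfield) \<Rightarrow>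
   ('p \<Rightarrow> 'a oneform) \<Rightarrow> bool" where
  "normal_structure A f \<xi> \<eta> \<longleftrightarrow>
     (\<forall>X Y. vector_field A X \<longrightarrow> vector_field A Y \<longrightarrow>
        (\<forall>x. nijenhuis_torsion A f X Y x
             + 2 *\<^sub>R (\<Sum>i\<in>UNIV. d_oneform A (\<eta> i) X Y x *\<^sub>R \<xi> i x) = 0))"

definition fundamental_form :: "'a tensor11 \<Rightarrow> 'a tensor02 \<Rightarrow> 'a tensor02" where
  "fundamental_form f g x u v = g x u (f x v)"

definition weak_K_structure ::
  "('a, 'e::euclidean_space) atlas \<Rightarrow> nat \<Rightarrow> 'a tensor11 \<Rightarrow> 'a tensor11 \<Rightarrow>
   ('p::finite \<Rightarrow> 'a vfield) \<Rightarrow> ('p \<Rightarrow> 'a oneform) \<Rightarrow> 'a tensor02 \<Rightarrow> bool" where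
  "weak_K_structure A n f Q \<xi> \<eta> g \<longleftrightarrow>
     metric_weak_f_structure A n f Q \<xi> \<eta> g \<and>
     normal_structure A f \<xi> \<eta> \<and>
     (\<forall>X Y Z. vector_field A X \<longrightarrow> vector_field A Y \<longrightarrow> vector_field A Z \<longrightarrow>
        (\<forall>x. d_twoform A (fundamental_form f g) X Y Z x = 0))"

end

theory Submission
  imports Defs
begin

text \<open>Compatibility of \<open>g\<close> and \<open>f\<close> makes \<open>\<eta>\<^sup>i\<close> the metric dual of \<open>\<xi>\<^sub>i\<close>, and a trace inequality gives
  \<open>\<eta>\<^sup>i \<circ> f = 0\<close>. Splitting the normality condition for \<open>(X, \<xi>\<^sub>j)\<close> into its part along the \<open>\<xi>\<close>'s and its
  \<open>f\<close>-part yields \<open>L\<^sub>\<xi> \<eta>\<^sup>i = 0\<close>, \<open>L\<^sub>\<xi> f = 0\<close> and \<open>[\<xi>\<^sub>i, \<xi>\<^sub>j] = 0\<close>. Together with \<open>d\<Phi> = 0\<close> this gives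
  \<open>(L\<^sub>\<xi> g)(Y, f Z) = 0\<close> and \<open>(L\<^sub>\<xi> g)(Y, \<xi>\<^sub>i) = 0\<close>; as \<open>Q = - f\<^sup>2 + \<Sum> \<eta>\<^sup>i \<otimes> \<xi>\<^sub>i\<close> is nonsingular, \<open>\<xi>\<close> is Killing.
  The vanishing of \<open>\<nabla>\<^sub>\<xi> \<xi>\<close> is then formal, since the \<open>\<xi>\<^sub>i\<close> are orthonormal commuting Killing fields.
  Integral manifolds of \<open>ker f\<close> are parametrised by the time-one map of \<open>\<Sum> t\<^sub>i \<xi>\<^sub>i\<close>.\<close>

section \<open>Calculus of smooth functions\<close>

text \<open>Two encodings shape the proof. Tangent vectors are derivations of globally defined
  smooth functions, so every local object must be cut off before a derivation or a bracket can see
  it: bump functions extend coordinates and coordinate fields, and Hadamard's lemma shows that a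
  derivation is determined by its values on coordinates. Integrability asks for actual integral
  manifolds, so vanishing brackets of the \<open>\<xi> i\<close> must be turned into a smooth
  injective map; its derivative is itself a combination of the fields along the map, and from this
  equation smoothness of every order follows. The identity \<open>\<eta> i x (f x v) = 0\<close> is
  not among the axioms and has to precede any use of normality, since it is what separates the two
  parts of that equation. The final passage to arbitrary arguments of the Lie derivative of g
  represents a vector as \<open>Q x z\<close> at a single point only; hence this Lie derivative has
  to be shown tensorial.\<close>

lemma C_k_on_Suc_imp: "C_k_on (Suc k) S f \<Longrightarrow> C_k_on k S f"
proof (induction k arbitrary: f)
  case 0
  then show ?case
    by (auto intro!: continuous_at_imp_continuous_on differentiable_imp_continuous_within)
qed auto

lemma C_k_on_subset: "C_k_on k S f \<Longrightarrow> T \<subseteq> S \<Longrightarrow> C_k_on k T f"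
  by (induction k arbitrary: f) (auto intro: continuous_on_subset)

lemma differentiable_transform_open:
  assumes "open S" "x \<in> S" "\<And>x. x \<in> S \<Longrightarrow> f x = g x" "f differentiable (at x)"
  shows "g differentiable (at x)"
  using assms unfolding differentiable_def
  by (meson has_derivative_transform_within_open)

lemma C_k_on_cong:
  assumes "open S" "\<And>x. x \<in> S \<Longrightarrow> f x = g x" "C_k_on k S f"
  shows "C_k_on k S g"
  using assms(2,3)
proof (induction k arbitrary: f g)
  case 0
  then show ?case by (metis C_k_on.simps(1) continuous_on_cong)
next
  case (Suc k)
  have *: "f differentiable (at x)" if "x \<in> S" for x
    using Suc.prems(2) that by auto
  have "frechet_derivative f (at x) = frechet_derivative g (at x)" if "x \<in> S" for x
    using frechet_derivative_transform_within_open[OF *[OF that] assms(1) that] Suc.prems(1) by blast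
  then have "C_k_on k S (\<lambda>x. frechet_derivative g (at x) v)" for v
    using Suc.IH[of "\<lambda>x. frechet_derivative f (at x) v" "\<lambda>x. frechet_derivative g (at x) v"] Suc.prems(2)
    by simp
  moreover have "g differentiable (at x)" if "x \<in> S" for x
    using differentiable_transform_open[OF assms(1) that _ *[OF that]] Suc.prems(1) by auto
  ultimately show ?case by simp
qed

text \<open>Lets any explicitly known derivative replace \<open>frechet_derivative\<close>; since
  \<open>S\<close> is open, agreement on \<open>S\<close> carries over to all further
  derivatives.\<close>

lemma C_k_on_SucI:
  assumes "open S" "\<And>x. x \<in> S \<Longrightarrow> (f has_derivative f' x) (at x)"
    and "\<And>v. C_k_on k S (\<lambda>x. f' x v)"
  shows "C_k_on (Suc k) S f"
proof -
  have "frechet_derivative f (at x) = f' x" if "x \<in> S" for x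
    using frechet_derivative_at[OF assms(2)[OF that]] by simp
  then have "C_k_on k S (\<lambda>x. frechet_derivative f (at x) v)" for v
    using C_k_on_cong[OF assms(1) _ assms(3)[of v], of "\<lambda>x. frechet_derivative f (at x) v"] by simp
  then show ?thesis using assms(2) by (auto simp: differentiable_def)
qed

lemma C_k_on_SucD:
  assumes "C_k_on (Suc k) S f"
  shows "x \<in> S \<Longrightarrow> (f has_derivative frechet_derivative f (at x)) (at x)"
    and "C_k_on k S (\<lambda>x. frechet_derivative f (at x) v)"
  using assms by (auto simp: frechet_derivative_works)

text \<open>\<open>C_k_on\<close> differentiates at points of the ambient space, so it can be
  checked on open neighbourhoods; this is what allows gluing.\<close>

lemma C_k_on_local:
  assumes "\<And>x. x \<in> S \<Longrightarrow> \<exists>T. open T \<and> x \<in> T \<and> C_k_on k T f"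
  shows "C_k_on k S f"
  using assms
proof (induction k arbitrary: f)
  case 0
  then show ?case
    by (auto intro!: continuous_at_imp_continuous_on) (meson continuous_on_eq_continuous_at)
next
  case (Suc k)
  have "C_k_on k S (\<lambda>x. frechet_derivative f (at x) v)" for v
    by (rule Suc.IH) (use Suc.prems in fastforce)
  moreover have "f differentiable (at x)" if "x \<in> S" for x
    using Suc.prems[OF that] by auto
  ultimately show ?case by simp
qed

lemma C_k_on_const: "C_k_on k S (\<lambda>x. c)"
proof (induction k arbitrary: c)
  case (Suc k)
  then show ?case by (auto simp: frechet_derivative_const)
qed auto

lemma C_k_on_bounded_linear:
  assumes "bounded_linear f" "open S"
  shows "C_k_on k S f"
proof (cases k)
  case 0
  then show ?thesis using assms(1) by (auto intro: linear_continuous_on)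
next
  case (Suc m)
  then show ?thesis
    using C_k_on_SucI[OF assms(2), of f "\<lambda>x. f"] assms(1)
    by (auto intro: bounded_linear_imp_has_derivative C_k_on_const)
qed

lemma C_k_on_add:
  assumes "open S" "C_k_on k S f" "C_k_on k S g"
  shows "C_k_on k S (\<lambda>x. f x + g x)"
  using assms(2,3)
proof (induction k arbitrary: f g)
  case (Suc k)
  show ?case
    by (rule C_k_on_SucI[OF assms(1)])
       (use C_k_on_SucD[OF Suc.prems(1)] C_k_on_SucD[OF Suc.prems(2)] Suc.IH
        in \<open>auto intro!: has_derivative_add\<close>)
qed (auto intro: continuous_on_add)

lemma (in bounded_bilinear) C_k_on:
  assumes "open S" "C_k_on k S f" "C_k_on k S g"
  shows "C_k_on k S (\<lambda>x. prod (f x) (g x))"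
  using assms(2,3)
proof (induction k arbitrary: f g)
  case (Suc k)
  note f = C_k_on_SucD[OF Suc.prems(1)] C_k_on_Suc_imp[OF Suc.prems(1)]
  note g = C_k_on_SucD[OF Suc.prems(2)] C_k_on_Suc_imp[OF Suc.prems(2)]
  show ?case
    by (rule C_k_on_SucI[OF assms(1) FDERIV]) (use f g Suc.IH assms(1) in \<open>auto intro!: C_k_on_add\<close>)
qed (auto intro: continuous_on)

lemma C_k_on_sum:
  assumes "open S" "\<And>i. i \<in> I \<Longrightarrow> C_k_on k S (f i)"
  shows "C_k_on k S (\<lambda>x. \<Sum>i\<in>I. f i x)"
  using assms(2)
  by (induction I rule: infinite_finite_induct) (auto intro: C_k_on_const C_k_on_add[OF assms(1)])

lemma linear_eq_sum_Basis:
  fixes f :: "'a::euclidean_space \<Rightarrow> 'b::real_vector"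
  assumes "linear f"
  shows "f v = (\<Sum>b\<in>Basis. (v \<bullet> b) *\<^sub>R f b)"
  by (metis (mono_tags, lifting) assms euclidean_representation linear_scale linear_sum sum.cong)

lemma C_k_on_compose:
  fixes f :: "'a::real_normed_vector \<Rightarrow> 'b::euclidean_space"
  assumes "open S" "open T" "f ` S \<subseteq> T" "C_k_on k S f" "C_k_on k T g"
  shows "C_k_on k S (\<lambda>x. g (f x))"
  using assms(4,5)
proof (induction k arbitrary: g)
  case 0
  then show ?case using assms(3) by (auto intro: continuous_on_compose2)
next
  case (Suc k)
  note f = C_k_on_SucD[OF Suc.prems(1)] C_k_on_Suc_imp[OF Suc.prems(1)]
  note g = C_k_on_SucD[OF Suc.prems(2)]
  have "linear (frechet_derivative g (at (f x)))" if "x \<in> S" for x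
    using g(1)[of "f x"] assms(3) that by (auto dest: has_derivative_linear)
  \<comment> \<open>The direction \<open>frechet_derivative f (at x) v\<close> varies with x,
    whereas \<open>C_k_on\<close> and the induction hypothesis speak of fixed directions; expanding
    over \<open>Basis\<close> leaves only varying scalars.\<close>
  then have eq: "(\<Sum>b\<in>Basis. (frechet_derivative f (at x) v \<bullet> b) *\<^sub>R frechet_derivative g (at (f x)) b)
      = frechet_derivative g (at (f x)) (frechet_derivative f (at x) v)" if "x \<in> S" for x v
    using linear_eq_sum_Basis that by metis
  show ?case
  proof (rule C_k_on_SucI[OF assms(1)])
    fix x assume x: "x \<in> S"
    show "((\<lambda>x. g (f x)) has_derivative
        (\<lambda>v. frechet_derivative g (at (f x)) (frechet_derivative f (at x) v))) (at x)"
      using has_derivative_compose[OF f(1)[OF x] g(1)[of "f x"]] x assms(3) by auto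
  next
    fix v
    have "C_k_on k S (\<lambda>x. \<Sum>b\<in>Basis. (frechet_derivative f (at x) v \<bullet> b) *\<^sub>R
            frechet_derivative g (at (f x)) b)"
      by (intro C_k_on_sum assms(1) bounded_bilinear.C_k_on[OF bounded_bilinear_scaleR]
          bounded_bilinear.C_k_on[OF bounded_bilinear_inner] C_k_on_const f(2) Suc.IH[OF f(3)] g(2))
    then show "C_k_on k S (\<lambda>x. frechet_derivative g (at (f x)) (frechet_derivative f (at x) v))"
      by (rule C_k_on_cong[OF assms(1), rotated]) (rule eq)
  qed
qed

lemma smooth_on_subset: "smooth_on S f \<Longrightarrow> T \<subseteq> S \<Longrightarrow> smooth_on T f"
  by (auto simp: smooth_on_def intro: C_k_on_subset)

lemma smooth_on_cong:
  assumes "open S" "\<And>x. x \<in> S \<Longrightarrow> f x = g x" "smooth_on S f"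
  shows "smooth_on S g"
  using assms by (auto simp: smooth_on_def intro: C_k_on_cong)

lemma smooth_on_Un: "open S \<Longrightarrow> open T \<Longrightarrow> smooth_on S f \<Longrightarrow> smooth_on T f \<Longrightarrow> smooth_on (S \<union> T) f"
  unfolding smooth_on_def by (blast intro: C_k_on_local)

lemma smooth_on_const: "smooth_on S (\<lambda>x. c)"
  by (auto simp: smooth_on_def intro: C_k_on_const)

lemma smooth_on_bounded_linear: "bounded_linear f \<Longrightarrow> open S \<Longrightarrow> smooth_on S f"
  by (auto simp: smooth_on_def intro: C_k_on_bounded_linear)

lemma smooth_on_id: "open S \<Longrightarrow> smooth_on S (\<lambda>x. x)"
  by (rule smooth_on_bounded_linear) (rule bounded_linear_ident)

lemma smooth_on_add:
  "open S \<Longrightarrow> smooth_on S f \<Longrightarrow> smooth_on S g \<Longrightarrow> smooth_on S (\<lambda>x. f x + g x)"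
  by (auto simp: smooth_on_def intro: C_k_on_add)

lemma (in bounded_bilinear) smooth_on:
  "open S \<Longrightarrow> smooth_on S f \<Longrightarrow> smooth_on S g \<Longrightarrow> smooth_on S (\<lambda>x. prod (f x) (g x))"
  by (auto simp: smooth_on_def intro: C_k_on)

lemmas smooth_on_mult = bounded_bilinear.smooth_on[OF bounded_bilinear_mult]
lemmas smooth_on_scaleR = bounded_bilinear.smooth_on[OF bounded_bilinear_scaleR]
lemmas smooth_on_inner = bounded_bilinear.smooth_on[OF bounded_bilinear_inner]

lemma smooth_on_diff:
  fixes f g :: "'a::real_normed_vector \<Rightarrow> 'b::real_normed_vector"
  assumes "open S" "smooth_on S f" "smooth_on S g"
  shows "smooth_on S (\<lambda>x. f x - g x)"
  using smooth_on_add[OF assms(1,2) smooth_on_scaleR[OF assms(1) smooth_on_const[of _ "-1"] assms(3)]]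
  by simp

lemma smooth_on_sum:
  "open S \<Longrightarrow> (\<And>i. i \<in> I \<Longrightarrow> smooth_on S (f i)) \<Longrightarrow> smooth_on S (\<lambda>x. \<Sum>i\<in>I. f i x)"
  by (auto simp: smooth_on_def intro!: C_k_on_sum)

lemma smooth_on_compose:
  fixes f :: "'a::real_normed_vector \<Rightarrow> 'b::euclidean_space"
  shows "open S \<Longrightarrow> open T \<Longrightarrow> f ` S \<subseteq> T \<Longrightarrow> smooth_on S f \<Longrightarrow> smooth_on T g \<Longrightarrow>
    smooth_on S (\<lambda>x. g (f x))"
  by (auto simp: smooth_on_def intro: C_k_on_compose)

lemma smooth_on_has_derivative:
  "smooth_on S f \<Longrightarrow> x \<in> S \<Longrightarrow> (f has_derivative frechet_derivative f (at x)) (at x)"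
  unfolding smooth_on_def by (metis C_k_on_SucD(1))

lemma smooth_on_frechet_derivative:
  "smooth_on S f \<Longrightarrow> smooth_on S (\<lambda>x. frechet_derivative f (at x) v)"
  unfolding smooth_on_def using C_k_on_SucD(2) by blast

lemma smooth_on_imp_continuous_on: "smooth_on S f \<Longrightarrow> continuous_on S f"
  unfolding smooth_on_def by (metis C_k_on.simps(1))

lemma smooth_on_frechet_derivative_along:
  fixes f :: "'a::euclidean_space \<Rightarrow> 'b::real_normed_vector"
  assumes "open S" "smooth_on S f" "smooth_on S X"
  shows "smooth_on S (\<lambda>x. frechet_derivative f (at x) (X x))"
proof (rule smooth_on_cong[OF assms(1)])
  show "smooth_on S (\<lambda>x. \<Sum>b\<in>Basis. (X x \<bullet> b) *\<^sub>R frechet_derivative f (at x) b)"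
    by (intro smooth_on_sum smooth_on_scaleR smooth_on_inner smooth_on_const
        smooth_on_frechet_derivative assms)
  fix x assume "x \<in> S"
  then show "(\<Sum>b\<in>Basis. (X x \<bullet> b) *\<^sub>R frechet_derivative f (at x) b) = frechet_derivative f (at x) (X x)"
    by (metis linear_eq_sum_Basis has_derivative_linear smooth_on_has_derivative[OF assms(2)])
qed

section \<open>Smooth bump functions\<close>

text \<open>The functions t^(-k) exp(-1/t), extended by 0. The powers are carried along because the
  derivative is a combination of the members with exponents \<open>k + 1\<close> and
  \<open>k + 2\<close>, which closes the induction for smoothness.\<close>

definition flat_exp :: "nat \<Rightarrow> real \<Rightarrow> real" where
  "flat_exp k t = (if t > 0 then inverse t ^ k * exp (- inverse t) else 0)"

text \<open>This is the difference quotient at 0, as \<open>flat_exp k 0 = 0\<close>. From the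
  right, u = 1/t turns it into u^(k+1) / exp u at infinity; from the left it is identically
  0.\<close>

lemma flat_exp_quotient_tendsto_0:
  "((\<lambda>t. flat_exp k t / t) \<longlongrightarrow> 0) (at 0)"
proof -
  have "((\<lambda>u::real. u ^ (Suc k) / exp u) \<longlongrightarrow> 0) at_top"
    by (rule tendsto_power_div_exp_0)
  then have "((\<lambda>t::real. inverse t ^ (Suc k) / exp (inverse t)) \<longlongrightarrow> 0) (at_right 0)"
    using filterlim_compose[OF _ filterlim_inverse_at_top_right] by blast
  moreover have "\<forall>\<^sub>F t in at_right 0. inverse t ^ (Suc k) / exp (inverse t) = flat_exp k t / t"
    by (auto simp: eventually_at_filter flat_exp_def exp_minus divide_simps)
  ultimately have "((\<lambda>t. flat_exp k t / t) \<longlongrightarrow> 0) (at_right 0)"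
    using tendsto_cong by fast
  moreover have "((\<lambda>t. flat_exp k t / t) \<longlongrightarrow> 0) (at_left 0)"
    by (rule tendsto_eventually) (auto simp: eventually_at_filter flat_exp_def)
  ultimately show ?thesis by (simp add: filterlim_split_at)
qed

lemma flat_exp_has_derivative:
  "(flat_exp k has_real_derivative (flat_exp (k + 2) t - real k * flat_exp (k + 1) t)) (at t)"
proof (cases t "0::real" rule: linorder_cases)
  case less
  have "((\<lambda>t::real. 0) has_real_derivative 0) (at t)" by simp
  then have "(flat_exp k has_real_derivative 0) (at t)"
    by (rule has_field_derivative_transform_within_open[of _ _ _ "{..<0}"])
       (use less in \<open>auto simp: flat_exp_def\<close>)
  then show ?thesis using less by (simp add: flat_exp_def)
next
  case equal
  have "(flat_exp k has_real_derivative 0) (at 0)"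
    using flat_exp_quotient_tendsto_0[of k] by (simp add: DERIV_def flat_exp_def)
  then show ?thesis using equal by (simp add: flat_exp_def)
next
  case greater
  have "((\<lambda>t. inverse t ^ k * exp (- inverse t)) has_real_derivative
     (inverse t ^ k * (exp (- inverse t) * inverse t ^ 2)
      - (real k * inverse t ^ (k - 1) * inverse t) * inverse t * exp (- inverse t))) (at t)"
    using greater
    by (auto intro!: derivative_eq_intros simp: power2_eq_square algebra_simps)
  also have "real k * inverse t ^ (k - 1) * inverse t = real k * inverse t ^ k"
    by (cases k) auto
  also have "inverse t ^ k * (exp (- inverse t) * inverse t ^ 2)
      - real k * inverse t ^ k * inverse t * exp (- inverse t)
      = flat_exp (k + 2) t - real k * flat_exp (k + 1) t"
    using greater by (simp add: flat_exp_def power_add power2_eq_square)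
  finally have "((\<lambda>t. inverse t ^ k * exp (- inverse t)) has_real_derivative
     (flat_exp (k + 2) t - real k * flat_exp (k + 1) t)) (at t)" .
  then show ?thesis
    by (rule has_field_derivative_transform_within_open[of _ _ _ "{0<..}"])
       (use greater in \<open>auto simp: flat_exp_def\<close>)
qed

lemma smooth_on_flat_exp: "smooth_on UNIV (flat_exp k)"
proof -
  have "C_k_on m UNIV (flat_exp k)" for m
  proof (induction m arbitrary: k)
    case 0
    show ?case
      by (auto intro!: continuous_at_imp_continuous_on DERIV_isCont flat_exp_has_derivative)
  next
    case (Suc m)
    show ?case
    proof (rule C_k_on_SucI)
      show "(flat_exp k has_derivative
          (\<lambda>v. (flat_exp (k + 2) t + (- real k) * flat_exp (k + 1) t) * v)) (at t)" for t
        using flat_exp_has_derivative[of k t] by (simp add: has_field_derivative_def)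
      show "C_k_on m UNIV (\<lambda>t. (flat_exp (k + 2) t + (- real k) * flat_exp (k + 1) t) * v)" for v
        by (intro bounded_bilinear.C_k_on[OF bounded_bilinear_mult] C_k_on_add C_k_on_const Suc.IH open_UNIV)
    qed auto
  qed
  then show ?thesis by (simp add: smooth_on_def)
qed

text \<open>The inner \<open>flat_exp\<close> exceeds the threshold near the centre, where the outer one vanishes
  identically; this gives a plateau without dividing smooth functions.\<close>

lemma bump_exists:
  fixes c :: "'e::euclidean_space"
  assumes "0 < r" "r < R"
  obtains b :: "'e \<Rightarrow> real" where "smooth_on UNIV b" "\<And>y. y \<in> cball c r \<Longrightarrow> b y = 1"
    "\<And>y. y \<notin> cball c R \<Longrightarrow> b y = 0"
proof
  let ?d = "R\<^sup>2 - r\<^sup>2"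
  have d: "?d > 0" using assms by (simp add: power_strict_mono)
  let ?k = "flat_exp 0 ?d"
  let ?q = "\<lambda>y. R\<^sup>2 - (y - c) \<bullet> (y - c)"
  \<comment> \<open>\<open>?k\<close> is the inner value on the sphere of radius \<open>r\<close>.
    Where the inner function vanishes, the outer one equals \<open>flat_exp 0 ?k\<close>, and the
    constant factor scales this to 1.\<close>
  let ?b = "\<lambda>y. 1 - flat_exp 0 (?k - flat_exp 0 (?q y)) * inverse (flat_exp 0 ?k)"
  have k: "?k > 0" using d by (simp add: flat_exp_def)
  have q: "smooth_on UNIV ?q"
    by (intro smooth_on_diff smooth_on_inner smooth_on_const smooth_on_id open_UNIV)
  show "smooth_on UNIV ?b"
    by (intro smooth_on_diff smooth_on_mult smooth_on_const open_UNIV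
        smooth_on_compose[OF _ _ _ _ smooth_on_flat_exp] q) auto
  show "?b y = 1" if "y \<in> cball c r" for y
  proof -
    have "norm (y - c) \<le> r" using that by (simp add: dist_norm norm_minus_commute)
    then have "(y - c) \<bullet> (y - c) \<le> r\<^sup>2"
      by (metis dot_square_norm norm_ge_zero power_mono)
    then have "?d \<le> ?q y" by simp
    then have "?k \<le> flat_exp 0 (?q y)" using d by (auto simp: flat_exp_def le_imp_inverse_le)
    then show ?thesis by (simp add: flat_exp_def)
  qed
  show "?b y = 0" if "y \<notin> cball c R" for y
  proof -
    have "R < norm (y - c)" using that by (simp add: dist_norm norm_minus_commute)
    then have "R\<^sup>2 < (y - c) \<bullet> (y - c)"
      using assms by (metis dot_square_norm less_eq_real_def order_less_trans power_strict_mono zero_less_numeral)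
    then have "flat_exp 0 (?q y) = 0" by (simp add: flat_exp_def)
    moreover have "flat_exp 0 ?k > 0" using k by (simp add: flat_exp_def)
    ultimately show ?thesis by simp
  qed
qed

section \<open>Hadamard's lemma\<close>

text \<open>Differentiation under the integral sign replaces \<open>u\<close> by a directional
  derivative and, by the chain rule for c + s (y - c), brings out one more factor s. The weight
  \<open>s ^ m\<close> makes the family closed under this, so the induction runs over all
  \<open>u\<close> and \<open>m\<close>.\<close>

lemma C_k_on_ray_average:
  fixes u :: "'e::euclidean_space \<Rightarrow> real"
  assumes "smooth_on (ball c r) u"
  shows "C_k_on k (ball c r) (\<lambda>y. integral {0..1} (\<lambda>s. s ^ m * u (c + s *\<^sub>R (y - c))))"
  using assms
proof (induction k arbitrary: u m)
  case (0 u m)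
  have mem: "c + s *\<^sub>R (y - c) \<in> ball c r" if "y \<in> ball c r" "s \<in> {0..1}" for y s
  proof -
    have "s * norm (y - c) \<le> norm (y - c)" using that by (simp add: mult_left_le_one_le)
    then show ?thesis using that by (simp add: dist_norm norm_minus_commute)
  qed
  have "continuous_on (ball c r \<times> cbox 0 1) (\<lambda>(y, s). s ^ m * u (c + s *\<^sub>R (y - c)))"
    unfolding split_def
    by (intro continuous_intros continuous_on_compose2[OF smooth_on_imp_continuous_on[OF "0"]])
       (use mem in \<open>auto simp: box_real\<close>)
  from integral_continuous_on_param[OF this] show ?case by simp
next
  case (Suc k)
  let ?D = "\<lambda>y. frechet_derivative u (at y)"
  have mem: "c + s *\<^sub>R (y - c) \<in> ball c r" if "y \<in> ball c r" "s \<in> {0..1}" for y s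
  proof -
    have "s * norm (y - c) \<le> norm (y - c)" using that by (simp add: mult_left_le_one_le)
    then show ?thesis using that by (simp add: dist_norm norm_minus_commute)
  qed
  \<comment> \<open>The Leibniz rule expects derivatives of bounded-linear-function type.
    \<open>Blinfun\<close> is meaningful only where its argument is bounded linear, hence the
    evaluation \<open>fx\<close> is confined to the ball and the unit interval.\<close>
  let ?fx = "\<lambda>y s. Blinfun (\<lambda>v. s ^ Suc m * ?D (c + s *\<^sub>R (y - c)) v)"
  have bl: "bounded_linear (\<lambda>v. s ^ Suc m * ?D (c + s *\<^sub>R (y - c)) v)"
    if "y \<in> ball c r" "s \<in> {0..1}" for y s
    using has_derivative_bounded_linear[OF smooth_on_has_derivative[OF Suc.prems mem[OF that]]]
    by (rule bounded_linear_const_mult)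
  have fx: "blinfun_apply (?fx y s) v = s ^ Suc m * ?D (c + s *\<^sub>R (y - c)) v"
    if "y \<in> ball c r" "s \<in> {0..1}" for y s v
    using bounded_linear_Blinfun_apply[OF bl[OF that]] by simp
  have contD: "continuous_on (ball c r \<times> cbox 0 1) (\<lambda>(y, s). s ^ Suc m * ?D (c + s *\<^sub>R (y - c)) v)" for v
    unfolding split_def
    by (intro continuous_intros continuous_on_compose2[OF smooth_on_imp_continuous_on[OF
          smooth_on_frechet_derivative[OF Suc.prems]]])
       (use mem in \<open>auto simp: box_real\<close>)
  have cont: "continuous_on (ball c r \<times> cbox 0 1) (\<lambda>(y, s). ?fx y s)"
  proof (rule continuous_on_blinfun_componentwise)
    fix i :: 'e
    have "continuous_on (ball c r \<times> cbox 0 1) (\<lambda>z. blinfun_apply (case z of (y, s) \<Rightarrow> ?fx y s) i)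
      \<longleftrightarrow> continuous_on (ball c r \<times> cbox 0 1) (\<lambda>(y, s). s ^ Suc m * ?D (c + s *\<^sub>R (y - c)) i)"
      by (rule continuous_on_cong) (use fx in \<open>auto simp: box_real\<close>)
    then show "continuous_on (ball c r \<times> cbox 0 1) (\<lambda>z. blinfun_apply (case z of (y, s) \<Rightarrow> ?fx y s) i)"
      using contD by blast
  qed
  show ?case
  proof (rule C_k_on_SucI[OF open_ball])
    fix y assume y: "y \<in> ball c r"
    have "((\<lambda>y. integral (cbox 0 1) (\<lambda>s. s ^ m * u (c + s *\<^sub>R (y - c)))) has_derivative
        integral (cbox 0 1) (?fx y)) (at y within ball c r)"
    proof (rule leibniz_rule[OF _ _ cont y convex_ball])
      fix y s assume y: "y \<in> ball c r" and "s \<in> cbox 0 (1::real)"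
      then have s: "s \<in> {0..1}" by (simp add: box_real)
      have "((\<lambda>y. s ^ m * u (c + s *\<^sub>R (y - c))) has_derivative
             (\<lambda>v. s ^ m * ?D (c + s *\<^sub>R (y - c)) (s *\<^sub>R v))) (at y)"
        by (rule has_derivative_mult_right, rule has_derivative_compose[where f = "\<lambda>y. c + s *\<^sub>R (y - c)", OF _
            smooth_on_has_derivative[OF Suc.prems mem[OF y s]]]) (auto intro!: derivative_eq_intros)
      moreover have "(\<lambda>v. s ^ m * ?D (c + s *\<^sub>R (y - c)) (s *\<^sub>R v)) = blinfun_apply (?fx y s)"
        using linear_scale[OF has_derivative_linear[OF smooth_on_has_derivative[OF Suc.prems mem[OF y s]]]]
        by (intro ext, subst fx[OF y s]) (simp add: ac_simps)
      ultimately show "((\<lambda>y. s ^ m * u (c + s *\<^sub>R (y - c))) has_derivative blinfun_apply (?fx y s))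
          (at y within ball c r)"
        by (metis has_derivative_at_withinI)
    next
      fix y assume y: "y \<in> ball c r"
      show "(\<lambda>s. s ^ m * u (c + s *\<^sub>R (y - c))) integrable_on cbox 0 1"
        by (intro integrable_continuous continuous_intros
            continuous_on_compose2[OF smooth_on_imp_continuous_on[OF Suc.prems]])
           (use mem[OF y] in \<open>auto simp: box_real\<close>)
    qed
    then show "((\<lambda>y. integral {0..1} (\<lambda>s. s ^ m * u (c + s *\<^sub>R (y - c)))) has_derivative
        blinfun_apply (integral {0..1} (?fx y))) (at y)"
      using at_within_open[OF y open_ball] by simp
  next
    fix v
    have "blinfun_apply (integral {0..1} (?fx y)) v
        = integral {0..1} (\<lambda>s. s ^ Suc m * ?D (c + s *\<^sub>R (y - c)) v)" if y: "y \<in> ball c r" for y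
    proof -
      have "continuous_on (cbox 0 1) (\<lambda>s. (\<lambda>(y, s). ?fx y s) (y, s))"
        by (rule continuous_on_compose2[OF cont]) (use y in \<open>auto intro!: continuous_intros\<close>)
      then have "?fx y integrable_on {0..1}"
        using integrable_continuous by fastforce
      then have "blinfun_apply (integral {0..1} (?fx y)) v = integral {0..1} (\<lambda>s. blinfun_apply (?fx y s) v)"
        by (rule blinfun_apply_integral)
      also have "\<dots> = integral {0..1} (\<lambda>s. s ^ Suc m * ?D (c + s *\<^sub>R (y - c)) v)"
        by (rule integral_cong) (use fx[OF y] in auto)
      finally show ?thesis .
    qed
    then show "C_k_on k (ball c r) (\<lambda>y. blinfun_apply (integral {0..1} (?fx y)) v)"
      using C_k_on_cong[OF open_ball _ Suc.IH[OF smooth_on_frechet_derivative[OF Suc.prems, of v], of "Suc m"],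
          of "\<lambda>y. blinfun_apply (integral {0..1} (?fx y)) v"]
      by simp
  qed
qed

text \<open>The fundamental theorem of calculus along the segment from c to y: \<open>w a\<close> is
  the mean over the segment of the partial derivative in direction a, which for y = c is the mean of
  a constant.\<close>

lemma hadamard:
  fixes u :: "'e::euclidean_space \<Rightarrow> real"
  assumes u: "smooth_on (ball c r) u" and r: "r > 0"
  obtains w :: "'e \<Rightarrow> 'e \<Rightarrow> real" where "\<And>a. smooth_on (ball c r) (w a)"
    "\<And>y. y \<in> ball c r \<Longrightarrow> u y = u c + (\<Sum>a\<in>Basis. ((y - c) \<bullet> a) * w a y)"
    "\<And>a. w a c = frechet_derivative u (at c) a"
proof
  let ?D = "\<lambda>y. frechet_derivative u (at y)"
  let ?w = "\<lambda>a y. integral {0..1} (\<lambda>s. ?D (c + s *\<^sub>R (y - c)) a)"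
  have mem: "c + s *\<^sub>R (y - c) \<in> ball c r" if "y \<in> ball c r" "s \<in> {0..1}" for y s
  proof -
    have "s * norm (y - c) \<le> norm (y - c)" using that by (simp add: mult_left_le_one_le)
    then show ?thesis using that by (simp add: dist_norm norm_minus_commute)
  qed
  show "smooth_on (ball c r) (?w a)" for a
    using C_k_on_ray_average[OF smooth_on_frechet_derivative[OF u], of _ 0] by (simp add: smooth_on_def)
  show "?w a c = ?D c a" for a by simp
  show "u y = u c + (\<Sum>a\<in>Basis. ((y - c) \<bullet> a) * ?w a y)" if y: "y \<in> ball c r" for y
  proof -
    have "((\<lambda>s. ?D (c + s *\<^sub>R (y - c)) (y - c)) has_integral u (c + 1 *\<^sub>R (y - c)) - u (c + 0 *\<^sub>R (y - c))) {0..1}"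
    proof (rule fundamental_theorem_of_calculus)
      fix s :: real assume s: "s \<in> {0..1}"
      have "((\<lambda>s. u (c + s *\<^sub>R (y - c))) has_derivative (\<lambda>t. ?D (c + s *\<^sub>R (y - c)) (t *\<^sub>R (y - c)))) (at s)"
        by (rule has_derivative_compose[where f = "\<lambda>s. c + s *\<^sub>R (y - c)",
              OF _ smooth_on_has_derivative[OF u mem[OF y s]]])
           (auto intro!: derivative_eq_intros)
      then show "((\<lambda>s. u (c + s *\<^sub>R (y - c))) has_vector_derivative ?D (c + s *\<^sub>R (y - c)) (y - c)) (at s within {0..1})"
        unfolding has_vector_derivative_def
        using linear_scale[OF has_derivative_linear[OF smooth_on_has_derivative[OF u mem[OF y s]]]]
        by (auto intro: has_derivative_at_withinI)
    qed simp
    then have "u y - u c = integral {0..1} (\<lambda>s. ?D (c + s *\<^sub>R (y - c)) (y - c))"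
      by (simp add: integral_unique)
    also have "\<dots> = integral {0..1} (\<lambda>s. \<Sum>a\<in>Basis. ((y - c) \<bullet> a) * ?D (c + s *\<^sub>R (y - c)) a)"
    proof (rule integral_cong)
      fix s :: real assume s: "s \<in> {0..1}"
      show "?D (c + s *\<^sub>R (y - c)) (y - c) = (\<Sum>a\<in>Basis. ((y - c) \<bullet> a) * ?D (c + s *\<^sub>R (y - c)) a)"
        using linear_eq_sum_Basis[OF has_derivative_linear[OF smooth_on_has_derivative[OF u mem[OF y s]]], of "y - c"]
        by (simp only: real_scaleR_def)
    qed
    also have "\<dots> = (\<Sum>a\<in>Basis. ((y - c) \<bullet> a) * ?w a y)"
    proof (subst integral_sum)
      show "(\<lambda>s. ((y - c) \<bullet> a) * ?D (c + s *\<^sub>R (y - c)) a) integrable_on {0..1}" for a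
        by (intro integrable_continuous_real continuous_intros
            continuous_on_compose2[OF smooth_on_imp_continuous_on[OF smooth_on_frechet_derivative[OF u]]])
           (use mem[OF y] in auto)
    qed auto
    finally show ?thesis by simp
  qed
qed

section \<open>Integral maps of commuting vector fields\<close>

lemma linear_norm_le_sum_Basis:
  fixes f :: "'a::euclidean_space \<Rightarrow> 'b::real_normed_vector"
  assumes "linear f"
  shows "norm (f v) \<le> (\<Sum>b\<in>Basis. norm (f b)) * norm v"
proof -
  have "norm (f v) = norm (\<Sum>b\<in>Basis. (v \<bullet> b) *\<^sub>R f b)"
    using linear_eq_sum_Basis[OF assms] by metis
  also have "\<dots> \<le> (\<Sum>b\<in>Basis. norm (f b) * norm v)"
    by (intro sum_norm_le) (metis norm_scaleR mult.commute mult_right_mono norm_ge_zero Basis_le_norm)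
  finally show ?thesis by (simp add: sum_distrib_right)
qed

text \<open>Mean value inequality on a convex ball. Smoothness provides continuity of the derivative
  for each fixed direction, so its operator norm is bounded through the finitely many basis
  directions.\<close>

lemma smooth_on_lipschitz_cball:
  fixes f :: "'a::euclidean_space \<Rightarrow> 'b::real_normed_vector"
  assumes f: "smooth_on S f" and sub: "cball c R \<subseteq> S"
  obtains L where "L \<ge> 0" "\<And>y z. y \<in> cball c R \<Longrightarrow> z \<in> cball c R \<Longrightarrow> norm (f y - f z) \<le> L * norm (y - z)"
proof -
  let ?D = "\<lambda>y. frechet_derivative f (at y)"
  have "\<forall>b. \<exists>B. \<forall>y\<in>cball c R. norm (?D y b) \<le> B"
    using compact_continuous_image[OF continuous_on_subset[OF smooth_on_imp_continuous_on[OF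
          smooth_on_frechet_derivative[OF f]] sub] compact_cball]
    by (metis (no_types, lifting) bounded_iff compact_imp_bounded image_eqI)
  then obtain B where B: "\<And>b y. y \<in> cball c R \<Longrightarrow> norm (?D y b) \<le> B b" by metis
  define L where "L = (\<Sum>b\<in>Basis. \<bar>B b\<bar>)"
  have "norm (f y - f z) \<le> L * norm (y - z)" if "y \<in> cball c R" "z \<in> cball c R" for y z
  proof (rule differentiable_bound[OF convex_cball _ _ that])
    fix x assume x: "x \<in> cball c R"
    then have D: "(f has_derivative ?D x) (at x)" using smooth_on_has_derivative[OF f] sub by blast
    then show "(f has_derivative ?D x) (at x within cball c R)" by (rule has_derivative_at_withinI)
    have "norm (?D x v) \<le> L * norm v" for v
    proof -
      have "norm (?D x v) \<le> (\<Sum>b\<in>Basis. norm (?D x b)) * norm v"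
        by (rule linear_norm_le_sum_Basis[OF has_derivative_linear[OF D]])
      also have "\<dots> \<le> L * norm v" unfolding L_def
        by (intro mult_right_mono sum_mono) (use B[OF x] in \<open>auto intro: order_trans[OF _ abs_ge_self]\<close>)
      finally show ?thesis .
    qed
    then show "onorm (?D x) \<le> L" by (rule onorm_le)
  qed
  then show ?thesis by (intro that[of L]) (auto simp: L_def sum_nonneg)
qed

text \<open>The derivative is Lipschitz on the ball, hence along the segment it differs from its
  value at y by at most C |z - y|; linearising about y multiplies this by |z - y|.\<close>

lemma smooth_on_taylor_cball:
  fixes f :: "'a::euclidean_space \<Rightarrow> 'b::real_normed_vector"
  assumes f: "smooth_on S f" and sub: "cball c R \<subseteq> S"
  obtains C where "C \<ge> 0" "\<And>y z. y \<in> cball c R \<Longrightarrow> z \<in> cball c R \<Longrightarrow>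
    norm (f z - f y - frechet_derivative f (at y) (z - y)) \<le> C * (norm (z - y))\<^sup>2"
proof -
  let ?D = "\<lambda>y. frechet_derivative f (at y)"
  have "\<forall>b. \<exists>L\<ge>0. \<forall>y\<in>cball c R. \<forall>z\<in>cball c R. norm (?D y b - ?D z b) \<le> L * norm (y - z)"
    using smooth_on_lipschitz_cball[OF smooth_on_frechet_derivative[OF f] sub] by metis
  then obtain L where L0: "\<And>b. L b \<ge> 0"
    and L: "\<And>b y z. y \<in> cball c R \<Longrightarrow> z \<in> cball c R \<Longrightarrow> norm (?D y b - ?D z b) \<le> L b * norm (y - z)"
    by metis
  define C where "C = (\<Sum>b\<in>Basis. L b)"
  have D: "(f has_derivative ?D y) (at y)" if "y \<in> cball c R" for y
    using smooth_on_has_derivative[OF f] sub that by blast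
  have "norm (f z - f y - ?D y (z - y)) \<le> C * (norm (z - y))\<^sup>2"
    if y: "y \<in> cball c R" and z: "z \<in> cball c R" for y z
  proof -
    have seg: "y + t *\<^sub>R (z - y) \<in> cball c R" if "t \<in> {0..1}" for t
      using convexD_alt[OF convex_cball y z, of t] that by (simp add: algebra_simps)
    let ?B = "C * norm (z - y)"
    have "norm (f z - f y - ?D y (z - y)) \<le> norm (z - y) * ?B"
    proof (rule differentiable_bound_linearization[of y z "closed_segment y z" f ?D y ?B])
      show "\<And>t. t \<in> {0..1} \<Longrightarrow> y + t *\<^sub>R (z - y) \<in> closed_segment y z"
        by (auto simp: in_segment algebra_simps)
      fix x assume "x \<in> closed_segment y z"
      then obtain t where t: "t \<in> {0..1}" "x = y + t *\<^sub>R (z - y)"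
        by (auto simp: in_segment algebra_simps)
      then have x: "x \<in> cball c R" using seg by auto
      show "(f has_derivative ?D x) (at x within closed_segment y z)"
        using D[OF x] by (rule has_derivative_at_withinI)
      have "norm (x - y) \<le> norm (z - y)" using t by (simp add: mult_left_le_one_le)
      have "norm (?D x v - ?D y v) \<le> ?B * norm v" for v
      proof -
        have "linear (\<lambda>v. ?D x v - ?D y v)"
          by (intro linear_compose_sub has_derivative_linear[OF D] x y)
        then have "norm (?D x v - ?D y v) \<le> (\<Sum>b\<in>Basis. norm (?D x b - ?D y b)) * norm v"
          by (rule linear_norm_le_sum_Basis)
        also have "\<dots> \<le> (\<Sum>b\<in>Basis. L b * norm (z - y)) * norm v"
        proof (intro mult_right_mono sum_mono)
          fix b
          have "norm (?D x b - ?D y b) \<le> L b * norm (x - y)" by (rule L[OF x y])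
          also have "\<dots> \<le> L b * norm (z - y)"
            using \<open>norm (x - y) \<le> norm (z - y)\<close> L0 by (rule mult_left_mono)
          finally show "norm (?D x b - ?D y b) \<le> L b * norm (z - y)" .
        qed auto
        finally show ?thesis by (simp add: C_def sum_distrib_right)
      qed
      then show "onorm (?D x - ?D y) \<le> ?B" by (intro onorm_le) (simp add: fun_diff_def)
    qed auto
    then show ?thesis by (simp add: power2_eq_square ac_simps)
  qed
  then show ?thesis by (intro that[of C]) (auto simp: C_def sum_nonneg L0)
qed

text \<open>On the unit interval a global Lipschitz constant 1/2 makes the Picard operator a
  contraction without any shrinking of time, and the bound r keeps the solution within distance r of
  c.\<close>

lemma picard_unit_interval:
  fixes f :: "'e::euclidean_space \<Rightarrow> 'e"
  assumes lip: "\<And>y z. norm (f y - f z) \<le> 1/2 * norm (y - z)"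
    and bd: "\<And>y. norm (f y) \<le> r"
  obtains u where "u 0 = c" "\<And>s. s \<in> {0..1} \<Longrightarrow> u s \<in> cball c r"
    "\<And>s. s \<in> {0..1} \<Longrightarrow> (u has_vector_derivative f (u s)) (at s within {0..1})"
proof -
  \<comment> \<open>Banach's theorem is applied to bounded continuous functions on all of
    \<open>real\<close>; clamping the upper limit of integration to [0,1] keeps the operator inside
    that space and changes nothing on the interval itself.\<close>
  define cl where "cl = (\<lambda>s::real. max 0 (min 1 s))"
  have cl: "cl s \<in> {0..1}" for s by (auto simp: cl_def)
  have contf: "continuous_on UNIV f"
    by (rule lipschitz_on_continuous_on[of "1/2"], rule lipschitz_onI)
       (use lip in \<open>auto simp: dist_norm\<close>)
  have contfu: "continuous_on S (\<lambda>s. f (apply_bcontfun u s))" for u :: "real \<Rightarrow>\<^sub>C 'e" and S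
    by (rule continuous_on_compose2[OF contf]) (auto intro: continuous_on_subset[OF continuous_on_apply_bcontfun])
  then have intf: "(\<lambda>s. f (apply_bcontfun u s)) integrable_on {a..b}" for u :: "real \<Rightarrow>\<^sub>C 'e" and a b
    by (rule integrable_continuous_real)
  define P where "P = (\<lambda>(u::real \<Rightarrow>\<^sub>C 'e) s. c + integral {0..cl s} (\<lambda>s. f (apply_bcontfun u s)))"
  have Pb: "norm (integral {0..cl s} (\<lambda>s. f (apply_bcontfun u s))) \<le> r" for u s
  proof -
    have "norm (integral {0..cl s} (\<lambda>s. f (apply_bcontfun u s))) \<le> r * (cl s - 0)"
      by (rule integral_bound) (use cl[of s] bd contfu in auto)
    also have "\<dots> \<le> r * 1" using cl[of s] order_trans[OF norm_ge_zero bd]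
      by (intro mult_left_mono) auto
    finally show ?thesis by simp
  qed
  have "P u \<in> bcontfun" for u
  proof (rule bcontfun_normI)
    have "continuous_on {0..1} (\<lambda>s. integral {0..s} (\<lambda>s. f (apply_bcontfun u s)))"
      by (rule indefinite_integral_continuous_1[OF intf])
    then show "continuous_on UNIV (P u)" unfolding P_def
      by (intro continuous_intros, elim continuous_on_compose2) (auto simp: cl_def intro!: continuous_intros)
    show "norm (P u x) \<le> norm c + r" for x
      unfolding P_def using Pb[of x u] norm_triangle_ineq by (meson add_left_mono order_trans)
  qed
  then have P: "apply_bcontfun (Bcontfun (P u)) = P u" for u
    by (rule Bcontfun_inverse)
  have "\<exists>!u. Bcontfun (P u) = u"
  proof (rule banach_fix_type[of "1/2"])
    show "\<forall>u v. dist (Bcontfun (P u)) (Bcontfun (P v)) \<le> 1/2 * dist u v"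
    proof (intro allI dist_bound)
      fix u v s
      have "dist (P u s) (P v s)
        = norm (integral {0..cl s} (\<lambda>s. f (apply_bcontfun u s) - f (apply_bcontfun v s)))"
        unfolding P_def by (simp add: dist_norm integral_diff[OF intf intf])
      also have "\<dots> \<le> (1/2 * dist u v) * (cl s - 0)"
      proof (rule integral_bound)
        fix s
        have "norm (f (apply_bcontfun u s) - f (apply_bcontfun v s))
            \<le> 1/2 * dist (apply_bcontfun u s) (apply_bcontfun v s)"
          using lip by (simp add: dist_norm)
        also have "\<dots> \<le> 1/2 * dist u v" using dist_bounded[of u s v] by simp
        finally show "norm (f (apply_bcontfun u s) - f (apply_bcontfun v s)) \<le> 1/2 * dist u v" .
      qed (use cl[of s] contfu in \<open>auto intro!: continuous_on_diff\<close>)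
      also have "\<dots> \<le> (1/2 * dist u v) * 1" using cl[of s] by (intro mult_left_mono) auto
      finally show "dist (apply_bcontfun (Bcontfun (P u)) s) (apply_bcontfun (Bcontfun (P v)) s)
          \<le> 1/2 * dist u v" by (simp add: P)
    qed
  qed auto
  then obtain u where "Bcontfun (P u) = u" by auto
  then have "apply_bcontfun u = P u" by (metis P)
  moreover define I where "I = (\<lambda>s. integral {0..s} (\<lambda>s. f (apply_bcontfun u s)))"
  ultimately have u: "apply_bcontfun u s = c + I (cl s)" for s
    by (metis P_def)
  have I0: "I 0 = 0" by (simp add: I_def)
  have Ib: "norm (I (cl s)) \<le> r" for s
    using Pb[where u = u and s = s] by (simp only: I_def)
  show ?thesis
  proof
    show "apply_bcontfun u 0 = c" by (simp add: u cl_def I0)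
    show "apply_bcontfun u s \<in> cball c r" if "s \<in> {0..1}" for s
      using Ib[of s] by (simp add: u dist_norm)
    fix s :: real assume s: "s \<in> {0..1}"
    have "(I has_vector_derivative f (apply_bcontfun u s)) (at s within {0..1})"
      unfolding I_def by (rule integral_has_vector_derivative[OF contfu s])
    then have "((\<lambda>s. c + I s) has_vector_derivative f (apply_bcontfun u s)) (at s within {0..1})"
      using has_vector_derivative_add[OF has_vector_derivative_const] by fastforce
    then show "(apply_bcontfun u has_vector_derivative f (apply_bcontfun u s)) (at s within {0..1})"
      by (rule has_vector_derivative_transform[OF s, rotated]) (simp add: u cl_def)
  qed
qed

text \<open>A Gronwall estimate for the constant 1/2: at a point t of maximal norm the mean value
  inequality on an interval of length at most 1 gives |w t| <= |w t| / 2 + B, and the half is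
  absorbed.\<close>

lemma half_gronwall:
  fixes w :: "real \<Rightarrow> 'a::real_normed_vector"
  assumes w: "\<And>s. s \<in> {0..1} \<Longrightarrow> (w has_vector_derivative w' s) (at s within {0..1})"
    and w0: "w 0 = 0" and bd: "\<And>s. s \<in> {0..1} \<Longrightarrow> norm (w' s) \<le> 1/2 * norm (w s) + B"
  shows "norm (w 1) \<le> 2 * B"
proof -
  have "continuous_on {0..1} w"
    using w by (meson continuous_on_eq_continuous_within has_vector_derivative_continuous)
  then have "continuous_on {0..1} (\<lambda>s. norm (w s))" by (intro continuous_intros)
  then have "\<exists>t\<in>{0..1}. \<forall>s\<in>{0..1}. norm (w s) \<le> norm (w t)"
    by (intro continuous_attains_sup) auto
  then obtain t where t: "t \<in> {0..1}" and max: "\<And>s. s \<in> {0..1} \<Longrightarrow> norm (w s) \<le> norm (w t)"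
    by blast
  let ?K = "1/2 * norm (w t) + B"
  have "norm (w t - w 0) \<le> ?K * norm (t - 0)"
  proof (rule differentiable_bound[of "{0..1}" w "\<lambda>s v. v *\<^sub>R w' s"])
    fix s :: real assume s: "s \<in> {0..1}"
    show "(w has_derivative (\<lambda>v. v *\<^sub>R w' s)) (at s within {0..1})"
      using w[OF s] by (simp add: has_vector_derivative_def)
    have "norm (w' s) \<le> ?K" using bd[OF s] max[OF s] by simp
    then have "norm (v *\<^sub>R w' s) \<le> ?K * norm v" for v :: real
      using mult_right_mono[of "norm (w' s)" ?K "norm v"] by (simp add: mult.commute)
    then show "onorm (\<lambda>v. v *\<^sub>R w' s) \<le> ?K" by (rule onorm_le)
  qed (use t in auto)
  also have "\<dots> \<le> ?K * 1"
    using t order_trans[OF norm_ge_zero bd[OF t]] by (intro mult_left_mono) auto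
  finally have "norm (w t) \<le> 2 * B" using w0 by simp
  then show ?thesis using max[of 1] by simp
qed

text \<open>The integral map is \<open>t \<mapsto> y\<^sub>t(1)\<close> with \<open>y\<^sub>t' = V t y\<^sub>t\<close>. Commutativity makes
  \<open>y\<^sub>t(s) + s V h (y\<^sub>t(s))\<close> a solution for the parameter \<open>t + h\<close> up to \<open>O(|h|\<^sup>2)\<close>, so the map is
  differentiable without any general theorem on smooth dependence on parameters.\<close>

lemma commuting_integral_map:
  fixes V :: "'d::euclidean_space \<Rightarrow> 'e::euclidean_space \<Rightarrow> 'e" and DV :: "'d \<Rightarrow> 'e \<Rightarrow> 'e \<Rightarrow> 'e"
  assumes R: "R > 0"
    and lin: "\<And>y. linear (\<lambda>t. V t y)"
    and M: "M \<ge> 0" "\<And>t y. y \<in> cball c R \<Longrightarrow> norm (V t y) \<le> M * norm t"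
    and L: "L \<ge> 0" "\<And>t y z. y \<in> cball c R \<Longrightarrow> z \<in> cball c R \<Longrightarrow>
      norm (V t y - V t z) \<le> L * norm t * norm (y - z)"
    and C: "C \<ge> 0" "\<And>t y z. y \<in> cball c R \<Longrightarrow> z \<in> cball c R \<Longrightarrow>
      norm (V t z - V t y - DV t y (z - y)) \<le> C * norm t * (norm (z - y))\<^sup>2"
    and der: "\<And>t y. y \<in> cball c R \<Longrightarrow> (V t has_derivative DV t y) (at y)"
    and comm: "\<And>s t y. y \<in> cball c R \<Longrightarrow> DV s y (V t y) = DV t y (V s y)"
  obtains \<delta> F where "\<delta> > 0" "F 0 = c" "\<And>t. t \<in> ball 0 \<delta> \<Longrightarrow> F t \<in> cball c (R/2)"
    "\<And>t. t \<in> ball 0 \<delta> \<Longrightarrow> (F has_derivative (\<lambda>h. V h (F t))) (at t)"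
proof -
  \<comment> \<open>The first bound makes \<open>M * norm t\<close> at most R/2: solutions stay in
    the half ball, and room remains for a perturbation by \<open>V h\<close> inside radius R. The
    second yields the constant 1/2 of the Picard and Gronwall estimates. The added 1 avoids division
    by zero.\<close>
  define \<delta> where "\<delta> = min (R / 2 / (M + 1)) (1 / 2 / (L + 1))"
  have \<delta>: "\<delta> > 0" using R M(1) L(1) by (simp add: \<delta>_def)
  have \<delta>M: "M * norm t \<le> R / 2" and \<delta>L: "L * norm t \<le> 1 / 2" if "t \<in> ball 0 \<delta>" for t :: 'd
  proof -
    have t: "norm t \<le> R / 2 / (M + 1)" "norm t \<le> 1 / 2 / (L + 1)" using that by (auto simp: \<delta>_def)
    have "M * norm t \<le> (M + 1) * norm t" by (simp add: algebra_simps)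
    also have "\<dots> \<le> R / 2" using t(1) M(1) by (simp add: field_simps)
    finally show "M * norm t \<le> R / 2" .
    have "L * norm t \<le> (L + 1) * norm t" by (simp add: algebra_simps)
    also have "\<dots> \<le> 1 / 2" using t(2) L(1) by (simp add: field_simps)
    finally show "L * norm t \<le> 1 / 2" .
  qed
  have half: "cball c (R/2) \<subseteq> cball c R" using R by auto
  have "\<exists>u. u 0 = c \<and> (\<forall>s\<in>{0..1}. u s \<in> cball c (R/2)) \<and>
      (\<forall>s\<in>{0..1}. (u has_vector_derivative V t (u s)) (at s within {0..1}))" if t: "t \<in> ball 0 \<delta>" for t
  proof -
    \<comment> \<open>Nearest-point projection is 1-Lipschitz, so \<open>V t\<close> composed with
      it is bounded and Lipschitz everywhere; as the solution stays in the half ball, the projection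
      drops out again.\<close>
    let ?p = "closest_point (cball c (R/2))"
    have p: "?p y \<in> cball c (R/2)" for y using R by (intro closest_point_in_set) auto
    have "norm (V t (?p y) - V t (?p z)) \<le> 1/2 * norm (y - z)" for y z
    proof -
      have "norm (V t (?p y) - V t (?p z)) \<le> L * norm t * norm (?p y - ?p z)"
        using L(2) p half by blast
      also have "\<dots> \<le> 1/2 * norm (y - z)"
        using closest_point_lipschitz[of "cball c (R/2)" y z] R \<delta>L[OF t]
        by (intro mult_mono) (auto simp: dist_norm)
      finally show ?thesis .
    qed
    moreover have "norm (V t (?p y)) \<le> R/2" for y
      using M(2)[of "?p y" t] p[of y] half \<delta>M[OF t] by fastforce
    ultimately obtain u where u: "u 0 = c" "\<And>s. s \<in> {0..1} \<Longrightarrow> u s \<in> cball c (R/2)"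
      "\<And>s. s \<in> {0..1} \<Longrightarrow> (u has_vector_derivative V t (?p (u s))) (at s within {0..1})"
      using picard_unit_interval[of "\<lambda>y. V t (?p y)" "R/2" c] by metis
    then show ?thesis using closest_point_self by metis
  qed
  then obtain Y where Y0: "\<And>t. t \<in> ball 0 \<delta> \<Longrightarrow> Y t 0 = c"
    and Yc: "\<And>t s. t \<in> ball 0 \<delta> \<Longrightarrow> s \<in> {0..1} \<Longrightarrow> Y t s \<in> cball c (R/2)"
    and Y: "\<And>t s. t \<in> ball 0 \<delta> \<Longrightarrow> s \<in> {0..1} \<Longrightarrow>
      (Y t has_vector_derivative V t (Y t s)) (at s within {0..1})"
    by metis
  define F where "F = (\<lambda>t. Y t 1)"
  \<comment> \<open>First summand: quadratic Taylor remainder of \<open>V t\<close> over a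
    displacement of at most \<open>M * norm h\<close>. Second: variation of \<open>V h\<close> over
    the same displacement.\<close>
  define K where "K = C * \<delta> * M\<^sup>2 + L * M"
  have K: "K \<ge> 0" unfolding K_def using C(1) L(1) M(1) \<delta> by auto
  have est: "norm (F (t + h) - F t - V h (F t)) \<le> 2 * (K * (norm h)\<^sup>2)"
    if t: "t \<in> ball 0 \<delta>" and th: "t + h \<in> ball 0 \<delta>" and h: "h \<in> ball 0 \<delta>" for t h
  proof -
    let ?y = "Y t"
    define z where "z = (\<lambda>s. ?y s + s *\<^sub>R V h (?y s))"
    define z' where "z' = (\<lambda>s. V t (?y s) + (s *\<^sub>R DV h (?y s) (V t (?y s)) + V h (?y s)))"
    have y: "?y s \<in> cball c R" if "s \<in> {0..1}" for s using Yc[OF t that] half by blast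
    have sV: "norm (s *\<^sub>R V h (?y s)) \<le> M * norm h" if "s \<in> {0..1}" for s
    proof -
      have "norm (s *\<^sub>R V h (?y s)) \<le> norm (V h (?y s))" using that by (simp add: mult_left_le_one_le)
      then show ?thesis using M(2)[OF y[OF that], of h] by simp
    qed
    have z: "z s \<in> cball c R" if s: "s \<in> {0..1}" for s
    proof -
      have "norm (z s - c) \<le> norm (?y s - c) + norm (s *\<^sub>R V h (?y s))"
        unfolding z_def by (metis add_diff_eq add.commute norm_triangle_ineq)
      also have "\<dots> \<le> R/2 + R/2"
        using Yc[OF t s] sV[OF s] \<delta>M[OF h] by (intro add_mono) (auto simp: dist_norm norm_minus_commute)
      finally show ?thesis by (simp add: dist_norm norm_minus_commute)
    qed
    have zder: "(z has_vector_derivative z' s) (at s within {0..1})" if s: "s \<in> {0..1}" for s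
    proof -
      have "((\<lambda>s. V h (?y s)) has_vector_derivative DV h (?y s) (V t (?y s))) (at s within {0..1})"
        using vector_derivative_diff_chain_within[OF Y[OF t s] has_derivative_at_withinI[OF der[OF y[OF s]]]]
        by (simp add: o_def)
      then have "((\<lambda>s. s *\<^sub>R V h (?y s)) has_vector_derivative
         s *\<^sub>R DV h (?y s) (V t (?y s)) + 1 *\<^sub>R V h (?y s)) (at s within {0..1})"
        by (rule has_vector_derivative_scaleR[rotated]) (auto intro: derivative_eq_intros)
      then show ?thesis unfolding z_def z'_def
        using has_vector_derivative_add[OF Y[OF t s]] by fastforce
    qed
    have "norm (Y (t + h) 1 - z 1) \<le> 2 * (K * (norm h)\<^sup>2)"
    proof (rule half_gronwall[of "\<lambda>s. Y (t + h) s - z s" "\<lambda>s. V (t + h) (Y (t + h) s) - z' s"])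
      fix s :: real assume s: "s \<in> {0..1}"
      show "((\<lambda>s. Y (t + h) s - z s) has_vector_derivative V (t + h) (Y (t + h) s) - z' s) (at s within {0..1})"
        by (rule has_vector_derivative_diff[OF Y[OF th s] zder[OF s]])
      \<comment> \<open>Commutativity enters here: the term s DV h (V t), produced by
        differentiating the perturbation, equals the linear Taylor term of \<open>V t\<close> along
        the displacement, so the two cancel.\<close>
      have lins: "DV t (?y s) (s *\<^sub>R V h (?y s)) = s *\<^sub>R DV h (?y s) (V t (?y s))"
        using linear_scale[OF has_derivative_linear[OF der[OF y[OF s]]]] comm[OF y[OF s]] by simp
      have add: "V (t + h) x = V t x + V h x" for x using linear_add[OF lin] by simp
      have "V (t + h) (Y (t + h) s) - z' s = (V (t + h) (Y (t + h) s) - V (t + h) (z s)) +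
         ((V t (z s) - V t (?y s) - DV t (?y s) (z s - ?y s)) + (V h (z s) - V h (?y s)))"
        by (simp add: z'_def z_def lins add)
      also have "norm \<dots> \<le> 1/2 * norm (Y (t + h) s - z s) + (C * \<delta> * M\<^sup>2 * (norm h)\<^sup>2 + L * M * (norm h)\<^sup>2)"
      proof (intro order_trans[OF norm_triangle_ineq] add_mono)
        have "norm (V (t + h) (Y (t + h) s) - V (t + h) (z s))
            \<le> L * norm (t + h) * norm (Y (t + h) s - z s)"
          using Yc[OF th s] half z[OF s] by (intro L(2)) auto
        also have "\<dots> \<le> 1/2 * norm (Y (t + h) s - z s)"
          using \<delta>L[OF th] by (intro mult_right_mono) auto
        finally show "norm (V (t + h) (Y (t + h) s) - V (t + h) (z s)) \<le> 1/2 * norm (Y (t + h) s - z s)" .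
        have zy: "norm (z s - ?y s) \<le> M * norm h" using sV[OF s] by (simp add: z_def)
        have "norm (V t (z s) - V t (?y s) - DV t (?y s) (z s - ?y s)) \<le> C * norm t * (norm (z s - ?y s))\<^sup>2"
          by (rule C(2)[OF y[OF s] z[OF s]])
        also have "\<dots> \<le> C * \<delta> * (M * norm h)\<^sup>2"
          using C(1) t \<delta> zy M(1) by (intro mult_mono power_mono) auto
        finally show "norm (V t (z s) - V t (?y s) - DV t (?y s) (z s - ?y s)) \<le> C * \<delta> * M\<^sup>2 * (norm h)\<^sup>2"
          by (simp add: power_mult_distrib ac_simps)
        have "norm (V h (z s) - V h (?y s)) \<le> L * norm h * norm (z s - ?y s)"
          by (rule L(2)[OF z[OF s] y[OF s]])
        also have "\<dots> \<le> L * norm h * (M * norm h)" using zy L(1) by (intro mult_left_mono) auto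
        finally show "norm (V h (z s) - V h (?y s)) \<le> L * M * (norm h)\<^sup>2"
          by (simp add: power2_eq_square ac_simps)
      qed
      finally show "norm (V (t + h) (Y (t + h) s) - z' s) \<le> 1/2 * norm (Y (t + h) s - z s) + K * (norm h)\<^sup>2"
        by (simp add: K_def algebra_simps)
    qed (use Y0[OF t] Y0[OF th] in \<open>auto simp: z_def\<close>)
    then show ?thesis by (simp add: F_def z_def algebra_simps)
  qed
  show ?thesis
  proof (rule that[of \<delta> F])
    \<comment> \<open>The field for parameter 0 vanishes, so \<open>half_gronwall\<close> with bound
      0 shows that its curve stays at c.\<close>
    have "V 0 y = 0" for y using linear_0[OF lin] by simp
    then have "norm (Y 0 1 - c) \<le> 2 * 0"
      using \<delta> Y[of 0] Y0[of 0]
      by (intro half_gronwall[of "\<lambda>s. Y 0 s - c" "\<lambda>s. 0"]) (auto intro!: derivative_eq_intros)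
    then show "F 0 = c" by (simp add: F_def)
    show "F t \<in> cball c (R/2)" if "t \<in> ball 0 \<delta>" for t using Yc[OF that] by (simp add: F_def)
    show "(F has_derivative (\<lambda>h. V h (F t))) (at t)" if t: "t \<in> ball 0 \<delta>" for t
      unfolding has_derivative_at_alt
    proof (intro conjI allI impI)
      show "bounded_linear (\<lambda>h. V h (F t))" using lin linear_conv_bounded_linear by blast
      fix e :: real assume e: "e > 0"
      \<comment> \<open>\<open>\<delta> - norm t\<close> keeps both the increment and the new
        parameter in the ball of radius \<open>\<delta>\<close>; \<open>e / (2 * K + 1)\<close>
        turns the quadratic estimate into e times the increment.\<close>
      define d where "d = min (\<delta> - norm t) (e / (2 * K + 1))"
      have d: "d > 0" using t e K by (simp add: d_def)
      moreover have "norm (F x - F t - V (x - t) (F t)) \<le> e * norm (x - t)" if x: "norm (x - t) < d" for x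
      proof -
        have "norm x \<le> norm t + norm (x - t)" by (metis add.commute diff_add_cancel norm_triangle_ineq)
        then have "norm x < \<delta>" "norm (x - t) < \<delta>" using x norm_ge_zero[of t] unfolding d_def by linarith+
        then have "norm (F x - F t - V (x - t) (F t)) \<le> 2 * (K * (norm (x - t))\<^sup>2)"
          using est[OF t, of "x - t"] by simp
        also have "\<dots> = (2 * K * norm (x - t)) * norm (x - t)" by (simp add: power2_eq_square)
        also have "\<dots> \<le> e * norm (x - t)"
        proof (rule mult_right_mono)
          have "2 * K * norm (x - t) \<le> (2 * K + 1) * norm (x - t)" by (simp add: algebra_simps)
          also have "\<dots> \<le> e" using x K unfolding d_def by (simp add: field_simps)
          finally show "2 * K * norm (x - t) \<le> e" .
        qed simp
        finally show ?thesis .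
      qed
      ultimately show "\<exists>d>0. \<forall>x. norm (x - t) < d \<longrightarrow> norm (F x - F t - V (x - t) (F t)) \<le> e * norm (x - t)"
        by blast
    qed
  qed (rule \<delta>)
qed

text \<open>The fields are combined into one family V t, the sum of t_i X_i. Linearity in t makes
  each constant the sum of those of the single fields, times |t|, as
  \<open>commuting_integral_map\<close> requires.\<close>

lemma commuting_fields_integral_map:
  fixes X :: "'p::finite \<Rightarrow> 'e::euclidean_space \<Rightarrow> 'e"
  assumes S: "open S" "c \<in> S" and X: "\<And>i. smooth_on S (X i)"
    and comm: "\<And>i j y. y \<in> S \<Longrightarrow>
      frechet_derivative (X i) (at y) (X j y) = frechet_derivative (X j) (at y) (X i y)"
  obtains \<delta> and F :: "real ^ 'p \<Rightarrow> 'e" where "\<delta> > 0" "F 0 = c" "F ` ball 0 \<delta> \<subseteq> S"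
    "\<And>t. t \<in> ball 0 \<delta> \<Longrightarrow> (F has_derivative (\<lambda>h. \<Sum>i\<in>UNIV. (h $ i) *\<^sub>R X i (F t))) (at t)"
proof -
  obtain R where R: "R > 0" and sub: "cball c R \<subseteq> S" using S open_contains_cball by blast
  let ?D = "\<lambda>i y. frechet_derivative (X i) (at y)"
  define V where "V = (\<lambda>(t::real^'p) y. \<Sum>i\<in>UNIV. (t $ i) *\<^sub>R X i y)"
  define DV where "DV = (\<lambda>(t::real^'p) y v. \<Sum>i\<in>UNIV. (t $ i) *\<^sub>R ?D i y v)"
  have D: "(X i has_derivative ?D i y) (at y)" if "y \<in> cball c R" for i y
    using smooth_on_has_derivative[OF X] sub that by blast
  have bnd: "norm (\<Sum>i\<in>UNIV. (t $ i) *\<^sub>R a i) \<le> (\<Sum>i\<in>UNIV. m i) * norm t"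
    if "\<And>i. norm (a i) \<le> m i" for t :: "real^'p" and a :: "'p \<Rightarrow> 'e" and m
  proof -
    have "norm ((t $ i) *\<^sub>R a i) \<le> m i * norm t" for i
      using mult_mono[OF component_le_norm_cart[of t i] that[of i]] by (simp add: mult.commute)
    then have "norm (\<Sum>i\<in>UNIV. (t $ i) *\<^sub>R a i) \<le> (\<Sum>i\<in>UNIV. m i * norm t)"
      by (intro sum_norm_le)
    then show ?thesis by (simp add: sum_distrib_right)
  qed
  have "\<forall>i. \<exists>m. \<forall>y\<in>cball c R. norm (X i y) \<le> m"
    using compact_continuous_image[OF continuous_on_subset[OF smooth_on_imp_continuous_on[OF X] sub] compact_cball]
    by (metis (no_types, lifting) bounded_iff compact_imp_bounded image_eqI)
  then obtain m where m: "\<And>i y. y \<in> cball c R \<Longrightarrow> norm (X i y) \<le> m i" by metis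
  have "\<forall>i. \<exists>l\<ge>0. \<forall>y\<in>cball c R. \<forall>z\<in>cball c R. norm (X i y - X i z) \<le> l * norm (y - z)"
    using smooth_on_lipschitz_cball[OF X sub] by metis
  then obtain l where l: "\<And>i. l i \<ge> 0"
    "\<And>i y z. y \<in> cball c R \<Longrightarrow> z \<in> cball c R \<Longrightarrow> norm (X i y - X i z) \<le> l i * norm (y - z)" by metis
  have "\<forall>i. \<exists>k\<ge>0. \<forall>y\<in>cball c R. \<forall>z\<in>cball c R.
      norm (X i z - X i y - ?D i y (z - y)) \<le> k * (norm (z - y))\<^sup>2"
  proof
    fix i show "\<exists>k\<ge>0. \<forall>y\<in>cball c R. \<forall>z\<in>cball c R.
      norm (X i z - X i y - ?D i y (z - y)) \<le> k * (norm (z - y))\<^sup>2"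
      by (rule smooth_on_taylor_cball[OF X sub]) blast
  qed
  then obtain k where k: "\<And>i. k i \<ge> 0" "\<And>i y z. y \<in> cball c R \<Longrightarrow> z \<in> cball c R \<Longrightarrow>
      norm (X i z - X i y - ?D i y (z - y)) \<le> k i * (norm (z - y))\<^sup>2" by metis
  have m0: "m i \<ge> 0" for i using order_trans[OF norm_ge_zero m[of c i]] R by simp
  show ?thesis
  proof (rule commuting_integral_map[of R V "\<Sum>i\<in>UNIV. m i" c "\<Sum>i\<in>UNIV. l i" "\<Sum>i\<in>UNIV. k i" DV])
    show "linear (\<lambda>t. V t y)" for y
      unfolding V_def by (rule linearI) (simp_all add: scaleR_add_left sum.distrib scaleR_sum_right)
    show "norm (V t y) \<le> sum m UNIV * norm t" if "y \<in> cball c R" for t y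
      unfolding V_def by (rule bnd) (rule m[OF that])
    show "norm (V t y - V t z) \<le> sum l UNIV * norm t * norm (y - z)"
      if "y \<in> cball c R" "z \<in> cball c R" for t y z
      using bnd[of "\<lambda>i. X i y - X i z" "\<lambda>i. l i * norm (y - z)" t] l(2)[OF that]
      by (simp add: V_def sum_subtractf scaleR_diff_right sum_distrib_right[symmetric] ac_simps)
    show "norm (V t z - V t y - DV t y (z - y)) \<le> sum k UNIV * norm t * (norm (z - y))\<^sup>2"
      if "y \<in> cball c R" "z \<in> cball c R" for t y z
      using bnd[of "\<lambda>i. X i z - X i y - ?D i y (z - y)" "\<lambda>i. k i * (norm (z - y))\<^sup>2" t] k(2)[OF that]
      by (simp add: V_def DV_def sum_subtractf scaleR_diff_right sum_distrib_right[symmetric] ac_simps)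
    show "(V t has_derivative DV t y) (at y)" if "y \<in> cball c R" for t y
      unfolding V_def DV_def by (intro has_derivative_sum has_derivative_scaleR_right D[OF that])
    show "DV s y (V t y) = DV t y (V s y)" if y: "y \<in> cball c R" for s t y
    proof -
      have lin: "linear (?D i y)" for i by (rule has_derivative_linear[OF D[OF y]])
      have "DV s y (V t y) = (\<Sum>i\<in>UNIV. \<Sum>j\<in>UNIV. (s $ i * t $ j) *\<^sub>R ?D i y (X j y))" for s t
        unfolding DV_def V_def by (simp add: linear_sum[OF lin] linear_scale[OF lin] scaleR_sum_right)
      note eq = this
      have "DV s y (V t y) = (\<Sum>j\<in>UNIV. \<Sum>i\<in>UNIV. (s $ i * t $ j) *\<^sub>R ?D j y (X i y))"
        unfolding eq using comm y sub by (subst sum.swap) (auto intro!: sum.cong)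
      also have "\<dots> = DV t y (V s y)" unfolding eq by (simp add: mult.commute)
      finally show ?thesis .
    qed
    fix \<delta> F
    assume "\<delta> > 0" "F 0 = c" "\<And>t. t \<in> ball 0 \<delta> \<Longrightarrow> F t \<in> cball c (R/2)"
      "\<And>t. t \<in> ball 0 \<delta> \<Longrightarrow> (F has_derivative (\<lambda>h. V h (F t))) (at t)"
    moreover from this have "F ` ball 0 \<delta> \<subseteq> S" using sub R by fastforce
    ultimately show thesis by (intro that[of \<delta> F]) (auto simp: V_def)
  qed (use R m0 l(1) k(1) in \<open>auto intro: sum_nonneg\<close>)
qed

section \<open>Charts and globally smooth functions\<close>

lemma scaleR_fun_apply [simp]: "(c *\<^sub>R f) x = c *\<^sub>R f x"
  by (simp add: scaleR_fun_def)

lemma sum_fun_apply: "(\<Sum>i\<in>I. f i) x = (\<Sum>i\<in>I. f i x)"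
  for f :: "'i \<Rightarrow> 'a \<Rightarrow> 'b::comm_monoid_add"
  by (induction I rule: infinite_finite_induct) auto

locale smooth_manifold =
  fixes A :: "('a::t2_space, 'e::euclidean_space) atlas"
  assumes atlas: "smooth_atlas A"
begin

lemma chart:
  assumes "(U, \<phi>) \<in> A"
  shows "open U" "open (\<phi> ` U)" "continuous_on U \<phi>" "continuous_on (\<phi> ` U) (inv_into U \<phi>)"
    and "\<And>x. x \<in> U \<Longrightarrow> inv_into U \<phi> (\<phi> x) = x"
proof -
  have "is_chart U \<phi>" using atlas assms unfolding smooth_atlas_def by blast
  then have *: "open U" "open (\<phi> ` U)" "homeomorphism U (\<phi> ` U) \<phi> (inv_into U \<phi>)"
    unfolding is_chart_def by blast+
  show "open U" "open (\<phi> ` U)" using * by auto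
  show "continuous_on U \<phi>" "continuous_on (\<phi> ` U) (inv_into U \<phi>)"
    "\<And>x. x \<in> U \<Longrightarrow> inv_into U \<phi> (\<phi> x) = x"
    using *(3) unfolding homeomorphism_def by auto
qed

lemma chart_inv:
  assumes "y \<in> \<phi> ` U"
  shows "\<phi> (inv_into U \<phi> y) = y" "inv_into U \<phi> y \<in> U"
  using assms by (auto simp: f_inv_into_f inv_into_into)

lemma chart_at: obtains U \<phi> where "(U, \<phi>) \<in> A" "x \<in> U"
proof -
  have "x \<in> (\<Union>(U, \<phi>)\<in>A. U)" using atlas unfolding smooth_atlas_def by simp
  then show ?thesis using that by auto
qed

lemma open_chart_image:
  assumes "(U, \<phi>) \<in> A" "open W"
  shows "open (\<phi> ` (U \<inter> W))"
proof -
  have "\<phi> ` (U \<inter> W) = inv_into U \<phi> -` W \<inter> \<phi> ` U"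
    using chart(5)[OF assms(1)] by (auto simp: image_iff)
  then show ?thesis
    using continuous_on_open_vimage[OF chart(2)[OF assms(1)]] chart(4)[OF assms(1)] assms(2) by metis
qed

lemma open_chart_vimage:
  assumes "(U, \<phi>) \<in> A" "open T"
  shows "open (U \<inter> \<phi> -` T)"
  using continuous_open_preimage[OF chart(3)[OF assms(1)] chart(1)[OF assms(1)] assms(2)] .

lemma transition:
  assumes "(U, \<phi>) \<in> A" "(V, \<psi>) \<in> A"
  shows "smooth_on (\<phi> ` (U \<inter> V)) (\<lambda>y. \<psi> (inv_into U \<phi> y))"
  using atlas assms unfolding smooth_atlas_def o_def by blast

lemma smooth_fun_on_chart:
  "smooth_fun A h \<Longrightarrow> (U, \<phi>) \<in> A \<Longrightarrow> smooth_on (\<phi> ` U) (h \<circ> inv_into U \<phi>)"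
  unfolding smooth_fun_def by blast

lemma smooth_fun_const: "smooth_fun A (\<lambda>x. c)"
  unfolding smooth_fun_def o_def by (auto intro: smooth_on_const)

lemma smooth_fun_add:
  assumes "smooth_fun A h" "smooth_fun A k"
  shows "smooth_fun A (\<lambda>x. h x + k x)"
  using assms chart(2) unfolding smooth_fun_def o_def by (auto intro!: smooth_on_add)

lemma smooth_fun_mult:
  assumes "smooth_fun A h" "smooth_fun A k"
  shows "smooth_fun A (\<lambda>x. h x * k x)"
  using assms chart(2) unfolding smooth_fun_def o_def by (auto intro!: smooth_on_mult)

lemma smooth_fun_diff:
  assumes "smooth_fun A h" "smooth_fun A k"
  shows "smooth_fun A (\<lambda>x. h x - k x)"
  using smooth_fun_add[OF assms(1) smooth_fun_mult[OF smooth_fun_const[of "-1"] assms(2)]] by simp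

lemma smooth_fun_sum:
  "(\<And>i. i \<in> I \<Longrightarrow> smooth_fun A (h i)) \<Longrightarrow> smooth_fun A (\<lambda>x. \<Sum>i\<in>I. h i x)"
  by (induction I rule: infinite_finite_induct) (auto intro: smooth_fun_const smooth_fun_add)

text \<open>In a Hausdorff space the compact set corresponding to \<open>K\<close> is closed, so
  \<open>U\<close> and its complement form an open cover; on the first the function is
  \<open>u\<close> in coordinates, on the second it is 0. All global cut-offs rest on this.\<close>

lemma smooth_fun_chart_extend:
  assumes U: "(U, \<phi>) \<in> A" and u: "smooth_on (\<phi> ` U) u"
    and K: "compact K" "K \<subseteq> \<phi> ` U" and 0: "\<And>y. y \<in> \<phi> ` U \<Longrightarrow> y \<notin> K \<Longrightarrow> u y = 0"
  shows "smooth_fun A (\<lambda>x. if x \<in> U then u (\<phi> x) else 0)" (is "smooth_fun A ?h")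
  unfolding smooth_fun_def
proof clarify
  fix V \<psi> assume V: "(V, \<psi>) \<in> A"
  let ?K = "inv_into U \<phi> ` K"
  have "compact ?K" using continuous_on_subset[OF chart(4)[OF U] K(2)] K(1) by (rule compact_continuous_image)
  then have cl: "open (- ?K)" by (simp add: compact_imp_closed open_Compl)
  note T1 = open_chart_image[OF V chart(1)[OF U]]
  note T2 = open_chart_image[OF V cl]
  have "smooth_on (\<psi> ` (V \<inter> U)) (\<lambda>y. u (\<phi> (inv_into V \<psi> y)))"
    by (rule smooth_on_compose[OF T1 chart(2)[OF U] _ transition[OF V U] u])
       (use chart(5)[OF V] in auto)
  then have 1: "smooth_on (\<psi> ` (V \<inter> U)) (?h \<circ> inv_into V \<psi>)"
    by (rule smooth_on_cong[OF T1, rotated]) (use chart(5)[OF V] in auto)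
  have h0: "?h x = 0" if "x \<notin> ?K" for x
  proof -
    have "\<phi> x \<notin> K" if "x \<in> U" using that \<open>x \<notin> ?K\<close> chart(5)[OF U that] by (metis image_eqI)
    then show ?thesis using 0 by auto
  qed
  have 2: "smooth_on (\<psi> ` (V \<inter> - ?K)) (?h \<circ> inv_into V \<psi>)"
  proof (rule smooth_on_cong[OF T2 _ smooth_on_const[of _ 0]])
    fix y assume "y \<in> \<psi> ` (V \<inter> - ?K)"
    then obtain x where "x \<in> V" "x \<notin> ?K" "y = \<psi> x" by blast
    then have "inv_into V \<psi> y \<notin> ?K" using chart(5)[OF V] by metis
    from h0[OF this] show "0 = (?h \<circ> inv_into V \<psi>) y" unfolding o_apply by (rule sym)
  qed
  have "?K \<subseteq> U" using K(2) by (auto intro!: chart_inv(2))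
  then have "\<psi> ` V = \<psi> ` (V \<inter> U) \<union> \<psi> ` (V \<inter> - ?K)" by blast
  then show "smooth_on (\<psi> ` V) (?h \<circ> inv_into V \<psi>)"
    using smooth_on_Un[OF T1 T2 1 2] by simp
qed

lemma bump_fun_exists:
  assumes "open S" "x \<in> S"
  obtains \<beta> W where "smooth_fun A \<beta>" "open W" "x \<in> W" "W \<subseteq> S" "\<And>y. y \<in> W \<Longrightarrow> \<beta> y = 1"
    "\<And>y. y \<notin> S \<Longrightarrow> \<beta> y = 0"
proof -
  obtain U \<phi> where U: "(U, \<phi>) \<in> A" "x \<in> U" by (rule chart_at)
  have "\<phi> x \<in> \<phi> ` (U \<inter> S)" using U assms by blast
  then obtain R where R: "R > 0" "cball (\<phi> x) R \<subseteq> \<phi> ` (U \<inter> S)"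
    using open_chart_image[OF U(1) assms(1)] open_contains_cball by blast
  obtain b :: "'e \<Rightarrow> real" where b: "smooth_on UNIV b" "\<And>y. y \<in> cball (\<phi> x) (R/2) \<Longrightarrow> b y = 1"
    "\<And>y. y \<notin> cball (\<phi> x) R \<Longrightarrow> b y = 0"
    using bump_exists[of "R/2" R "\<phi> x"] R(1) by auto
  let ?W = "U \<inter> \<phi> -` ball (\<phi> x) (R/2)"
  let ?\<beta> = "\<lambda>y. if y \<in> U then b (\<phi> y) else 0"
  have in_S: "y \<in> S" if y: "y \<in> U" "\<phi> y \<in> cball (\<phi> x) R" for y
  proof -
    obtain z where "z \<in> U" "z \<in> S" "\<phi> y = \<phi> z" using y(2) R(2) by blast
    then show ?thesis using chart(5)[OF U(1)] y(1) by metis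
  qed
  show ?thesis
  proof (rule that[of ?\<beta> ?W])
    show "smooth_fun A ?\<beta>"
      by (rule smooth_fun_chart_extend[OF U(1) smooth_on_subset[OF b(1)] compact_cball])
         (use R(2) b(3) in auto)
    show "open ?W" by (rule open_chart_vimage[OF U(1) open_ball])
    show "?W \<subseteq> S" using in_S R(1) by (auto simp: subset_iff)
    show "\<And>y. y \<in> ?W \<Longrightarrow> ?\<beta> y = 1" using b(2) by auto
    show "\<And>y. y \<notin> S \<Longrightarrow> ?\<beta> y = 0" using b(3) in_S by metis
  qed (use U R(1) in auto)
qed

section \<open>Tangent vectors and vector fields\<close>

lemma tangent_add: "v \<in> tangent_space A x \<Longrightarrow> smooth_fun A h \<Longrightarrow> smooth_fun A k \<Longrightarrow>
    v (\<lambda>y. h y + k y) = v h + v k"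
  and tangent_cmult: "v \<in> tangent_space A x \<Longrightarrow> smooth_fun A h \<Longrightarrow> v (\<lambda>y. c * h y) = c * v h"
  and tangent_mult: "v \<in> tangent_space A x \<Longrightarrow> smooth_fun A h \<Longrightarrow> smooth_fun A k \<Longrightarrow>
    v (\<lambda>y. h y * k y) = v h * k x + h x * v k"
  and tangent_nonsmooth: "v \<in> tangent_space A x \<Longrightarrow> \<not> smooth_fun A h \<Longrightarrow> v h = 0"
  unfolding tangent_space_def by auto

lemma tangent_const:
  assumes "v \<in> tangent_space A x"
  shows "v (\<lambda>y. c) = 0"
proof -
  have "v (\<lambda>y. 1) = 0"
    using tangent_mult[OF assms smooth_fun_const[of 1] smooth_fun_const[of 1]] by simp
  then show ?thesis using tangent_cmult[OF assms smooth_fun_const[of 1], of c] by simp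
qed

lemma tangent_diff:
  assumes v: "v \<in> tangent_space A x" and "smooth_fun A h" "smooth_fun A k"
  shows "v (\<lambda>y. h y - k y) = v h - v k"
  using tangent_add[OF v assms(2) smooth_fun_mult[OF smooth_fun_const[of "-1"] assms(3)]]
    tangent_cmult[OF v assms(3), of "-1"] by simp

lemma tangent_sum:
  assumes v: "v \<in> tangent_space A x" and "\<And>i. i \<in> I \<Longrightarrow> smooth_fun A (h i)"
  shows "v (\<lambda>y. \<Sum>i\<in>I. h i y) = (\<Sum>i\<in>I. v (h i))"
  using assms(2)
  by (induction I rule: infinite_finite_induct)
     (auto simp: tangent_const[OF v] tangent_add[OF v] smooth_fun_sum)

lemma subspace_tangent_space: "subspace (tangent_space A x)"
  unfolding subspace_def tangent_space_def by (auto simp: algebra_simps)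

text \<open>For a bump function \<beta> at x that vanishes off \<open>S\<close>, the product (h - k)
  \<beta> is identically 0; the Leibniz rule at x, where \<beta> = 1 and h - k = 0, turns this into
  v (h - k) = 0.\<close>

lemma tangent_local:
  assumes v: "v \<in> tangent_space A x" and h: "smooth_fun A h" and k: "smooth_fun A k"
    and S: "open S" "x \<in> S" and eq: "\<And>y. y \<in> S \<Longrightarrow> h y = k y"
  shows "v h = v k"
proof -
  obtain \<beta> W where \<beta>: "smooth_fun A \<beta>" "x \<in> W" "\<And>y. y \<in> W \<Longrightarrow> \<beta> y = 1" "\<And>y. y \<notin> S \<Longrightarrow> \<beta> y = 0"
    by (rule bump_fun_exists[OF S]) blast
  have "(\<lambda>y. (h y - k y) * \<beta> y) = (\<lambda>y. 0)" using eq \<beta>(4) by fastforce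
  then have "v (\<lambda>y. (h y - k y) * \<beta> y) = 0" using tangent_const[OF v] by simp
  then have "v (\<lambda>y. h y - k y) = 0"
    using tangent_mult[OF v smooth_fun_diff[OF h k] \<beta>(1)] \<beta>(2,3) eq S(2) by simp
  then show ?thesis using tangent_diff[OF v h k] by simp
qed

lemma vector_fieldD:
  assumes "vector_field A X"
  shows "X x \<in> tangent_space A x" "smooth_fun A h \<Longrightarrow> smooth_fun A (\<lambda>y. X y h)"
  using assms unfolding vector_field_def vfield_app_def by auto

lemma vector_fieldI:
  assumes "\<And>x. X x \<in> tangent_space A x" "\<And>h. smooth_fun A h \<Longrightarrow> smooth_fun A (\<lambda>y. X y h)"
  shows "vector_field A X"
  using assms unfolding vector_field_def vfield_app_def by auto

lemma vector_field_scale: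
  assumes "smooth_fun A h" "vector_field A X"
  shows "vector_field A (\<lambda>x. h x *\<^sub>R X x)"
proof (rule vector_fieldI)
  show "h x *\<^sub>R X x \<in> tangent_space A x" for x
    by (rule subspace_scale[OF subspace_tangent_space vector_fieldD(1)[OF assms(2)]])
  show "smooth_fun A (\<lambda>y. (h y *\<^sub>R X y) k)" if "smooth_fun A k" for k
    using smooth_fun_mult[OF assms(1) vector_fieldD(2)[OF assms(2) that]] by simp
qed

lemma vector_field_sum:
  assumes "\<And>i. i \<in> I \<Longrightarrow> vector_field A (X i)"
  shows "vector_field A (\<lambda>x. \<Sum>i\<in>I. X i x)"
proof (rule vector_fieldI)
  show "(\<Sum>i\<in>I. X i x) \<in> tangent_space A x" for x
    by (rule subspace_sum[OF subspace_tangent_space vector_fieldD(1)[OF assms]])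
  show "smooth_fun A (\<lambda>y. (\<Sum>i\<in>I. X i y) k)" if "smooth_fun A k" for k
    unfolding sum_fun_apply by (rule smooth_fun_sum[OF vector_fieldD(2)[OF assms that]])
qed

lemma lie_bracket_apply:
  "smooth_fun A h \<Longrightarrow> lie_bracket A X Y x h = X x (\<lambda>y. Y y h) - Y x (\<lambda>y. X y h)"
  by (simp add: lie_bracket_def vfield_app_def)

text \<open>In the Leibniz rule for the bracket the mixed products of first derivatives are
  symmetric in \<open>X\<close> and \<open>Y\<close> and cancel.\<close>

lemma vector_field_lie_bracket:
  assumes X: "vector_field A X" and Y: "vector_field A Y"
  shows "vector_field A (lie_bracket A X Y)"
proof (rule vector_fieldI)
  note X' = vector_fieldD[OF X] and Y' = vector_fieldD[OF Y]
  note tX = tangent_add[OF X'(1)] tangent_cmult[OF X'(1)] tangent_mult[OF X'(1)] smooth_fun_mult smooth_fun_add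
  note tY = tangent_add[OF Y'(1)] tangent_cmult[OF Y'(1)] tangent_mult[OF Y'(1)]
  show "lie_bracket A X Y x \<in> tangent_space A x" for x
    unfolding tangent_space_def
    by (auto simp: lie_bracket_apply smooth_fun_add smooth_fun_mult smooth_fun_const tX tY X' Y' algebra_simps)
       (simp add: lie_bracket_def)
  show "smooth_fun A (\<lambda>y. lie_bracket A X Y y h)" if "smooth_fun A h" for h
    using that by (simp add: lie_bracket_apply smooth_fun_diff X' Y')
qed

section \<open>Local frames\<close>

text \<open>Hadamard's lemma writes h near x as a constant plus products of coordinate increments
  with coefficients; under v the Leibniz rule leaves only the terms in which the increment,
  vanishing at x, is differentiated. The coefficients live only near x and are first cut off to
  global functions.\<close>

lemma chart_expansion:
  assumes U: "(U, \<phi>) \<in> A" and v: "v \<in> tangent_space A x" and h: "smooth_fun A h"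
    and W: "open W" "x \<in> W" "W \<subseteq> U"
    and X: "\<And>a. smooth_fun A (X a)" "\<And>y a. y \<in> W \<Longrightarrow> X a y = \<phi> y \<bullet> a"
  shows "v h = (\<Sum>a\<in>Basis. frechet_derivative (h \<circ> inv_into U \<phi>) (at (\<phi> x)) a * v (X a))"
proof -
  let ?u = "h \<circ> inv_into U \<phi>" and ?c = "\<phi> x"
  have "open (\<phi> ` (U \<inter> W))" "?c \<in> \<phi> ` (U \<inter> W)"
    using open_chart_image[OF U W(1)] W by auto
  then obtain r where r: "r > 0" "ball ?c r \<subseteq> \<phi> ` (U \<inter> W)" using open_contains_ball by blast
  then have sub: "ball ?c r \<subseteq> \<phi> ` U" by blast
  obtain w where w: "\<And>a. smooth_on (ball ?c r) (w a)"
    "\<And>y. y \<in> ball ?c r \<Longrightarrow> ?u y = ?u ?c + (\<Sum>a\<in>Basis. ((y - ?c) \<bullet> a) * w a y)"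
    "\<And>a. w a ?c = frechet_derivative ?u (at ?c) a"
    by (rule hadamard[OF smooth_on_subset[OF smooth_fun_on_chart[OF h U] sub] r(1)]) blast
  obtain b :: "'e \<Rightarrow> real" where b: "smooth_on UNIV b" "\<And>y. y \<in> cball ?c (r/3) \<Longrightarrow> b y = 1"
    "\<And>y. y \<notin> cball ?c (r/2) \<Longrightarrow> b y = 0"
    using bump_exists[of "r/3" "r/2" ?c] r(1) by auto
  \<comment> \<open>The Hadamard coefficient is controlled only on the ball of radius r; since
    \<open>b\<close> vanishes beyond r/2, the extension by 0 is smooth on two overlapping open sets
    that cover the space.\<close>
  let ?g = "\<lambda>a y. if y \<in> ball ?c r then b y * w a y else 0"
  have "smooth_on (ball ?c r \<union> - cball ?c (r/2)) (?g a)" for a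
  proof (rule smooth_on_Un)
    show "smooth_on (ball ?c r) (?g a)"
      by (rule smooth_on_cong[OF open_ball _ smooth_on_mult[OF open_ball smooth_on_subset[OF b(1)] w(1)]]) auto
    show "smooth_on (- cball ?c (r/2)) (?g a)"
      by (rule smooth_on_cong[OF _ _ smooth_on_const[of _ 0]]) (use b(3) in auto)
  qed auto
  moreover have "ball ?c r \<union> - cball ?c (r/2) = UNIV" using r(1) by auto
  ultimately have g: "smooth_on UNIV (?g a)" for a by simp
  define G where "G = (\<lambda>a y. if y \<in> U then ?g a (\<phi> y) else 0)"
  have G: "smooth_fun A (G a)" for a
    unfolding G_def
    by (rule smooth_fun_chart_extend[OF U smooth_on_subset[OF g] compact_cball[of ?c "r/2"]])
       (use sub r(1) b(3) in \<open>auto simp: subset_iff\<close>)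
  have G0: "G a x = frechet_derivative ?u (at ?c) a" for a
    using W r(1) b(2)[of ?c] w(3) by (auto simp: G_def)
  let ?N = "U \<inter> \<phi> -` ball ?c (r/3)"
  let ?k = "\<lambda>y. h x + (\<Sum>a\<in>Basis. (X a y - ?c \<bullet> a) * G a y)"
  have k: "smooth_fun A ?k"
    by (intro smooth_fun_add smooth_fun_const smooth_fun_sum smooth_fun_mult smooth_fun_diff X G)
  have "h y = ?k y" if y: "y \<in> ?N" for y
  proof -
    have y': "\<phi> y \<in> ball ?c r" "\<phi> y \<in> cball ?c (r/3)" "y \<in> U" using y r(1) by auto
    have "y \<in> W" using r(2) y'(1,3) chart(5)[OF U] by (metis IntD1 IntD2 imageE subsetD)
    then show ?thesis
      using w(2)[OF y'(1)] y' chart(5)[OF U y'(3)] chart(5)[OF U, of x] W b(2)[OF y'(2)]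
      by (auto simp: G_def X(2) inner_diff_left intro!: sum.cong)
  qed
  then have "v h = v ?k"
    by (intro tangent_local[OF v h k open_chart_vimage[OF U open_ball[of ?c "r/3"]]])
       (use W r(1) in auto)
  also have "\<dots> = (\<Sum>a\<in>Basis. v (\<lambda>y. (X a y - ?c \<bullet> a) * G a y))"
    using X G by (simp add: tangent_add[OF v] tangent_const[OF v] tangent_sum[OF v]
        smooth_fun_const smooth_fun_sum smooth_fun_mult smooth_fun_diff)
  also have "\<dots> = (\<Sum>a\<in>Basis. frechet_derivative ?u (at ?c) a * v (X a))"
    using X W G
    by (simp add: tangent_mult[OF v] tangent_diff[OF v] tangent_const[OF v] smooth_fun_diff smooth_fun_const
        G0 mult.commute)
  finally show ?thesis .
qed

text \<open>The coordinate field in direction \<open>a\<close>, multiplied by a cut-off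
  \<open>b\<close> that vanishes outside \<open>K\<close>.\<close>

lemma vector_field_chart_extend:
  assumes U: "(U, \<phi>) \<in> A" and b: "smooth_on (\<phi> ` U) b"
    and K: "compact K" "K \<subseteq> \<phi> ` U" and 0: "\<And>y. y \<in> \<phi> ` U \<Longrightarrow> y \<notin> K \<Longrightarrow> b y = 0"
  shows "vector_field A (\<lambda>x h. if smooth_fun A h \<and> x \<in> U
    then b (\<phi> x) * frechet_derivative (h \<circ> inv_into U \<phi>) (at (\<phi> x)) a else 0)"
    (is "vector_field A ?E")
proof (rule vector_fieldI)
  fix x
  show "?E x \<in> tangent_space A x"
  proof (cases "x \<in> U")
    case True
    let ?D = "\<lambda>h. frechet_derivative (h \<circ> inv_into U \<phi>) (at (\<phi> x)) a"
    have D: "((\<lambda>y. h (inv_into U \<phi> y)) has_derivative frechet_derivative (h \<circ> inv_into U \<phi>) (at (\<phi> x)))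
        (at (\<phi> x))" if "smooth_fun A h" for h
      using smooth_on_has_derivative[OF smooth_fun_on_chart[OF that U]] True by (auto simp: o_def)
    have "?D (\<lambda>y. h y + k y) = ?D h + ?D k" if "smooth_fun A h" "smooth_fun A k" for h k
      using frechet_derivative_at[OF has_derivative_add[OF D[OF that(1)] D[OF that(2)]], symmetric]
      by (simp add: o_def)
    moreover have "?D (\<lambda>y. c * h y) = c * ?D h" if "smooth_fun A h" for c h
      using frechet_derivative_at[OF has_derivative_mult_right[OF D[OF that]], symmetric]
      by (simp add: o_def)
    moreover have "?D (\<lambda>y. h y * k y) = ?D h * k x + h x * ?D k"
      if "smooth_fun A h" "smooth_fun A k" for h k
      using frechet_derivative_at[OF has_derivative_mult[OF D[OF that(1)] D[OF that(2)]], symmetric]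
        chart(5)[OF U True] by (simp add: o_def)
    ultimately show ?thesis
      unfolding tangent_space_def
      by (auto simp: smooth_fun_add smooth_fun_mult smooth_fun_const algebra_simps)
  next
    case False
    then show ?thesis unfolding tangent_space_def by auto
  qed
next
  fix h assume h: "smooth_fun A h"
  have "smooth_fun A (\<lambda>x. if x \<in> U then (\<lambda>y. b y * frechet_derivative (h \<circ> inv_into U \<phi>) (at y) a) (\<phi> x) else 0)"
    by (rule smooth_fun_chart_extend[OF U smooth_on_mult[OF chart(2)[OF U] b smooth_on_frechet_derivative[OF
            smooth_fun_on_chart[OF h U]]] K]) (use 0 in auto)
  then show "smooth_fun A (\<lambda>y. ?E y h)" using h by simp
qed

lemma chart_frame:
  obtains U \<phi> W X E where "(U, \<phi>) \<in> A" "open W" "x0 \<in> W" "W \<subseteq> U"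
    "\<And>a. smooth_fun A (X a)" "\<And>y a. y \<in> W \<Longrightarrow> X a y = \<phi> y \<bullet> a"
    "\<And>a. vector_field A (E a)"
    "\<And>x v. x \<in> W \<Longrightarrow> v \<in> tangent_space A x \<Longrightarrow> v = (\<Sum>a\<in>Basis. v (X a) *\<^sub>R E a x)"
proof -
  obtain U \<phi> where U: "(U, \<phi>) \<in> A" "x0 \<in> U" by (rule chart_at)
  let ?c = "\<phi> x0"
  obtain R where R: "R > 0" "cball ?c R \<subseteq> \<phi> ` U"
    using chart(2)[OF U(1)] U(2) open_contains_cball by blast
  obtain b :: "'e \<Rightarrow> real" where b: "smooth_on UNIV b" "\<And>y. y \<in> cball ?c (R/2) \<Longrightarrow> b y = 1"
    "\<And>y. y \<notin> cball ?c R \<Longrightarrow> b y = 0"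
    using bump_exists[of "R/2" R ?c] R(1) by auto
  define W where "W = U \<inter> \<phi> -` ball ?c (R/2)"
  define X where "X = (\<lambda>a y. if y \<in> U then (\<lambda>y. b y * (y \<bullet> a)) (\<phi> y) else 0)"
  define E where "E = (\<lambda>a x h. if smooth_fun A h \<and> x \<in> U
    then b (\<phi> x) * frechet_derivative (h \<circ> inv_into U \<phi>) (at (\<phi> x)) a else 0)"
  have W: "open W" "x0 \<in> W" "W \<subseteq> U"
    using open_chart_vimage[OF U(1) open_ball] U(2) R(1) by (auto simp: W_def)
  have X: "smooth_fun A (X a)" for a
    unfolding X_def
    by (rule smooth_fun_chart_extend[OF U(1) _ compact_cball R(2)])
       (use b(3) in \<open>auto intro!: smooth_on_mult smooth_on_inner smooth_on_id smooth_on_const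
          smooth_on_subset[OF b(1)] chart(2)[OF U(1)]\<close>)
  have XW: "X a y = \<phi> y \<bullet> a" if "y \<in> W" for y a
    using that b(2)[of "\<phi> y"] by (auto simp: W_def X_def)
  have E: "vector_field A (E a)" for a
    unfolding E_def
    by (rule vector_field_chart_extend[OF U(1) smooth_on_subset[OF b(1)] compact_cball R(2)])
       (use b(3) in auto)
  have "v = (\<Sum>a\<in>Basis. v (X a) *\<^sub>R E a x)" if x: "x \<in> W" and v: "v \<in> tangent_space A x" for x v
  proof
    fix h
    show "v h = (\<Sum>a\<in>Basis. v (X a) *\<^sub>R E a x) h"
    proof (cases "smooth_fun A h")
      case True
      have "v h = (\<Sum>a\<in>Basis. frechet_derivative (h \<circ> inv_into U \<phi>) (at (\<phi> x)) a * v (X a))"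
        by (rule chart_expansion[OF U(1) v True W(1) x W(3) X XW])
      then show ?thesis
        using True x b(2)[of "\<phi> x"] by (auto simp: sum_fun_apply E_def W_def mult.commute)
    qed (use tangent_nonsmooth[OF v] in \<open>simp add: sum_fun_apply E_def\<close>)
  qed
  then show ?thesis using that[of U \<phi> W X E] U(1) W X XW E by blast
qed

text \<open>Multiplication by a bump function that vanishes outside the domain of the frame makes
  the expansion valid at every point, so it can be substituted under operators acting on whole
  vector fields.\<close>

lemma global_frame:
  obtains X E \<beta> where "\<And>a::'e. smooth_fun A (X a)" "\<And>a. vector_field A (E a)"
    "smooth_fun A \<beta>" "\<beta> x0 = 1"
    "\<And>x v. v \<in> tangent_space A x \<Longrightarrow> \<beta> x *\<^sub>R v = (\<Sum>a\<in>Basis. (\<beta> x * v (X a)) *\<^sub>R E a x)"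
proof -
  obtain U \<phi> W and X :: "'e \<Rightarrow> 'a \<Rightarrow> real" and E where *: "open W" "x0 \<in> W"
    "\<And>a. smooth_fun A (X a)" "\<And>a. vector_field A (E a)"
    "\<And>x v. x \<in> W \<Longrightarrow> v \<in> tangent_space A x \<Longrightarrow> v = (\<Sum>a\<in>Basis. v (X a) *\<^sub>R E a x)"
    by (rule chart_frame[of x0]) blast
  obtain \<beta> W' where \<beta>: "smooth_fun A \<beta>" "x0 \<in> W'" "\<And>y. y \<in> W' \<Longrightarrow> \<beta> y = 1" "\<And>y. y \<notin> W \<Longrightarrow> \<beta> y = 0"
    by (rule bump_fun_exists[OF *(1,2)]) blast
  have "\<beta> x *\<^sub>R v = (\<Sum>a\<in>Basis. (\<beta> x * v (X a)) *\<^sub>R E a x)" if v: "v \<in> tangent_space A x" for x v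
  proof (cases "x \<in> W")
    case True
    have "\<beta> x *\<^sub>R (\<Sum>a\<in>Basis. v (X a) *\<^sub>R E a x) = (\<Sum>a\<in>Basis. (\<beta> x * v (X a)) *\<^sub>R E a x)"
      by (simp add: scaleR_sum_right)
    then show ?thesis using *(5)[OF True v] by simp
  qed (use \<beta>(4) in simp)
  then show ?thesis using that[of X E \<beta>] * \<beta> by blast
qed

lemma tangent_extend:
  assumes v: "v \<in> tangent_space A x"
  obtains X where "vector_field A X" "X x = v"
proof -
  obtain U \<phi> W and C :: "'e \<Rightarrow> 'a \<Rightarrow> real" and E where *: "x \<in> W" "\<And>a. vector_field A (E a)"
    "\<And>x v. x \<in> W \<Longrightarrow> v \<in> tangent_space A x \<Longrightarrow> v = (\<Sum>a\<in>Basis. v (C a) *\<^sub>R E a x)"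
    by (rule chart_frame[of x]) blast
  show ?thesis
    by (rule that[of "\<lambda>y. \<Sum>a\<in>Basis. v (C a) *\<^sub>R E a y"])
       (use *(3)[OF *(1) v] *(2) in \<open>auto intro!: vector_field_sum vector_field_scale smooth_fun_const\<close>)
qed

lemma tangent_finite_span:
  obtains B where "finite B" "tangent_space A x = span B"
proof -
  obtain U \<phi> W and C :: "'e \<Rightarrow> 'a \<Rightarrow> real" and E where *: "x \<in> W" "\<And>a. vector_field A (E a)"
    "\<And>x v. x \<in> W \<Longrightarrow> v \<in> tangent_space A x \<Longrightarrow> v = (\<Sum>a\<in>Basis. v (C a) *\<^sub>R E a x)"
    by (rule chart_frame[of x]) blast
  let ?B = "(\<lambda>a. E a x) ` Basis"
  have "(\<Sum>a\<in>Basis. v (C a) *\<^sub>R E a x) \<in> span ?B" for v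
    by (intro span_sum span_scale span_base imageI)
  then have "v \<in> span ?B" if "v \<in> tangent_space A x" for v
    using *(3)[OF *(1) that] by metis
  moreover have "span ?B \<subseteq> tangent_space A x"
    using vector_fieldD(1)[OF *(2)] by (intro span_minimal subspace_tangent_space) auto
  ultimately show ?thesis using that[of ?B] by auto
qed

end

section \<open>Integral manifolds of commuting frames\<close>

text \<open>A bootstrap: the derivative of u along F in direction h is again a smooth function
  composed with F, namely the derivative of u along the sum of the h_i X_i. One order is gained for
  all u at once, starting from mere continuity of F.\<close>

lemma smooth_on_integral_map:
  fixes X :: "'p::finite \<Rightarrow> 'e::euclidean_space \<Rightarrow> 'e" and F :: "real ^ 'p \<Rightarrow> 'e"
  assumes S: "open S" and V: "open V" and X: "\<And>i. smooth_on V (X i)"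
    and F: "\<And>t. t \<in> S \<Longrightarrow> (F has_derivative (\<lambda>h. \<Sum>i\<in>UNIV. (h $ i) *\<^sub>R X i (F t))) (at t)"
    and u: "smooth_on V u"
  shows "smooth_on (S \<inter> F -` V) (\<lambda>t. u (F t))"
proof -
  have contF: "continuous_on S F"
    using F by (intro continuous_at_imp_continuous_on ballI has_derivative_continuous) blast
  then have "open (S \<inter> F -` V)" using S V by (rule continuous_open_preimage)
  moreover have "C_k_on k (S \<inter> F -` V) (\<lambda>t. u (F t))" for k
    using u
  proof (induction k arbitrary: u)
    case (0 u)
    have "continuous_on (S \<inter> F -` V) F" by (rule continuous_on_subset[OF contF]) simp
    then show ?case
      unfolding C_k_on.simps by (rule continuous_on_compose2[OF smooth_on_imp_continuous_on[OF "0"]]) auto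
  next
    case (Suc k)
    show ?case
    proof (rule C_k_on_SucI)
      fix t assume t: "t \<in> S \<inter> F -` V"
      show "((\<lambda>t. u (F t)) has_derivative
          (\<lambda>h. frechet_derivative u (at (F t)) (\<Sum>i\<in>UNIV. (h $ i) *\<^sub>R X i (F t)))) (at t)"
        by (rule has_derivative_compose[OF F smooth_on_has_derivative[OF Suc.prems]]) (use t in auto)
    next
      fix h :: "real ^ 'p"
      show "C_k_on k (S \<inter> F -` V)
          (\<lambda>t. frechet_derivative u (at (F t)) (\<Sum>i\<in>UNIV. (h $ i) *\<^sub>R X i (F t)))"
        by (intro Suc.IH[of "\<lambda>y. frechet_derivative u (at y) (\<Sum>i\<in>UNIV. (h $ i) *\<^sub>R X i y)"]
            smooth_on_frechet_derivative_along smooth_on_sum smooth_on_scaleR smooth_on_const V X Suc.prems)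
    qed fact
  qed
  ultimately show ?thesis by (simp add: smooth_on_def)
qed

text \<open>The derivative at 0 is injective, hence has a linear left inverse (the dimensions may
  differ), and it varies continuously in operator norm, which is the setting of the local
  injectivity theorem.\<close>

lemma integral_map_locally_injective:
  fixes X :: "'p::finite \<Rightarrow> 'e::euclidean_space \<Rightarrow> 'e" and F :: "real ^ 'p \<Rightarrow> 'e"
  assumes \<delta>: "\<delta> > 0" and V: "open V" "F ` ball 0 \<delta> \<subseteq> V" and X: "\<And>i. continuous_on V (X i)"
    and F: "\<And>t. t \<in> ball 0 \<delta> \<Longrightarrow> (F has_derivative (\<lambda>h. \<Sum>i\<in>UNIV. (h $ i) *\<^sub>R X i (F t))) (at t)"
    and indep: "\<And>h. (\<Sum>i\<in>UNIV. (h $ i) *\<^sub>R X i (F 0)) = 0 \<Longrightarrow> h = 0"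
  obtains r where "r > 0" "ball (0 :: real ^ 'p) r \<subseteq> ball 0 \<delta>" "inj_on F (ball 0 r)"
proof -
  let ?F' = "\<lambda>t h. \<Sum>i\<in>UNIV. (h $ i) *\<^sub>R X i (F t)"
  have lin: "linear (?F' t)" for t
    by (rule linearI) (simp_all add: scaleR_add_left sum.distrib scaleR_sum_right)
  have "inj (?F' 0)" using indep linear_injective_0[OF lin] by blast
  then obtain G where G: "linear G" "G \<circ> ?F' 0 = id"
    using linear_injective_left_inverse[OF lin] by blast
  have "\<exists>d>0. \<forall>t. dist 0 t < d \<longrightarrow> onorm (\<lambda>v. ?F' t v - ?F' 0 v) < e" if e: "e > 0" for e
  proof -
    let ?N = "\<lambda>t. \<Sum>i\<in>UNIV. norm (X i (F t) - X i (F 0))"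
    have "isCont F 0" using F[of 0] \<delta> by (intro has_derivative_continuous) auto
    moreover have "F 0 \<in> V" using V(2) \<delta> by auto
    then have "isCont (X i) (F 0)" for i
      using X V(1) by (auto simp: continuous_on_eq_continuous_at)
    ultimately have "isCont (\<lambda>t. X i (F t)) 0" for i by (rule isCont_o2)
    then have "isCont ?N 0"
      by (intro continuous_sum continuous_norm continuous_diff continuous_const)
    from this[unfolded continuous_at_eps_delta, rule_format, OF e]
    obtain d where d: "d > 0" "\<And>t. dist t 0 < d \<Longrightarrow> dist (?N t) (?N 0) < e" by blast
    have "onorm (\<lambda>v. ?F' t v - ?F' 0 v) < e" if "dist 0 t < d" for t
    proof -
      have "norm (?F' t v - ?F' 0 v) \<le> ?N t * norm v" for v
      proof -
        have "?F' t v - ?F' 0 v = (\<Sum>i\<in>UNIV. (v $ i) *\<^sub>R (X i (F t) - X i (F 0)))"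
          by (simp add: scaleR_diff_right sum_subtractf)
        also have "norm \<dots> \<le> (\<Sum>i\<in>UNIV. norm (X i (F t) - X i (F 0)) * norm v)"
          by (intro sum_norm_le)
             (metis component_le_norm_cart mult.commute mult_right_mono norm_ge_zero norm_scaleR)
        finally show ?thesis by (simp add: sum_distrib_right)
      qed
      then have "onorm (\<lambda>v. ?F' t v - ?F' 0 v) \<le> ?N t" by (rule onorm_le)
      also have "\<dots> < e" using d(2)[of t] that by (simp add: dist_norm)
      finally show ?thesis .
    qed
    then show ?thesis using d(1) by blast
  qed
  note cont = this
  have "\<exists>r>0. ball (0 :: real ^ 'p) r \<subseteq> ball 0 \<delta> \<and> inj_on F (ball 0 r)"
  proof (rule has_derivative_locally_injective[of 0 "ball 0 \<delta>" G ?F' F])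
    show "bounded_linear G" using G(1) linear_conv_bounded_linear by blast
    show "G \<circ> ?F' 0 = id" by (rule G(2))
    show "(F has_derivative ?F' t) (at t)" if "t \<in> ball 0 \<delta>" for t by (rule F[OF that])
    show "\<exists>d>0. \<forall>t. dist 0 t < d \<longrightarrow> onorm (\<lambda>v. ?F' t v - ?F' 0 v) < e" if "e > 0" for e
      by (rule cont[OF that])
    fix r :: real assume "0 < r" "ball (0 :: real ^ 'p) r \<subseteq> ball 0 \<delta>" "inj_on F (ball 0 r)"
    then show ?thesis by blast
  qed (use \<delta> in simp_all)
  then show ?thesis using that by blast
qed

context smooth_manifold
begin

text \<open>In a chart the coordinate components \<open>Y i\<close> of the fields satisfy the
  hypotheses of \<open>commuting_fields_integral_map\<close>; the resulting map is shrunk until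
  injective and composed with the inverse chart.\<close>

lemma commuting_frame_integral_manifold:
  fixes \<xi> :: "'p::finite \<Rightarrow> 'a vfield"
  assumes \<xi>: "\<And>i. vector_field A (\<xi> i)"
    and comm: "\<And>i j x. lie_bracket A (\<xi> i) (\<xi> j) x = 0"
    and indep: "\<And>x h. (\<Sum>i\<in>UNIV. (h $ i) *\<^sub>R \<xi> i x) = 0 \<Longrightarrow> (h :: real ^ 'p) = 0"
  obtains S and F :: "real ^ 'p \<Rightarrow> 'a"
  where "integral_manifold A (\<lambda>x. span (range (\<lambda>i. \<xi> i x))) S F" "x0 \<in> F ` S"
proof -
  obtain U \<phi> W and X :: "'e \<Rightarrow> 'a \<Rightarrow> real" and E where U: "(U, \<phi>) \<in> A" and W: "open W" "x0 \<in> W" "W \<subseteq> U"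
    and X: "\<And>a. smooth_fun A (X a)" "\<And>y a. y \<in> W \<Longrightarrow> X a y = \<phi> y \<bullet> a"
    and frame: "\<And>x v. x \<in> W \<Longrightarrow> v \<in> tangent_space A x \<Longrightarrow> v = (\<Sum>a\<in>Basis. v (X a) *\<^sub>R E a x)"
    by (rule chart_frame[of x0]) blast
  let ?\<psi> = "inv_into U \<phi>"
  define V where "V = \<phi> ` (U \<inter> W)"
  have V: "open V" "V \<subseteq> \<phi> ` U" unfolding V_def using open_chart_image[OF U W(1)] by auto
  have \<psi>W: "?\<psi> y \<in> W" if "y \<in> V" for y using that chart(5)[OF U] by (auto simp: V_def)
  have \<phi>\<psi>: "\<phi> (?\<psi> y) = y" if "y \<in> V" for y using that V(2) by (intro chart_inv(1)) auto
  define Y where "Y = (\<lambda>i y. \<Sum>a\<in>Basis. \<xi> i (?\<psi> y) (X a) *\<^sub>R a)"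
  have smY: "smooth_on V (\<lambda>y. \<xi> i (?\<psi> y) (X a))" for i a
    using smooth_on_subset[OF smooth_fun_on_chart[OF vector_fieldD(2)[OF \<xi> X(1)] U] V(2)] by (simp add: o_def)
  have Y: "smooth_on V (Y i)" for i
    unfolding Y_def by (intro smooth_on_sum smooth_on_scaleR smooth_on_const smY V)
  have Dlin: "linear (frechet_derivative (h \<circ> ?\<psi>) (at y))" if "smooth_fun A h" "y \<in> V" for h y
    using smooth_on_has_derivative[OF smooth_fun_on_chart[OF that(1) U]] that(2) V(2)
    by (blast dest: has_derivative_linear)
  have \<xi>Y: "\<xi> i (?\<psi> y) h = frechet_derivative (h \<circ> ?\<psi>) (at y) (Y i y)"
    if h: "smooth_fun A h" and y: "y \<in> V" for i h y
  proof -
    have "\<xi> i (?\<psi> y) h = (\<Sum>a\<in>Basis. frechet_derivative (h \<circ> ?\<psi>) (at (\<phi> (?\<psi> y))) a * \<xi> i (?\<psi> y) (X a))"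
      by (rule chart_expansion[OF U vector_fieldD(1)[OF \<xi>] h W(1) \<psi>W[OF y] W(3) X])
    also have "\<dots> = frechet_derivative (h \<circ> ?\<psi>) (at y) (Y i y)"
      unfolding Y_def \<phi>\<psi>[OF y]
      by (simp add: linear_sum[OF Dlin[OF h y]] linear_scale[OF Dlin[OF h y]] mult.commute)
    finally show ?thesis .
  qed
  have commY: "frechet_derivative (Y i) (at y) (Y j y) = frechet_derivative (Y j) (at y) (Y i y)"
    if y: "y \<in> V" for i j y
  proof (rule euclidean_eqI)
    fix a :: 'e assume a: "a \<in> Basis"
    have "frechet_derivative (Y i) (at y) v \<bullet> a
        = frechet_derivative ((\<lambda>x. \<xi> i x (X a)) \<circ> ?\<psi>) (at y) v" for i v
    proof -
      have "((\<lambda>y. Y i y \<bullet> a) has_derivative (\<lambda>v. frechet_derivative (Y i) (at y) v \<bullet> a)) (at y)"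
        by (rule has_derivative_inner_left[OF smooth_on_has_derivative[OF Y y]])
      moreover have "(\<lambda>y. Y i y \<bullet> a) = (\<lambda>x. \<xi> i x (X a)) \<circ> ?\<psi>"
        using a by (auto simp: Y_def inner_sum_left_Basis)
      ultimately show ?thesis by (metis frechet_derivative_at)
    qed
    \<comment> \<open>Component a of the derivative of \<open>Y i\<close> along \<open>Y j\<close>
      is \<open>\<xi> j\<close> applied to the function \<open>\<xi> i\<close> (X a); its
      antisymmetric part in i and j is the bracket evaluated on the coordinate X a.\<close>
    then have "frechet_derivative (Y i) (at y) (Y j y) \<bullet> a = \<xi> j (?\<psi> y) (\<lambda>x. \<xi> i x (X a))" for i j
      using \<xi>Y[OF vector_fieldD(2)[OF \<xi> X(1)] y] by simp
    moreover have "lie_bracket A (\<xi> i) (\<xi> j) (?\<psi> y) (X a) = 0" using comm by simp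
    ultimately show "frechet_derivative (Y i) (at y) (Y j y) \<bullet> a = frechet_derivative (Y j) (at y) (Y i y) \<bullet> a"
      using lie_bracket_apply[OF X(1)] by simp
  qed
  have x0V: "\<phi> x0 \<in> V" using W by (auto simp: V_def)
  obtain \<delta> and G :: "real ^ 'p \<Rightarrow> 'e" where \<delta>: "\<delta> > 0" and G0: "G 0 = \<phi> x0" and GV: "G ` ball 0 \<delta> \<subseteq> V"
    and G: "\<And>t. t \<in> ball 0 \<delta> \<Longrightarrow> (G has_derivative (\<lambda>h. \<Sum>i\<in>UNIV. (h $ i) *\<^sub>R Y i (G t))) (at t)"
    by (rule commuting_fields_integral_map[where X = Y, OF V(1) x0V Y commY]) (assumption, rule that)
  have indepY: "h = 0" if h: "(\<Sum>i\<in>UNIV. (h $ i) *\<^sub>R Y i (G 0)) = 0" for h :: "real ^ 'p"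
  proof -
    let ?v = "\<Sum>i\<in>UNIV. (h $ i) *\<^sub>R \<xi> i x0"
    have "?v \<in> tangent_space A x0"
      by (intro subspace_sum[OF subspace_tangent_space] subspace_scale[OF subspace_tangent_space]
          vector_fieldD(1)[OF \<xi>])
    moreover have "?v (X a) = 0" if a: "a \<in> Basis" for a
    proof -
      have "?\<psi> (G 0) = x0" using chart(5)[OF U] W G0 by auto
      then have "?v (X a) = (\<Sum>i\<in>UNIV. (h $ i) *\<^sub>R Y i (G 0)) \<bullet> a"
        using a by (simp add: Y_def sum_fun_apply inner_sum_left[of _ UNIV] inner_sum_left_Basis)
      then show ?thesis using h by simp
    qed
    ultimately have "?v = 0" using frame[OF W(2), of ?v] by simp
    then show ?thesis by (rule indep)
  qed
  obtain r where r: "r > 0" "ball (0 :: real ^ 'p) r \<subseteq> ball 0 \<delta>" "inj_on G (ball 0 r)"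
    by (rule integral_map_locally_injective[OF \<delta> V(1) GV smooth_on_imp_continuous_on[OF Y] G indepY])
  define F where "F = (\<lambda>t. ?\<psi> (G t))"
  let ?S = "ball (0 :: real ^ 'p) r"
  have GS: "G t \<in> V" if "t \<in> ?S" for t using that r(2) GV by blast
  have contG: "continuous_on ?S G"
    using G r(2) by (intro continuous_at_imp_continuous_on ballI has_derivative_continuous) blast
  have "smooth_map_into A ?S F"
    unfolding smooth_map_into_def
  proof (intro conjI, goal_cases)
    case 1
    show ?case unfolding F_def
      by (rule continuous_on_compose2[OF chart(4)[OF U] contG]) (use GS V(2) in auto)
  next
    case 2
    show ?case
    proof clarify
      fix V' \<psi> assume V': "(V', \<psi>) \<in> A"
      \<comment> \<open>In the chart \<open>\<psi>\<close>, the map F is the transition map along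
        \<open>G\<close>, which is controlled only over the overlap of the two charts.\<close>
      let ?T = "V \<inter> \<phi> ` (U \<inter> V')"
      have T: "open ?T" using V(1) open_chart_image[OF U chart(1)[OF V']] by blast
      have "smooth_on (?S \<inter> G -` ?T) (\<lambda>t. (\<lambda>y. \<psi> (?\<psi> y)) (G t))"
      proof (rule smooth_on_integral_map[where X = Y])
        show "smooth_on ?T (Y i)" for i by (rule smooth_on_subset[OF Y]) simp
        show "smooth_on ?T (\<lambda>y. \<psi> (?\<psi> y))" by (rule smooth_on_subset[OF transition[OF U V']]) simp
        show "(G has_derivative (\<lambda>h. \<Sum>i\<in>UNIV. (h $ i) *\<^sub>R Y i (G t))) (at t)" if "t \<in> ?S" for t
          using G r(2) that by blast
      qed (use T in auto)
      moreover have "?S \<inter> G -` ?T = ?S \<inter> F -` V'"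
      proof -
        have "G t \<in> \<phi> ` (U \<inter> V') \<longleftrightarrow> ?\<psi> (G t) \<in> V'" if "G t \<in> V" for t
        proof
          assume "G t \<in> \<phi> ` (U \<inter> V')"
          then show "?\<psi> (G t) \<in> V'" using chart(5)[OF U] by auto
        next
          have G: "G t \<in> \<phi> ` U" using that V(2) by blast
          assume "?\<psi> (G t) \<in> V'"
          then show "G t \<in> \<phi> ` (U \<inter> V')"
            using chart_inv[OF G] by (intro image_eqI[of _ _ "?\<psi> (G t)"]) auto
        qed
        then show ?thesis using GS by (auto simp: F_def)
      qed
      ultimately show "smooth_on (?S \<inter> F -` V') (\<psi> \<circ> F)" by (simp add: F_def o_def)
    qed
  qed
  moreover have "inj_on F ?S"
  proof (rule inj_onI)
    fix s t assume st: "s \<in> ?S" "t \<in> ?S" "F s = F t"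
    then have "G s = G t" using \<phi>\<psi> GS unfolding F_def by metis
    then show "s = t" using r(3) st by (auto dest: inj_onD)
  qed
  moreover have "inj (differential A F t) \<and> range (differential A F t) = span (range (\<lambda>i. \<xi> i (F t)))"
    if t: "t \<in> ?S" for t
  proof -
    let ?L = "\<lambda>h::real^'p. \<Sum>i\<in>UNIV. (h $ i) *\<^sub>R \<xi> i (F t)"
    have "differential A F t h k = ?L h k" for h k
    proof (cases "smooth_fun A k")
      case True
      have "((\<lambda>s. (k \<circ> ?\<psi>) (G s)) has_derivative (\<lambda>h. frechet_derivative (k \<circ> ?\<psi>) (at (G t))
          (\<Sum>i\<in>UNIV. (h $ i) *\<^sub>R Y i (G t)))) (at t)"
        by (rule has_derivative_compose[OF G smooth_on_has_derivative[OF smooth_fun_on_chart[OF True U]]])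
           (use t r(2) GS V(2) in auto)
      from frechet_derivative_at[OF this, symmetric]
      have "differential A F t h k = frechet_derivative (k \<circ> ?\<psi>) (at (G t))
          (\<Sum>i\<in>UNIV. (h $ i) *\<^sub>R Y i (G t))"
        using True by (simp add: differential_def F_def o_def)
      also have "\<dots> = (\<Sum>i\<in>UNIV. (h $ i) *\<^sub>R frechet_derivative (k \<circ> ?\<psi>) (at (G t)) (Y i (G t)))"
        using Dlin[OF True GS[OF t]] by (simp add: linear_sum linear_scale)
      also have "\<dots> = ?L h k"
        by (simp add: sum_fun_apply F_def \<xi>Y[OF True GS[OF t]])
      finally show ?thesis .
    next
      case False
      then show ?thesis
        using tangent_nonsmooth[OF vector_fieldD(1)[OF \<xi>]] by (simp add: differential_def sum_fun_apply)
    qed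
    then have diff: "differential A F t = ?L" by (intro ext) simp
    have lin: "linear ?L"
      by (rule linearI) (simp_all add: scaleR_add_left sum.distrib scaleR_sum_right)
    have "inj ?L" using linear_injective_0[OF lin] indep by blast
    moreover have "range ?L = span (range (\<lambda>i. \<xi> i (F t)))"
    proof
      show "range ?L \<subseteq> span (range (\<lambda>i. \<xi> i (F t)))"
        by (auto intro!: span_sum span_scale intro: span_base)
      have "\<xi> i (F t) \<in> range ?L" for i
      proof
        show "\<xi> i (F t) = ?L (axis i 1)"
          by (simp add: axis_def if_distrib[of "\<lambda>c. c *\<^sub>R _"] cong: if_cong)
      qed simp
      then show "span (range (\<lambda>i. \<xi> i (F t))) \<subseteq> range ?L"
        by (intro span_minimal linear_subspace_image[OF lin]) auto
    qed
    ultimately show ?thesis by (simp add: diff)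
  qed
  ultimately have "integral_manifold A (\<lambda>x. span (range (\<lambda>i. \<xi> i x))) ?S F"
    unfolding integral_manifold_def by blast
  moreover have "x0 \<in> F ` ?S"
    using chart(5)[OF U] W G0 r(1) by (intro image_eqI[of _ _ 0]) (auto simp: F_def)
  ultimately show ?thesis by (rule that)
qed

end

section \<open>Inner products on subspaces\<close>

text \<open>Relative to a subspace because \<open>g x\<close> is constrained only on the tangent
  space, itself a subspace of the type of all functionals.\<close>

locale inner_product_on =
  fixes T :: "'v::real_vector set" and B :: "'v \<Rightarrow> 'v \<Rightarrow> real"
  assumes subspace: "subspace T"
    and add_left: "u \<in> T \<Longrightarrow> v \<in> T \<Longrightarrow> w \<in> T \<Longrightarrow> B (u + v) w = B u w + B v w"
    and scale_left: "u \<in> T \<Longrightarrow> w \<in> T \<Longrightarrow> B (c *\<^sub>R u) w = c * B u w"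
    and sym: "u \<in> T \<Longrightarrow> v \<in> T \<Longrightarrow> B u v = B v u"
    and pos: "u \<in> T \<Longrightarrow> u \<noteq> 0 \<Longrightarrow> B u u > 0"
begin

lemma zero_mem: "0 \<in> T"
  and add_mem: "u \<in> T \<Longrightarrow> v \<in> T \<Longrightarrow> u + v \<in> T"
  and scale_mem: "u \<in> T \<Longrightarrow> c *\<^sub>R u \<in> T"
  and minus_mem: "u \<in> T \<Longrightarrow> - u \<in> T"
  and diff_mem: "u \<in> T \<Longrightarrow> v \<in> T \<Longrightarrow> u - v \<in> T"
  and sum_mem: "(\<And>i. i \<in> I \<Longrightarrow> w i \<in> T) \<Longrightarrow> (\<Sum>i\<in>I. w i) \<in> T"
  using subspace by (auto intro: subspace_0 subspace_add subspace_scale subspace_neg subspace_diff subspace_sum)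

lemma zero_left: "w \<in> T \<Longrightarrow> B 0 w = 0"
  using scale_left[OF zero_mem, of w 0] by simp

lemma minus_left: "u \<in> T \<Longrightarrow> w \<in> T \<Longrightarrow> B (- u) w = - B u w"
  using scale_left[of u w "-1"] by simp

lemma diff_left: "u \<in> T \<Longrightarrow> v \<in> T \<Longrightarrow> w \<in> T \<Longrightarrow> B (u - v) w = B u w - B v w"
  using add_left[of u "- v" w] minus_left minus_mem by simp

lemma sum_left: "(\<And>i. i \<in> I \<Longrightarrow> v i \<in> T) \<Longrightarrow> w \<in> T \<Longrightarrow> B (\<Sum>i\<in>I. v i) w = (\<Sum>i\<in>I. B (v i) w)"
  by (induction I rule: infinite_finite_induct) (auto simp: zero_left add_left sum_mem)

lemma add_right: "u \<in> T \<Longrightarrow> v \<in> T \<Longrightarrow> w \<in> T \<Longrightarrow> B w (u + v) = B w u + B w v"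
  using add_left sym add_mem by metis

lemma scale_right: "u \<in> T \<Longrightarrow> w \<in> T \<Longrightarrow> B w (c *\<^sub>R u) = c * B w u"
  using scale_left sym scale_mem by metis

lemma minus_right: "u \<in> T \<Longrightarrow> w \<in> T \<Longrightarrow> B w (- u) = - B w u"
  using minus_left sym minus_mem by metis

lemma diff_right: "u \<in> T \<Longrightarrow> v \<in> T \<Longrightarrow> w \<in> T \<Longrightarrow> B w (u - v) = B w u - B w v"
  using diff_left sym diff_mem by metis

lemma sum_right: "(\<And>i. i \<in> I \<Longrightarrow> v i \<in> T) \<Longrightarrow> w \<in> T \<Longrightarrow> B w (\<Sum>i\<in>I. v i) = (\<Sum>i\<in>I. B w (v i))"
  using sum_left[of I v w] sym[of w] sum_mem[of I v] by simp

lemma zero_right: "w \<in> T \<Longrightarrow> B w 0 = 0"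
  using zero_left sym zero_mem by metis

text \<open>Gram-Schmidt; if the residual \<open>w\<close> vanishes, the new vector already lies in
  the span and nothing is added.\<close>

lemma orthonormal_basis_exists:
  assumes "finite C" "C \<subseteq> T"
  obtains E where "finite E" "E \<subseteq> T" "span C \<subseteq> span E" "\<And>d e. d \<in> E \<Longrightarrow> e \<in> E \<Longrightarrow> B d e = (if d = e then 1 else 0)"
proof -
  have "\<exists>E. finite E \<and> E \<subseteq> T \<and> span C \<subseteq> span E \<and> (\<forall>d\<in>E. \<forall>e\<in>E. B d e = (if d = e then 1 else 0))"
    using assms
  proof (induction C rule: finite_induct)
    case empty
    show ?case by (intro exI[of _ "{}"]) auto
  next
    case (insert c C)
    then obtain E where E: "finite E" "E \<subseteq> T" "span C \<subseteq> span E"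
      and on: "\<And>d e. d \<in> E \<Longrightarrow> e \<in> E \<Longrightarrow> B d e = (if d = e then 1 else 0)" by auto
    have c: "c \<in> T" using insert.prems by simp
    define p where "p = (\<Sum>e\<in>E. B c e *\<^sub>R e)"
    define w where "w = c - p"
    have pT: "p \<in> T" unfolding p_def using E(2) by (auto intro!: sum_mem scale_mem)
    have wT: "w \<in> T" unfolding w_def by (intro diff_mem c pT)
    have pE: "p \<in> span E" unfolding p_def by (auto intro!: span_sum span_scale intro: span_base)
    have wd: "B w d = 0" if d: "d \<in> E" for d
    proof -
      have "B p d = (\<Sum>e\<in>E. B c e * B e d)"
        unfolding p_def using E(2) d by (subst sum_left) (auto simp: subset_iff scale_left scale_mem)
      also have "\<dots> = (\<Sum>e\<in>E. if e = d then B c e else 0)" using on[OF _ d] by (intro sum.cong) auto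
      also have "\<dots> = B c d" using E(1) d by simp
      finally show ?thesis unfolding w_def using c pT E(2) d by (subst diff_left) auto
    qed
    have cspan: "span (insert c C) \<subseteq> span F" if "span E \<subseteq> span F" "c \<in> span F" for F
      using that E(3) span_superset[of C] by (intro span_minimal subspace_span) auto
    show ?case
    proof (cases "w = 0")
      case True
      then have "c \<in> span E" using pE by (simp add: w_def)
      then show ?thesis using E on cspan[of E] by (intro exI[of _ E]) auto
    next
      case False
      let ?n = "sqrt (B w w)" and ?w = "(1 / sqrt (B w w)) *\<^sub>R w"
      have n: "?n > 0" using pos[OF wT False] by simp
      have w'T: "?w \<in> T" by (rule scale_mem[OF wT])
      have "B ?w ?w = (1 / ?n) * ((1 / ?n) * B w w)" using scale_left scale_right wT w'T by simp
      also have "\<dots> = 1" using n pos[OF wT False] by (simp add: field_simps)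
      finally have ww: "B ?w ?w = 1" .
      have w'd: "B ?w d = 0" "B d ?w = 0" if "d \<in> E" for d
        using scale_left[OF wT, of d] wd[OF that] sym[OF w'T, of d] that E(2) by auto
      have "?w \<notin> E" using w'd(1)[of ?w] ww by auto
      have "?w \<in> span (insert ?w E)" by (intro span_base) simp
      then have "?n *\<^sub>R ?w \<in> span (insert ?w E)" by (rule span_scale)
      then have "w \<in> span (insert ?w E)" using n by simp
      moreover have "span E \<subseteq> span (insert ?w E)" by (intro span_mono) auto
      ultimately have "p + w \<in> span (insert ?w E)" using pE by (intro span_add) auto
      then have "c \<in> span (insert ?w E)" by (simp add: w_def)
      then have "span (insert c C) \<subseteq> span (insert ?w E)"
        by (intro cspan span_mono) auto
      then show ?thesis
        using E(1,2) on ww w'd w'T \<open>?w \<notin> E\<close> by (intro exI[of _ "insert ?w E"]) auto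
    qed
  qed
  then show ?thesis using that by blast
qed

lemma orthonormal_expansion:
  assumes E: "finite E" "E \<subseteq> T" and on: "\<And>d e. d \<in> E \<Longrightarrow> e \<in> E \<Longrightarrow> B d e = (if d = e then 1 else 0)"
    and v: "v \<in> span E"
  shows "v = (\<Sum>e\<in>E. B v e *\<^sub>R e)"
proof -
  obtain c where c: "v = (\<Sum>e\<in>E. c e *\<^sub>R e)" using v span_finite[OF E(1)] by auto
  have "B v d = c d" if d: "d \<in> E" for d
  proof -
    have "B v d = (\<Sum>e\<in>E. c e * B e d)"
      unfolding c using E(2) d by (subst sum_left) (auto simp: subset_iff scale_left scale_mem)
    also have "\<dots> = (\<Sum>e\<in>E. if e = d then c e else 0)" using on[OF _ d] by (intro sum.cong) auto
    finally show ?thesis using E(1) d by simp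
  qed
  then have "(\<Sum>e\<in>E. B v e *\<^sub>R e) = (\<Sum>e\<in>E. c e *\<^sub>R e)" by (intro sum.cong) auto
  then show ?thesis using c by simp
qed

end

section \<open>The Lie derivative of a metric\<close>

context smooth_manifold
begin

lemma inner_product_on_tangent_space:
  "riemannian_metric A g \<Longrightarrow> inner_product_on (tangent_space A x) (g x)"
  unfolding riemannian_metric_def by (unfold_locales) (auto intro: subspace_tangent_space)

lemma lie_bracket_add_right:
  assumes "vector_field A X" "vector_field A Y" "vector_field A Z"
  shows "lie_bracket A X (\<lambda>x. Y x + Z x) x = lie_bracket A X Y x + lie_bracket A X Z x"
proof
  fix h
  show "lie_bracket A X (\<lambda>x. Y x + Z x) x h = (lie_bracket A X Y x + lie_bracket A X Z x) h"
  proof (cases "smooth_fun A h")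
    case True
    then show ?thesis
      using tangent_add[OF vector_fieldD(1)[OF assms(1)]] vector_fieldD(2)[OF assms(2)] vector_fieldD(2)[OF assms(3)]
      by (simp add: lie_bracket_apply)
  qed (simp add: lie_bracket_def)
qed

lemma lie_bracket_scale_right:
  assumes X: "vector_field A X" and Y: "vector_field A Y" and h: "smooth_fun A h"
  shows "lie_bracket A X (\<lambda>x. h x *\<^sub>R Y x) x = X x h *\<^sub>R Y x + h x *\<^sub>R lie_bracket A X Y x"
proof
  fix k
  show "lie_bracket A X (\<lambda>x. h x *\<^sub>R Y x) x k = (X x h *\<^sub>R Y x + h x *\<^sub>R lie_bracket A X Y x) k"
  proof (cases "smooth_fun A k")
    case True
    then show ?thesis
      using tangent_mult[OF vector_fieldD(1)[OF X] h vector_fieldD(2)[OF Y]]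
      by (simp add: lie_bracket_apply algebra_simps)
  next
    case False
    then show ?thesis using tangent_nonsmooth[OF vector_fieldD(1)[OF Y]] by (simp add: lie_bracket_def)
  qed
qed

lemma lie_bracket_swap: "lie_bracket A X Y x = - lie_bracket A Y X x"
  by (auto simp: lie_bracket_def)

lemma lie_bracket_zero_right: "vector_field A X \<Longrightarrow> lie_bracket A X (\<lambda>x. 0) x = 0"
  using tangent_const[OF vector_fieldD(1)] by (auto simp: lie_bracket_def vfield_app_def)

context
  fixes g :: "'a tensor02" and Z Y :: "'a vfield"
  assumes g: "riemannian_metric A g" and Z: "vector_field A Z" and Y: "vector_field A Y"
begin

interpretation ip: inner_product_on "tangent_space A x" "g x" for x
  by (rule inner_product_on_tangent_space[OF g])

lemma smooth_fun_metric: "vector_field A V \<Longrightarrow> vector_field A W \<Longrightarrow> smooth_fun A (\<lambda>x. g x (V x) (W x))"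
  using g unfolding riemannian_metric_def tensor02_app_def by blast

lemma lie_derivative_metric_add_right:
  assumes V: "vector_field A V" and W: "vector_field A W"
  shows "lie_derivative_metric A Z g Y (\<lambda>x. V x + W x) x
    = lie_derivative_metric A Z g Y V x + lie_derivative_metric A Z g Y W x"
  unfolding lie_derivative_metric_def vfield_app_def tensor02_app_def
  by (simp add: lie_bracket_add_right[OF Z V W] ip.add_right vector_fieldD(1) V W Y Z
      vector_field_lie_bracket tangent_add[OF vector_fieldD(1)[OF Z]] smooth_fun_metric)

text \<open>The product rule contributes Z(h) g(Y, W) once from differentiating the inner product
  and once from the bracket, with opposite signs.\<close>

lemma lie_derivative_metric_scale_right:
  assumes W: "vector_field A W" and h: "smooth_fun A h"
  shows "lie_derivative_metric A Z g Y (\<lambda>x. h x *\<^sub>R W x) x = h x * lie_derivative_metric A Z g Y W x"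
  unfolding lie_derivative_metric_def vfield_app_def tensor02_app_def
  by (simp add: lie_bracket_scale_right[OF Z W h] ip.add_right ip.scale_right ip.scale_mem vector_fieldD(1)
      W Y Z vector_field_lie_bracket tangent_mult[OF vector_fieldD(1)[OF Z] h] smooth_fun_metric algebra_simps)

lemma lie_derivative_metric_sum_right:
  assumes "finite I" "\<And>i. i \<in> I \<Longrightarrow> vector_field A (W i)" "\<And>i. i \<in> I \<Longrightarrow> smooth_fun A (h i)"
  shows "lie_derivative_metric A Z g Y (\<lambda>x. \<Sum>i\<in>I. h i x *\<^sub>R W i x) x
    = (\<Sum>i\<in>I. h i x * lie_derivative_metric A Z g Y (W i) x)"
  using assms
proof (induction I rule: finite_induct)
  case empty
  show ?case
    unfolding lie_derivative_metric_def vfield_app_def tensor02_app_def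
    by (simp add: lie_bracket_zero_right[OF Z] ip.zero_right vector_fieldD(1) Y Z vector_field_lie_bracket
        tangent_const[OF vector_fieldD(1)[OF Z]])
next
  case (insert i I)
  have IH: "lie_derivative_metric A Z g Y (\<lambda>x. \<Sum>i\<in>I. h i x *\<^sub>R W i x) x
      = (\<Sum>i\<in>I. h i x * lie_derivative_metric A Z g Y (W i) x)"
    by (rule insert.IH) (use insert.prems in auto)
  have hW: "vector_field A (\<lambda>x. h j x *\<^sub>R W j x)" if "j \<in> insert i I" for j
    by (rule vector_field_scale) (use insert.prems that in auto)
  have "lie_derivative_metric A Z g Y (\<lambda>x. h i x *\<^sub>R W i x + (\<Sum>i\<in>I. h i x *\<^sub>R W i x)) x
      = lie_derivative_metric A Z g Y (\<lambda>x. h i x *\<^sub>R W i x) x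
        + lie_derivative_metric A Z g Y (\<lambda>x. \<Sum>i\<in>I. h i x *\<^sub>R W i x) x"
    by (rule lie_derivative_metric_add_right[OF hW vector_field_sum[OF hW]]) auto
  moreover have "lie_derivative_metric A Z g Y (\<lambda>x. h i x *\<^sub>R W i x) x
      = h i x * lie_derivative_metric A Z g Y (W i) x"
    by (rule lie_derivative_metric_scale_right) (use insert.prems in auto)
  ultimately show ?case unfolding sum.insert[OF insert.hyps(1,2)] IH by (simp only:)
qed

text \<open>Tensoriality: the frame expansion multiplied by \<open>\<beta>\<close> is an identity of
  fields, so linearity over smooth functions expresses the value at \<open>x0\<close> by the
  components of the field at \<open>x0\<close>.\<close>

lemma lie_derivative_metric_cong_point:
  assumes V: "vector_field A V" and W: "vector_field A W" and eq: "V x0 = W x0"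
  shows "lie_derivative_metric A Z g Y V x0 = lie_derivative_metric A Z g Y W x0"
proof -
  obtain X E \<beta> where X: "\<And>a::'e. smooth_fun A (X a)" and E: "\<And>a. vector_field A (E a)"
    and \<beta>: "smooth_fun A \<beta>" "\<beta> x0 = 1"
    and frame: "\<And>x v. v \<in> tangent_space A x \<Longrightarrow> \<beta> x *\<^sub>R v = (\<Sum>a\<in>Basis. (\<beta> x * v (X a)) *\<^sub>R E a x)"
    by (rule global_frame[of x0]) blast
  have "lie_derivative_metric A Z g Y V x0
      = (\<Sum>a\<in>Basis. V x0 (X a) * lie_derivative_metric A Z g Y (E a) x0)" if V: "vector_field A V" for V
  proof -
    have "(\<lambda>x. \<beta> x *\<^sub>R V x) = (\<lambda>x. \<Sum>a\<in>Basis. (\<beta> x * V x (X a)) *\<^sub>R E a x)"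
      using frame[OF vector_fieldD(1)[OF V]] by blast
    then have "lie_derivative_metric A Z g Y (\<lambda>x. \<beta> x *\<^sub>R V x) x0
        = lie_derivative_metric A Z g Y (\<lambda>x. \<Sum>a\<in>Basis. (\<beta> x * V x (X a)) *\<^sub>R E a x) x0" by simp
    then show ?thesis
      by (simp add: lie_derivative_metric_scale_right[OF V \<beta>(1)] \<beta> E V X smooth_fun_mult
          lie_derivative_metric_sum_right vector_fieldD(2))
  qed
  then show ?thesis using V W eq by simp
qed

end

end

section \<open>Weak K-manifolds\<close>

locale weak_K_manifold = smooth_manifold A
  for A :: "('a::t2_space, 'e::euclidean_space) atlas" +
  fixes n :: nat and f Q :: "'a tensor11" and \<xi> :: "'p::finite \<Rightarrow> 'a vfield"
    and \<eta> :: "'p \<Rightarrow> 'a oneform" and g :: "'a tensor02"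
  assumes weak_K: "weak_K_structure A n f Q \<xi> \<eta> g"
begin

lemma weak_f_structure: "metric_weak_f_structure A n f Q \<xi> \<eta> g"
  using weak_K unfolding weak_K_structure_def by blast

lemma metric: "riemannian_metric A g"
  using weak_f_structure unfolding metric_weak_f_structure_def by blast

sublocale ip: inner_product_on "tangent_space A x" "g x" for x
  by (rule inner_product_on_tangent_space[OF metric])

section \<open>Pointwise algebra of a metric weak f-structure\<close>

lemma \<xi>: "vector_field A (\<xi> i)"
  and span_\<xi>: "span (range (\<lambda>i. \<xi> i x)) = char_distribution A f x"
  and \<eta>_\<xi>: "\<eta> i x (\<xi> j x) = (if i = j then 1 else 0)"
  using weak_f_structure unfolding metric_weak_f_structure_def by blast+

lemma f_tensor: "tensor11_field A f" and Q_tensor: "tensor11_field A Q"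
  and \<eta>_oneform: "oneform_field A (\<eta> i)"
  using weak_f_structure unfolding metric_weak_f_structure_def by blast+

lemma f_mem: "v \<in> tangent_space A x \<Longrightarrow> f x v \<in> tangent_space A x"
  and f_add: "u \<in> tangent_space A x \<Longrightarrow> v \<in> tangent_space A x \<Longrightarrow> f x (u + v) = f x u + f x v"
  and f_scale: "v \<in> tangent_space A x \<Longrightarrow> f x (c *\<^sub>R v) = c *\<^sub>R f x v"
  and f_field: "vector_field A X \<Longrightarrow> vector_field A (\<lambda>x. f x (X x))"
  using f_tensor unfolding tensor11_field_def tensor_app_def by auto

lemma Q_mem: "v \<in> tangent_space A x \<Longrightarrow> Q x v \<in> tangent_space A x"
  and Q_field: "vector_field A X \<Longrightarrow> vector_field A (\<lambda>x. Q x (X x))"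
  using Q_tensor unfolding tensor11_field_def tensor_app_def by auto

lemma Q_bij: "bij_betw (Q x) (tangent_space A x) (tangent_space A x)"
  and Q_char: "v \<in> char_distribution A f x \<Longrightarrow> Q x v = v"
  using weak_f_structure unfolding metric_weak_f_structure_def by blast+

lemma Q_surj: "Q x ` tangent_space A x = tangent_space A x"
  by (rule bij_betw_imp_surj_on[OF Q_bij])

lemma \<eta>_field: "vector_field A X \<Longrightarrow> smooth_fun A (\<lambda>x. \<eta> i x (X x))"
  using \<eta>_oneform unfolding oneform_field_def oneform_app_def by blast

lemma f_f: "v \<in> tangent_space A x \<Longrightarrow> f x (f x v) = - Q x v + (\<Sum>i\<in>UNIV. \<eta> i x v *\<^sub>R \<xi> i x)"
  and f_f_f: "v \<in> tangent_space A x \<Longrightarrow> f x (f x (f x v)) + f x (Q x v) = 0"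
  and g_f_f: "u \<in> tangent_space A x \<Longrightarrow> v \<in> tangent_space A x \<Longrightarrow>
    g x (f x u) (f x v) = g x u (Q x v) - (\<Sum>i\<in>UNIV. \<eta> i x u * \<eta> i x (Q x v))"
  using weak_f_structure unfolding metric_weak_f_structure_def by blast+

lemma \<xi>_mem: "\<xi> i x \<in> tangent_space A x"
  by (rule vector_fieldD(1)[OF \<xi>])

lemma \<xi>_char: "\<xi> i x \<in> char_distribution A f x"
  unfolding span_\<xi>[symmetric] by (rule span_base) simp

lemma f_\<xi>: "f x (\<xi> i x) = 0"
  using \<xi>_char[of i x] by (simp add: char_distribution_def)

lemma f_0: "f x 0 = 0"
  using f_scale[OF ip.zero_mem, of x 0] by simp

lemma f_minus: "v \<in> tangent_space A x \<Longrightarrow> f x (- v) = - f x v"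
  using f_scale[of v x "-1"] by simp

lemma f_diff: "u \<in> tangent_space A x \<Longrightarrow> v \<in> tangent_space A x \<Longrightarrow> f x (u - v) = f x u - f x v"
  using f_add[of u x "- v"] f_minus ip.minus_mem by simp

text \<open>Compatibility with second argument \<open>\<xi> i x\<close>: the left side vanishes
  since f kills this vector, and on the right Q fixes it.\<close>

lemma \<eta>_eq: "v \<in> tangent_space A x \<Longrightarrow> \<eta> i x v = g x v (\<xi> i x)"
  using g_f_f[OF _ \<xi>_mem]
  by (simp add: f_\<xi> Q_char[OF \<xi>_char] ip.zero_right f_mem \<eta>_\<xi> if_distrib cong: if_cong)

lemma g_\<xi>_\<xi>: "g x (\<xi> i x) (\<xi> j x) = (if i = j then 1 else 0)"
  by (metis \<eta>_eq \<xi>_mem \<eta>_\<xi>)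

lemma \<eta>_hor: "\<eta> i x (\<Sum>j\<in>UNIV. c j *\<^sub>R \<xi> j x) = c i"
  by (simp add: \<eta>_eq ip.sum_mem ip.scale_mem \<xi>_mem ip.sum_left ip.scale_left g_\<xi>_\<xi> if_distrib cong: if_cong)

lemma \<eta>_diff:
  assumes "u \<in> tangent_space A x" "v \<in> tangent_space A x"
  shows "\<eta> i x (u - v) = \<eta> i x u - \<eta> i x v"
  using ip.diff_left[OF assms \<xi>_mem] \<eta>_eq assms ip.diff_mem by simp

lemma f_f_diff:
  assumes "v \<in> tangent_space A x"
  shows "f x (f x v) = (\<Sum>i\<in>UNIV. \<eta> i x v *\<^sub>R \<xi> i x) - Q x v"
  using f_f[OF assms] by simp

lemma hor_mem: "(\<Sum>i\<in>UNIV. c i *\<^sub>R \<xi> i x) \<in> tangent_space A x"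
  by (intro ip.sum_mem ip.scale_mem \<xi>_mem)

text \<open>On ker f the formula for f^2 has left side 0, and Q acts as the identity.\<close>

lemma char_expansion:
  assumes "v \<in> tangent_space A x" "f x v = 0"
  shows "v = (\<Sum>i\<in>UNIV. \<eta> i x v *\<^sub>R \<xi> i x)"
  using f_f[OF assms(1)] assms f_0 Q_char[of v x] by (simp add: char_distribution_def)

lemma char_eq_0: "v \<in> tangent_space A x \<Longrightarrow> f x v = 0 \<Longrightarrow> (\<And>i. \<eta> i x v = 0) \<Longrightarrow> v = 0"
  using char_expansion by fastforce

text \<open>With \<open>P\<close> the orthogonal projection onto the common kernel of the \<open>\<eta>\<close>'s and \<open>S = P f\<close>, compatibility says
  \<open>|f e|\<^sup>2 = - g(e, S\<^sup>2 e)\<close>. Summed over an orthonormal basis this gives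
  \<open>\<Sum>|f e|\<^sup>2 = - tr S\<^sup>2 \<le> \<Sum>|S e|\<^sup>2\<close>, so \<open>f\<close> has no component along the \<open>\<xi>\<close>'s.\<close>

lemma \<eta>_f:
  assumes v: "v \<in> tangent_space A x"
  shows "\<eta> i x (f x v) = 0"
proof -
  let ?T = "tangent_space A x"
  obtain C where C: "finite C" "?T = span C" by (rule tangent_finite_span)
  then have "C \<subseteq> ?T" by (simp add: span_superset)
  then obtain E where E: "finite E" "E \<subseteq> ?T" "?T \<subseteq> span E"
    and on: "\<And>d e. d \<in> E \<Longrightarrow> e \<in> E \<Longrightarrow> g x d e = (if d = e then 1 else 0)"
    using ip.orthonormal_basis_exists[OF C(1), of x] C(2) by metis
  define P where "P = (\<lambda>v. v - (\<Sum>i\<in>UNIV. \<eta> i x v *\<^sub>R \<xi> i x))"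
  define S where "S = (\<lambda>v. P (f x v))"
  note hor = hor_mem[of _ x]
  have Pm: "P v \<in> ?T" if "v \<in> ?T" for v unfolding P_def by (intro ip.diff_mem that hor)
  have gP: "g x (P u) w = g x u w - (\<Sum>i\<in>UNIV. \<eta> i x u * \<eta> i x w)" if "u \<in> ?T" "w \<in> ?T" for u w
    unfolding P_def using that hor
    by (simp add: ip.diff_left ip.sum_left ip.scale_left ip.scale_mem \<xi>_mem \<eta>_eq[of w] ip.sym[of "\<xi> _ x"])
  have gPP: "g x (P u) w = g x u (P w)" if "u \<in> ?T" "w \<in> ?T" for u w
    using gP[OF that] gP[OF that(2,1)] ip.sym that Pm by (simp add: mult.commute)
  have \<eta>P: "\<eta> i x (P u) = 0" if "u \<in> ?T" for i u
  proof -
    have "\<eta> i x (P u) = g x (P u) (\<xi> i x)" using \<eta>_eq[OF Pm[OF that]] .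
    also have "\<dots> = 0" using gP[OF that \<xi>_mem] \<eta>_eq[OF that]
      by (simp add: \<eta>_\<xi> if_distrib cong: if_cong)
    finally show ?thesis .
  qed
  have P_fix: "P w = w" if "\<And>i. \<eta> i x w = 0" for w using that by (simp add: P_def)
  have fhor: "f x (\<Sum>i\<in>UNIV. c i *\<^sub>R \<xi> i x) = 0" for c
    using span_\<xi>[of x] unfolding char_distribution_def
    by (metis (mono_tags, lifting) mem_Collect_eq rangeI span_base span_scale span_sum)
  have fP: "f x (P u) = f x u" if "u \<in> ?T" for u
    unfolding P_def using f_diff[OF that hor] fhor by simp
  have Sm: "S u \<in> ?T" if "u \<in> ?T" for u unfolding S_def by (intro Pm f_mem that)
  \<comment> \<open>From f P = f comes S^2 = P f^2, and P annihilates the \<xi>-part of f^2, so P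
    f^2 = - P Q; compatibility itself reads g(f u, f u) = g(P u, Q u).\<close>
  have gf: "g x (f x u) (f x u) = - g x u (S (S u))" if u: "u \<in> ?T" for u
  proof -
    have Pff: "P (f x (f x u)) = - (P (Q x u))"
    proof -
      have "\<eta> i x (f x (f x u)) = \<eta> i x u - \<eta> i x (Q x u)" for i
        unfolding f_f_diff[OF u] \<eta>_diff[OF hor_mem Q_mem[OF u]] \<eta>_hor by simp
      then show ?thesis unfolding P_def
        by (simp add: f_f_diff[OF u] scaleR_diff_left sum_subtractf)
    qed
    have "g x (f x u) (f x u) = g x (P u) (Q x u)"
      using g_f_f[OF u u] gP[OF u Q_mem[OF u]] by simp
    also have "\<dots> = g x u (P (Q x u))" by (rule gPP[OF u Q_mem[OF u]])
    also have "\<dots> = - g x u (P (f x (f x u)))"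
      using Pff Pm[OF Q_mem[OF u]] u by (simp add: ip.minus_right)
    also have "P (f x (f x u)) = S (S u)"
      unfolding S_def by (simp add: fP f_mem u)
    finally show ?thesis .
  qed
  \<comment> \<open>Pythagoras for f u, split into S u and its components along the orthonormal
    \<open>\<xi> i x\<close>.\<close>
  have gS: "g x (f x u) (f x u) = g x (S u) (S u) + (\<Sum>i\<in>UNIV. (\<eta> i x (f x u))\<^sup>2)" if u: "u \<in> ?T" for u
  proof -
    have "g x (S u) (S u) = g x (f x u) (P (S u))"
      unfolding S_def using u by (intro gPP) (auto intro: f_mem Pm)
    also have "P (S u) = S u"
      using \<eta>P[OF f_mem[OF u]] P_fix by (simp add: S_def)
    also have "g x (f x u) (S u) = g x (S u) (f x u)" using ip.sym f_mem Sm u by simp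
    also have "\<dots> = g x (f x u) (f x u) - (\<Sum>i\<in>UNIV. (\<eta> i x (f x u))\<^sup>2)"
      unfolding S_def using gP[OF f_mem[OF u] f_mem[OF u]] by (simp add: power2_eq_square)
    finally show ?thesis by simp
  qed
  have expand: "w = (\<Sum>e\<in>E. g x w e *\<^sub>R e)" if "w \<in> ?T" for w
    by (rule ip.orthonormal_expansion[OF E(1,2) on]) (use that E(3) in auto)
  have parseval: "g x u w = (\<Sum>e\<in>E. g x u e * g x w e)" if "u \<in> ?T" "w \<in> ?T" for u w
  proof -
    have "g x u w = g x (\<Sum>e\<in>E. g x u e *\<^sub>R e) w" using expand[OF that(1)] by simp
    also have "\<dots> = (\<Sum>e\<in>E. g x u e * g x e w)"
      using E(2) that by (subst ip.sum_left) (auto simp: subset_iff ip.scale_left ip.scale_mem)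
    finally show ?thesis using E(2) that ip.sym[OF that(2)] by (simp add: subset_iff)
  qed
  have S_lin: "S (\<Sum>e\<in>E. c e *\<^sub>R e) = (\<Sum>e\<in>E. c e *\<^sub>R S e)" for c
  proof -
    have P_add: "P (u + w) = P u + P w" if "u \<in> ?T" "w \<in> ?T" for u w
      unfolding P_def using that
      by (simp add: \<eta>_eq ip.add_mem ip.add_left \<xi>_mem scaleR_add_left sum.distrib)
    have P_scale: "P (c *\<^sub>R u) = c *\<^sub>R P u" if "u \<in> ?T" for c u
      unfolding P_def using that
      by (simp add: \<eta>_eq ip.scale_mem ip.scale_left \<xi>_mem scaleR_diff_right scaleR_sum_right)
    have "F \<subseteq> E \<Longrightarrow> S (\<Sum>e\<in>F. c e *\<^sub>R e) = (\<Sum>e\<in>F. c e *\<^sub>R S e)" if "finite F" for F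
      using that
    proof (induction F)
      case empty
      show ?case
        using P_scale[OF ip.zero_mem, of 0] by (simp only: S_def f_0 sum.empty scaleR_zero_left)
    next
      case (insert e F)
      have mem: "e \<in> ?T" "(\<Sum>e\<in>F. c e *\<^sub>R e) \<in> ?T"
        using insert.prems E(2) by (auto intro!: ip.sum_mem ip.scale_mem)
      have "S (c e *\<^sub>R e + (\<Sum>e\<in>F. c e *\<^sub>R e)) = c e *\<^sub>R S e + S (\<Sum>e\<in>F. c e *\<^sub>R e)"
        unfolding S_def f_add[OF ip.scale_mem[OF mem(1)] mem(2)] f_scale[OF mem(1)]
          P_add[OF ip.scale_mem[OF f_mem[OF mem(1)]] f_mem[OF mem(2)]] P_scale[OF f_mem[OF mem(1)]] ..
      moreover have "S (\<Sum>e\<in>F. c e *\<^sub>R e) = (\<Sum>e\<in>F. c e *\<^sub>R S e)"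
        by (rule insert.IH) (use insert.prems in auto)
      ultimately show ?case by (simp only: sum.insert[OF insert.hyps])
    qed
    then show ?thesis using E(1) by blast
  qed
  have tr: "g x e (S (S e)) = (\<Sum>d\<in>E. g x (S e) d * g x (S d) e)" if e: "e \<in> E" for e
  proof -
    have eT: "e \<in> ?T" using e E(2) by blast
    have "S (S e) = (\<Sum>d\<in>E. g x (S e) d *\<^sub>R S d)"
      using expand[OF Sm[OF eT]] S_lin[of "\<lambda>d. g x (S e) d"] by simp
    then have "g x e (S (S e)) = (\<Sum>d\<in>E. g x (S e) d * g x e (S d))"
      using E(2) eT Sm by (simp add: ip.sum_right ip.scale_right ip.scale_mem subset_iff)
    also have "\<dots> = (\<Sum>d\<in>E. g x (S e) d * g x (S d) e)"
      using E(2) eT Sm ip.sym[OF eT] by (intro sum.cong) auto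
    finally show ?thesis .
  qed
  have "(\<Sum>e\<in>E. g x (f x e) (f x e)) = (\<Sum>e\<in>E. \<Sum>d\<in>E. - (g x (S e) d * g x (S d) e))"
    using E(2) by (intro sum.cong) (auto simp: gf tr sum_negf subset_iff)
  \<comment> \<open>Termwise -ab <= (a^2 + b^2)/2; both sums of squares agree after exchanging the
    indices, so the bound is the sum of all squared entries of the matrix of S.\<close>
  also have "\<dots> \<le> (\<Sum>e\<in>E. \<Sum>d\<in>E. ((g x (S e) d)\<^sup>2 + (g x (S d) e)\<^sup>2) / 2)"
  proof (intro sum_mono)
    fix e d
    have "0 \<le> (g x (S e) d + g x (S d) e)\<^sup>2" by simp
    then show "- (g x (S e) d * g x (S d) e) \<le> ((g x (S e) d)\<^sup>2 + (g x (S d) e)\<^sup>2) / 2"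
      by (simp add: power2_sum)
  qed
  also have "\<dots> = (\<Sum>e\<in>E. \<Sum>d\<in>E. (g x (S e) d)\<^sup>2)"
  proof -
    have "(\<Sum>e\<in>E. \<Sum>d\<in>E. (g x (S d) e)\<^sup>2) = (\<Sum>e\<in>E. \<Sum>d\<in>E. (g x (S e) d)\<^sup>2)" by (rule sum.swap)
    then show ?thesis by (simp add: sum.distrib add_divide_distrib flip: sum_divide_distrib)
  qed
  also have "\<dots> = (\<Sum>e\<in>E. g x (S e) (S e))"
  proof (rule sum.cong[OF refl])
    fix e assume "e \<in> E"
    then have "S e \<in> ?T" using E(2) Sm by blast
    from parseval[OF this this] show "(\<Sum>d\<in>E. (g x (S e) d)\<^sup>2) = g x (S e) (S e)"
      by (simp only: power2_eq_square)
  qed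
  \<comment> \<open>The sum of |f e|^2 is at most that of |S e|^2, yet by \<open>gS\<close> it
    exceeds it by exactly these squares.\<close>
  finally have "(\<Sum>e\<in>E. \<Sum>i\<in>UNIV. (\<eta> i x (f x e))\<^sup>2) \<le> 0"
    using gS E(2) by (simp add: subset_iff sum.distrib)
  then have "(\<Sum>e\<in>E. \<Sum>i\<in>UNIV. (\<eta> i x (f x e))\<^sup>2) = 0"
    by (rule order_antisym) (intro sum_nonneg zero_le_power2)
  then have "\<eta> i x (f x e) = 0" if "e \<in> E" for e
    using that E(1) by (auto simp: sum_nonneg_eq_0_iff sum_nonneg)
  then have 0: "g x (f x e) (\<xi> i x) = 0" if "e \<in> E" for e
    using that E(2) by (metis \<eta>_eq f_mem subsetD)
  have "F \<subseteq> E \<Longrightarrow> g x (f x (\<Sum>e\<in>F. c e *\<^sub>R e)) (\<xi> i x) = 0" if "finite F" for F c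
    using that
  proof (induction F)
    case empty
    show ?case by (simp only: sum.empty f_0 ip.zero_left[OF \<xi>_mem])
  next
    case (insert e F)
    have mem: "e \<in> ?T" "(\<Sum>e\<in>F. c e *\<^sub>R e) \<in> ?T"
      using insert.prems E(2) by (auto intro!: ip.sum_mem ip.scale_mem)
    have "g x (f x (c e *\<^sub>R e + (\<Sum>e\<in>F. c e *\<^sub>R e))) (\<xi> i x)
        = c e * g x (f x e) (\<xi> i x) + g x (f x (\<Sum>e\<in>F. c e *\<^sub>R e)) (\<xi> i x)"
      unfolding f_add[OF ip.scale_mem[OF mem(1)] mem(2)] f_scale[OF mem(1)]
        ip.add_left[OF ip.scale_mem[OF f_mem[OF mem(1)]] f_mem[OF mem(2)] \<xi>_mem]
        ip.scale_left[OF f_mem[OF mem(1)] \<xi>_mem] ..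
    moreover have "g x (f x e) (\<xi> i x) = 0" using insert.prems 0 by blast
    moreover have "g x (f x (\<Sum>e\<in>F. c e *\<^sub>R e)) (\<xi> i x) = 0"
      by (rule insert.IH) (use insert.prems in auto)
    ultimately show ?case by (simp only: sum.insert[OF insert.hyps] mult_zero_right add_0_left)
  qed
  from this[OF E(1), of "\<lambda>e. g x v e"] show ?thesis
    using expand[OF v] \<eta>_eq[OF f_mem[OF v]] by simp
qed

text \<open>From \<eta> o f = 0 follow \<eta> o Q = \<eta> and f Q = Q f, and the symmetry of g(f u,
  f v) makes Q self-adjoint. With v = Q z: g(f u, Q z) = g(f^2 u, f z) = - g(Q u, f z) = - g(u, Q f
  z) = - g(u, f v).\<close>

lemma g_f_skew:
  assumes u: "u \<in> tangent_space A x" and v: "v \<in> tangent_space A x"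
  shows "g x (f x u) v = - g x u (f x v)"
proof -
  obtain z where z: "z \<in> tangent_space A x" "v = Q x z" using v Q_surj by blast
  note mem = u z(1) f_mem Q_mem \<xi>_mem
  have \<eta>Q: "\<eta> i x (Q x w) = \<eta> i x w" if w: "w \<in> tangent_space A x" for i w
  proof -
    have "Q x w = (\<Sum>i\<in>UNIV. \<eta> i x w *\<^sub>R \<xi> i x) - f x (f x w)" using f_f_diff[OF w] by simp
    then show ?thesis
      using \<eta>_diff[OF hor_mem f_mem[OF f_mem[OF w]]] \<eta>_hor \<eta>_f[OF f_mem[OF w]] by simp
  qed
  have Qsym: "g x a (Q x b) = g x (Q x a) b" if "a \<in> tangent_space A x" "b \<in> tangent_space A x" for a b
    using g_f_f[OF that] g_f_f[OF that(2,1)] \<eta>Q that ip.sym[of "f x a" x "f x b"] ip.sym[of b x "Q x a"]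
    by (simp add: mem mult.commute)
  have fQ: "f x (Q x z) = Q x (f x z)"
    using f_f_f[OF z(1)] f_f[OF f_mem[OF z(1)]] \<eta>_f[OF z(1)] by (simp add: add_eq_0_iff2)
  have "g x (f x u) v = g x (f x (f x u)) (f x z)"
    using g_f_f[OF f_mem[OF u] z(1)] \<eta>_f[OF u] z(2) by simp
  also have "\<dots> = - g x (Q x u) (f x z)"
  proof -
    have "g x (\<xi> i x) (f x z) = 0" for i
      using ip.sym[OF \<xi>_mem f_mem[OF z(1)]] \<eta>_eq[OF f_mem[OF z(1)]] \<eta>_f[OF z(1)] by simp
    then have "g x (\<Sum>i\<in>UNIV. \<eta> i x u *\<^sub>R \<xi> i x) (f x z) = 0"
      by (simp add: ip.sum_left ip.scale_left ip.scale_mem mem)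
    then show ?thesis
      unfolding f_f_diff[OF u] by (simp add: ip.diff_left hor_mem mem)
  qed
  also have "\<dots> = - g x u (f x v)" using Qsym[OF u f_mem[OF z(1)]] fQ z(2) by simp
  finally show ?thesis .
qed

section \<open>Normality, closedness of the fundamental form and the Killing property\<close>

lemma bracket_mem: "vector_field A X \<Longrightarrow> vector_field A Y \<Longrightarrow> lie_bracket A X Y x \<in> tangent_space A x"
  by (rule vector_fieldD(1)[OF vector_field_lie_bracket])

lemma normal_\<xi>:
  assumes X: "vector_field A X"
  shows "f x (f x (lie_bracket A X (\<xi> j) x)) - f x (lie_bracket A (\<lambda>x. f x (X x)) (\<xi> j) x)
      + 2 *\<^sub>R (\<Sum>i\<in>UNIV. d_oneform A (\<eta> i) X (\<xi> j) x *\<^sub>R \<xi> i x) = 0"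
proof -
  have f\<xi>: "tensor_app f (\<xi> j) = (\<lambda>x. 0)" by (simp add: tensor_app_def f_\<xi> fun_eq_iff)
  have "normal_structure A f \<xi> \<eta>" using weak_K unfolding weak_K_structure_def by blast
  then have "nijenhuis_torsion A f X (\<xi> j) x
      + 2 *\<^sub>R (\<Sum>i\<in>UNIV. d_oneform A (\<eta> i) X (\<xi> j) x *\<^sub>R \<xi> i x) = 0"
    using X \<xi> unfolding normal_structure_def by blast
  moreover have "nijenhuis_torsion A f X (\<xi> j) x
      = f x (f x (lie_bracket A X (\<xi> j) x)) - f x (lie_bracket A (\<lambda>x. f x (X x)) (\<xi> j) x)"
    unfolding nijenhuis_torsion_def f\<xi>
    by (simp add: tensor_app_def fun_diff_def lie_bracket_zero_right[OF X] lie_bracket_zero_right[OF f_field[OF X]] f_0)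
  ultimately show ?thesis by simp
qed

text \<open>Pairing normality with \<open>\<xi> k\<close> removes both f-terms by
  \<open>\<eta>_f\<close> and leaves d\<eta>^k(X, \<xi>_j) = 0. As \<eta>^k(\<xi>_j) is constant,
  this is the invariance of \<eta>^k under \<xi>_j.\<close>

lemma \<eta>_bracket_\<xi>:
  assumes X: "vector_field A X"
  shows "\<eta> k x (lie_bracket A X (\<xi> j) x) = - \<xi> j x (\<lambda>y. \<eta> k y (X y))"
proof -
  let ?u = "f x (f x (lie_bracket A X (\<xi> j) x))" and ?w = "f x (lie_bracket A (\<lambda>x. f x (X x)) (\<xi> j) x)"
  let ?s = "\<Sum>i\<in>UNIV. d_oneform A (\<eta> i) X (\<xi> j) x *\<^sub>R \<xi> i x"
  have mem: "?u \<in> tangent_space A x" "?w \<in> tangent_space A x" "?s \<in> tangent_space A x"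
    by (intro f_mem bracket_mem f_field X \<xi> ip.sum_mem ip.scale_mem \<xi>_mem)+
  have "g x (?u - ?w + 2 *\<^sub>R ?s) (\<xi> k x) = 0"
    unfolding normal_\<xi>[OF X] by (rule ip.zero_left[OF \<xi>_mem])
  moreover have "g x ?u (\<xi> k x) = 0" "g x ?w (\<xi> k x) = 0"
    using \<eta>_f[of "f x (lie_bracket A X (\<xi> j) x)" x k] \<eta>_f[of "lie_bracket A (\<lambda>x. f x (X x)) (\<xi> j) x" x k] mem
    by (simp_all add: \<eta>_eq f_mem bracket_mem f_field X \<xi>)
  moreover have "g x ?s (\<xi> k x) = d_oneform A (\<eta> k) X (\<xi> j) x"
    by (simp add: ip.sum_left ip.scale_left ip.scale_mem \<xi>_mem g_\<xi>_\<xi> if_distrib cong: if_cong)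
  ultimately have "d_oneform A (\<eta> k) X (\<xi> j) x = 0"
    using mem by (simp add: ip.add_left ip.diff_left ip.diff_mem ip.scale_left ip.scale_mem \<xi>_mem)
  then show ?thesis
    by (simp add: d_oneform_def vfield_app_def oneform_app_def \<eta>_\<xi> tangent_const[OF vector_fieldD(1)[OF X]])
qed

text \<open>With the d\<eta>-terms gone, normality says only that f annihilates the difference of
  the two sides; that its \<eta>-components vanish as well comes from
  \<open>\<eta>_bracket_\<xi>\<close> for the field f X. The outcome is the invariance of f under
  \<xi>_j.\<close>

lemma bracket_f_\<xi>:
  assumes X: "vector_field A X"
  shows "lie_bracket A (\<lambda>x. f x (X x)) (\<xi> j) x = f x (lie_bracket A X (\<xi> j) x)"
proof -
  let ?u = "f x (lie_bracket A X (\<xi> j) x)" and ?w = "lie_bracket A (\<lambda>x. f x (X x)) (\<xi> j) x"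
  have mem: "?u \<in> tangent_space A x" "?w \<in> tangent_space A x"
    by (intro f_mem bracket_mem f_field X \<xi>)+
  have "d_oneform A (\<eta> i) X (\<xi> j) x = 0" for i
    using \<eta>_bracket_\<xi>[OF X, of i x j]
    by (simp add: d_oneform_def vfield_app_def oneform_app_def \<eta>_\<xi> tangent_const[OF vector_fieldD(1)[OF X]])
  then have "f x (?u - ?w) = 0" using normal_\<xi>[OF X, of x j] f_diff[OF mem] by simp
  moreover have "\<eta> i x (?u - ?w) = 0" for i
  proof -
    have "\<eta> i x ?w = - \<xi> j x (\<lambda>y. \<eta> i y (f y (X y)))" by (rule \<eta>_bracket_\<xi>[OF f_field[OF X]])
    also have "\<dots> = 0" using \<eta>_f[OF vector_fieldD(1)[OF X]] tangent_const[OF \<xi>_mem] by simp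
    finally have "\<eta> i x ?w = 0" .
    then show ?thesis
      using \<eta>_diff[OF mem] \<eta>_f[OF bracket_mem[OF X \<xi>]] by simp
  qed
  ultimately have "?u - ?w = 0" by (rule char_eq_0[OF ip.diff_mem[OF mem]])
  then show ?thesis by simp
qed

text \<open>Invariance of f, applied to the field \<open>\<xi> i\<close> that f kills, puts the
  bracket into ker f; its \<eta>-components are derivatives of constants.\<close>

lemma bracket_\<xi>_\<xi>: "lie_bracket A (\<xi> i) (\<xi> j) x = 0"
proof (rule char_eq_0)
  show "lie_bracket A (\<xi> i) (\<xi> j) x \<in> tangent_space A x" by (rule bracket_mem[OF \<xi> \<xi>])
  have "f x (lie_bracket A (\<xi> i) (\<xi> j) x) = - lie_bracket A (\<xi> j) (\<lambda>x. f x (\<xi> i x)) x"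
    using bracket_f_\<xi>[OF \<xi>] lie_bracket_swap by metis
  then show "f x (lie_bracket A (\<xi> i) (\<xi> j) x) = 0"
    by (simp add: f_\<xi> lie_bracket_zero_right[OF \<xi>])
  show "\<eta> k x (lie_bracket A (\<xi> i) (\<xi> j) x) = 0" for k
    using \<eta>_bracket_\<xi>[OF \<xi>] tangent_const[OF \<xi>_mem] by (simp add: \<eta>_\<xi>)
qed

text \<open>In d\<Phi>(Y, Z, \<xi>_j) every term with \<xi>_j itself inserted into \<Phi> vanishes,
  and the rest is the invariance of \<Phi> under \<xi>_j. Since f is invariant too and \<Phi>(Y, Z)
  = g(Y, f Z), the derivative falls on g alone. Skewness of f rewrites the term with
  [Z, \<xi>_j].\<close>

lemma lie_derivative_f:
  assumes Y: "vector_field A Y" and Z: "vector_field A Z"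
  shows "lie_derivative_metric A (\<xi> j) g Y (\<lambda>x. f x (Z x)) x = 0"
proof -
  have "d_twoform A (fundamental_form f g) Y Z (\<xi> j) x = 0"
    using weak_K Y Z \<xi> unfolding weak_K_structure_def by blast
  moreover have "(\<lambda>x. g x (Z x) (f x (\<xi> j x))) = (\<lambda>x. 0)"
    by (simp add: f_\<xi> ip.zero_right vector_fieldD(1)[OF Z])
  moreover have "(\<lambda>x. g x (\<xi> j x) (f x (Y x))) = (\<lambda>x. 0)"
    using \<eta>_f[OF vector_fieldD(1)[OF Y]] \<eta>_eq[OF f_mem[OF vector_fieldD(1)[OF Y]]]
      ip.sym[OF \<xi>_mem f_mem[OF vector_fieldD(1)[OF Y]]] by simp
  moreover have "g x (lie_bracket A Y Z x) (f x (\<xi> j x)) = 0"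
    by (simp add: f_\<xi> ip.zero_right bracket_mem Y Z)
  ultimately have 1: "\<xi> j x (\<lambda>y. g y (Y y) (f y (Z y))) = g x (lie_bracket A (\<xi> j) Y x) (f x (Z x))
      + g x (lie_bracket A Z (\<xi> j) x) (f x (Y x))"
    using tangent_const[OF vector_fieldD(1)[OF Y]] tangent_const[OF vector_fieldD(1)[OF Z]]
    by (simp add: d_twoform_def vfield_app_def tensor02_app_def fundamental_form_def)
  have bm: "lie_bracket A Z (\<xi> j) x \<in> tangent_space A x" by (rule bracket_mem[OF Z \<xi>])
  have Yx: "Y x \<in> tangent_space A x" by (rule vector_fieldD(1)[OF Y])
  have "g x (lie_bracket A Z (\<xi> j) x) (f x (Y x)) = - g x (f x (lie_bracket A Z (\<xi> j) x)) (Y x)"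
    using g_f_skew[OF bm Yx] by simp
  also have "\<dots> = - g x (Y x) (lie_bracket A (\<lambda>x. f x (Z x)) (\<xi> j) x)"
    using bracket_f_\<xi>[OF Z, of j x] ip.sym[OF Yx f_mem[OF bm]] by simp
  also have "\<dots> = g x (Y x) (lie_bracket A (\<xi> j) (\<lambda>x. f x (Z x)) x)"
    using ip.minus_right[OF bracket_mem[OF \<xi> f_field[OF Z], of j x] Yx]
      lie_bracket_swap[of "\<lambda>x. f x (Z x)" "\<xi> j" x] by simp
  finally show ?thesis
    using 1 by (simp add: lie_derivative_metric_def vfield_app_def tensor02_app_def)
qed

text \<open>As pairing with \<xi>_i is \<eta>^i, this is the invariance of \<eta>^i under \<xi>_j
  together with [\<xi>_j, \<xi>_i] = 0.\<close>

lemma lie_derivative_\<xi>: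
  assumes Y: "vector_field A Y"
  shows "lie_derivative_metric A (\<xi> j) g Y (\<xi> i) x = 0"
proof -
  have "\<eta> i x (lie_bracket A (\<xi> j) Y x) = \<xi> j x (\<lambda>y. \<eta> i y (Y y))"
  proof -
    have "\<eta> i x (lie_bracket A (\<xi> j) Y x) = - \<eta> i x (lie_bracket A Y (\<xi> j) x)"
      using lie_bracket_swap[of "\<xi> j" Y x] bracket_mem[OF Y \<xi>]
      by (simp add: \<eta>_eq ip.minus_left ip.minus_mem \<xi>_mem)
    then show ?thesis using \<eta>_bracket_\<xi>[OF Y] by simp
  qed
  then show ?thesis
    using vector_fieldD(1)[OF Y] bracket_mem[OF \<xi> Y]
    by (simp add: lie_derivative_metric_def vfield_app_def tensor02_app_def bracket_\<xi>_\<xi> ip.zero_right \<eta>_eq)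
qed

lemma killing_\<xi>: "killing_field A g (\<xi> j)"
  unfolding killing_field_def
proof (intro conjI allI impI)
  fix Y W x assume Y: "vector_field A Y" and W: "vector_field A W"
  \<comment> \<open>No smooth preimage of the whole field \<open>W\<close> under Q is constructed: z
    is chosen at x and extended, and \<open>lie_derivative_metric_cong_point\<close> replaces
    \<open>W\<close> by the field Q Z that agrees with it at x.\<close>
  obtain z where z: "z \<in> tangent_space A x" "W x = Q x z"
    using vector_fieldD(1)[OF W] Q_surj by blast
  obtain Z where Z: "vector_field A Z" "Z x = z" by (rule tangent_extend[OF z(1)])
  note ffZ = f_field[OF f_field[OF Z(1)]]
  have QZ: "(\<lambda>x. Q x (Z x)) = (\<lambda>x. (-1) *\<^sub>R f x (f x (Z x)) + (\<Sum>i\<in>UNIV. \<eta> i x (Z x) *\<^sub>R \<xi> i x))"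
    using f_f[OF vector_fieldD(1)[OF Z(1)]] by (simp add: fun_eq_iff)
  have "lie_derivative_metric A (\<xi> j) g Y W x = lie_derivative_metric A (\<xi> j) g Y (\<lambda>x. Q x (Z x)) x"
    by (rule lie_derivative_metric_cong_point[OF metric \<xi> Y W Q_field[OF Z(1)]]) (simp add: z Z)
  also have "\<dots> = lie_derivative_metric A (\<xi> j) g Y (\<lambda>x. (-1) *\<^sub>R f x (f x (Z x))) x
      + lie_derivative_metric A (\<xi> j) g Y (\<lambda>x. \<Sum>i\<in>UNIV. \<eta> i x (Z x) *\<^sub>R \<xi> i x) x"
    unfolding QZ
    by (intro lie_derivative_metric_add_right[OF metric \<xi> Y] vector_field_scale[OF smooth_fun_const ffZ]
        vector_field_sum vector_field_scale[OF \<eta>_field[OF Z(1)] \<xi>])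
  also have "\<dots> = 0"
    using lie_derivative_metric_scale_right[OF metric \<xi> Y ffZ smooth_fun_const[of "-1"]]
      lie_derivative_metric_sum_right[OF metric \<xi> Y finite \<xi> \<eta>_field[OF Z(1)]]
      lie_derivative_f[OF Y f_field[OF Z(1)]] lie_derivative_\<xi>[OF Y]
    by simp
  finally show "lie_derivative_metric A (\<xi> j) g Y W x = 0" .
qed (rule \<xi>)

lemma integrable_char_distribution: "integrable_distribution TYPE(real ^ 'p) A (char_distribution A f)"
proof -
  have indep: "h = 0" if h: "(\<Sum>i\<in>UNIV. (h $ i) *\<^sub>R \<xi> i x) = 0" for h :: "real ^ 'p" and x
  proof -
    have "h $ j = g x (\<Sum>i\<in>UNIV. (h $ i) *\<^sub>R \<xi> i x) (\<xi> j x)" for j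
      by (simp add: ip.sum_left ip.scale_left ip.scale_mem \<xi>_mem g_\<xi>_\<xi> if_distrib cong: if_cong)
    then show ?thesis by (simp add: h vec_eq_iff ip.zero_left \<xi>_mem)
  qed
  have char: "char_distribution A f = (\<lambda>x. span (range (\<lambda>i. \<xi> i x)))" by (simp add: span_\<xi> fun_eq_iff)
  show ?thesis
    unfolding integrable_distribution_def char
  proof
    fix x
    obtain S and F :: "real ^ 'p \<Rightarrow> 'a"
      where "integral_manifold A (\<lambda>x. span (range (\<lambda>i. \<xi> i x))) S F" "x \<in> F ` S"
      by (rule commuting_frame_integral_manifold[OF \<xi> bracket_\<xi>_\<xi> indep])
    then show "\<exists>(S :: (real ^ 'p) set) F. integral_manifold A (\<lambda>x. span (range (\<lambda>i. \<xi> i x))) S F \<and> x \<in> F ` S"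
      by blast
  qed
qed

section \<open>The Levi-Civita connection and total geodesy\<close>

context
  fixes nabla :: "'a vfield \<Rightarrow> 'a vfield \<Rightarrow> 'a vfield"
  assumes nabla: "levi_civita_connection A g nabla"
begin

lemma connection: "affine_connection A nabla"
  using nabla unfolding levi_civita_connection_def by blast

lemma nabla_field: "vector_field A X \<Longrightarrow> vector_field A Y \<Longrightarrow> vector_field A (nabla X Y)"
  and nabla_add_left: "vector_field A X \<Longrightarrow> vector_field A X' \<Longrightarrow> vector_field A Y \<Longrightarrow>
    nabla (\<lambda>x. X x + X' x) Y = (\<lambda>x. nabla X Y x + nabla X' Y x)"
  and nabla_scale_left: "smooth_fun A h \<Longrightarrow> vector_field A X \<Longrightarrow> vector_field A Y \<Longrightarrow>
    nabla (\<lambda>x. h x *\<^sub>R X x) Y = (\<lambda>x. h x *\<^sub>R nabla X Y x)"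
  and nabla_add_right: "vector_field A X \<Longrightarrow> vector_field A Y \<Longrightarrow> vector_field A Y' \<Longrightarrow>
    nabla X (\<lambda>x. Y x + Y' x) = (\<lambda>x. nabla X Y x + nabla X Y' x)"
  and nabla_scale_right: "smooth_fun A h \<Longrightarrow> vector_field A X \<Longrightarrow> vector_field A Y \<Longrightarrow>
    nabla X (\<lambda>x. h x *\<^sub>R Y x) = (\<lambda>x. vfield_app X h x *\<^sub>R Y x + h x *\<^sub>R nabla X Y x)"
  using connection unfolding affine_connection_def plus_fun_def[where 'b = "'a tangent"] by auto

lemma nabla_torsion_free:
  "vector_field A X \<Longrightarrow> vector_field A Y \<Longrightarrow> lie_bracket A X Y x = nabla X Y x - nabla Y X x"
proof -
  assume "vector_field A X" "vector_field A Y"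
  then have "nabla X Y - nabla Y X = lie_bracket A X Y"
    using nabla unfolding levi_civita_connection_def by blast
  then show ?thesis by (metis fun_diff_def)
qed

lemma nabla_metric:
  "vector_field A X \<Longrightarrow> vector_field A Y \<Longrightarrow> vector_field A Z \<Longrightarrow>
    X x (\<lambda>y. g y (Y y) (Z y)) = g x (nabla X Y x) (Z x) + g x (Y x) (nabla X Z x)"
proof -
  assume "vector_field A X" "vector_field A Y" "vector_field A Z"
  then have "vfield_app X (tensor02_app g Y Z) =
          (\<lambda>x. tensor02_app g (nabla X Y) Z x + tensor02_app g Y (nabla X Z) x)"
    using nabla unfolding levi_civita_connection_def by blast
  then show ?thesis by (simp add: vfield_app_def tensor02_app_def fun_eq_iff)
qed

text \<open>Killing's equation: by metric compatibility and vanishing torsion, all terms of the Lie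
  derivative of g cancel except those that differentiate \<open>\<xi> j\<close>.\<close>

lemma nabla_killing:
  assumes Y: "vector_field A Y" and Z: "vector_field A Z"
  shows "g x (nabla Y (\<xi> j) x) (Z x) = - g x (Y x) (nabla Z (\<xi> j) x)"
proof -
  have "lie_derivative_metric A (\<xi> j) g Y Z x = 0"
    using killing_\<xi> Y Z unfolding killing_field_def by blast
  then show ?thesis
    unfolding lie_derivative_metric_def vfield_app_def tensor02_app_def nabla_metric[OF \<xi> Y Z]
      nabla_torsion_free[OF \<xi> Y] nabla_torsion_free[OF \<xi> Z]
    using Y Z \<xi> by (simp add: ip.diff_left ip.diff_right vector_fieldD(1) nabla_field)
qed

text \<open>The field N = \<open>nabla (\<xi> k) (\<xi> j)\<close> is symmetric in k and j because
  the brackets vanish. Differentiating the constant g(\<xi>_k, \<xi>_j) along N gives 0, while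
  \<open>nabla_killing\<close> turns each of the two resulting terms into - g(N, N).\<close>

lemma nabla_\<xi>_\<xi>: "nabla (\<xi> k) (\<xi> j) x = 0"
proof -
  let ?N = "nabla (\<xi> k) (\<xi> j)"
  have N: "vector_field A ?N" by (rule nabla_field[OF \<xi> \<xi>])
  have sym: "?N x = nabla (\<xi> j) (\<xi> k) x"
    using nabla_torsion_free[OF \<xi> \<xi>] bracket_\<xi>_\<xi> by (metis eq_iff_diff_eq_0)
  have "?N x (\<lambda>y. g y (\<xi> k y) (\<xi> j y)) = 0"
    using tangent_const[OF vector_fieldD(1)[OF N]] by (simp add: g_\<xi>_\<xi>)
  then have "g x (nabla ?N (\<xi> k) x) (\<xi> j x) + g x (\<xi> k x) (nabla ?N (\<xi> j) x) = 0"
    using nabla_metric[OF N \<xi> \<xi>] by simp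
  moreover have "g x (?N x) (?N x) = - g x (\<xi> k x) (nabla ?N (\<xi> j) x)"
    by (rule nabla_killing[OF \<xi> N])
  moreover have "g x (nabla ?N (\<xi> k) x) (\<xi> j x) = - g x (?N x) (?N x)"
    using nabla_killing[OF N \<xi>] sym by simp
  ultimately have "g x (?N x) (?N x) = 0" by simp
  then show ?thesis using ip.pos[OF vector_fieldD(1)[OF N]] by fastforce
qed

lemma nabla_sum_left:
  assumes "finite I" "\<And>i. i \<in> I \<Longrightarrow> smooth_fun A (h i)" "\<And>i. i \<in> I \<Longrightarrow> vector_field A (X i)"
    and Y: "vector_field A Y"
  shows "nabla (\<lambda>x. \<Sum>i\<in>I. h i x *\<^sub>R X i x) Y = (\<lambda>x. \<Sum>i\<in>I. h i x *\<^sub>R nabla (X i) Y x)"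
  using assms(1-3)
proof (induction I)
  case empty
  show ?case
    using nabla_scale_left[OF smooth_fun_const[of 0] Y Y] by (simp only: sum.empty scaleR_zero_left)
next
  case (insert i I)
  have IH: "nabla (\<lambda>x. \<Sum>i\<in>I. h i x *\<^sub>R X i x) Y = (\<lambda>x. \<Sum>i\<in>I. h i x *\<^sub>R nabla (X i) Y x)"
    by (rule insert.IH) (use insert.prems in auto)
  have hX: "vector_field A (\<lambda>x. h j x *\<^sub>R X j x)" if "j \<in> insert i I" for j
    by (rule vector_field_scale) (use insert.prems that in auto)
  have "nabla (\<lambda>x. h i x *\<^sub>R X i x + (\<Sum>i\<in>I. h i x *\<^sub>R X i x)) Y
      = (\<lambda>x. nabla (\<lambda>x. h i x *\<^sub>R X i x) Y x + nabla (\<lambda>x. \<Sum>i\<in>I. h i x *\<^sub>R X i x) Y x)"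
    by (rule nabla_add_left[OF hX vector_field_sum[OF hX] Y]) auto
  moreover have "nabla (\<lambda>x. h i x *\<^sub>R X i x) Y = (\<lambda>x. h i x *\<^sub>R nabla (X i) Y x)"
    by (rule nabla_scale_left) (use insert.prems Y in auto)
  ultimately show ?case unfolding sum.insert[OF insert.hyps(1,2)] IH by (simp only:)
qed

lemma nabla_sum_right:
  assumes "finite I" "\<And>i. i \<in> I \<Longrightarrow> smooth_fun A (h i)" "\<And>i. i \<in> I \<Longrightarrow> vector_field A (Y i)"
    and X: "vector_field A X"
  shows "nabla X (\<lambda>x. \<Sum>i\<in>I. h i x *\<^sub>R Y i x)
    = (\<lambda>x. \<Sum>i\<in>I. (X x (h i) *\<^sub>R Y i x + h i x *\<^sub>R nabla X (Y i) x))"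
  using assms(1-3)
proof (induction I)
  case empty
  show ?case using nabla_scale_right[OF smooth_fun_const[of 0] X X]
    by (simp only: sum.empty scaleR_zero_left vfield_app_def tangent_const[OF vector_fieldD(1)[OF X]] add_0_left)
next
  case (insert i I)
  have IH: "nabla X (\<lambda>x. \<Sum>i\<in>I. h i x *\<^sub>R Y i x)
      = (\<lambda>x. \<Sum>i\<in>I. (X x (h i) *\<^sub>R Y i x + h i x *\<^sub>R nabla X (Y i) x))"
    by (rule insert.IH) (use insert.prems in auto)
  have hY: "vector_field A (\<lambda>x. h j x *\<^sub>R Y j x)" if "j \<in> insert i I" for j
    by (rule vector_field_scale) (use insert.prems that in auto)
  have "nabla X (\<lambda>x. h i x *\<^sub>R Y i x + (\<Sum>i\<in>I. h i x *\<^sub>R Y i x))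
      = (\<lambda>x. nabla X (\<lambda>x. h i x *\<^sub>R Y i x) x + nabla X (\<lambda>x. \<Sum>i\<in>I. h i x *\<^sub>R Y i x) x)"
    by (rule nabla_add_right[OF X hY vector_field_sum[OF hY]]) auto
  moreover have "nabla X (\<lambda>x. h i x *\<^sub>R Y i x)
      = (\<lambda>x. X x (h i) *\<^sub>R Y i x + h i x *\<^sub>R nabla X (Y i) x)"
    using nabla_scale_right[of "h i" X "Y i"] insert.prems X unfolding vfield_app_def by blast
  ultimately show ?case unfolding sum.insert[OF insert.hyps(1,2)] IH by (simp only:)
qed

text \<open>Fields in ker f are combinations of the \<open>\<xi> i\<close> with smooth coefficients.
  Linearity over functions in X and \<open>nabla_\<xi>_\<xi>\<close> give \<nabla>_X \<xi>_j = 0, so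
  only derivatives of the coefficients of Y survive. This is stronger than total geodesy, which
  concerns the symmetrised derivative.\<close>

lemma nabla_char:
  assumes X: "vector_field A X" "\<And>x. X x \<in> char_distribution A f x"
    and Y: "vector_field A Y" "\<And>x. Y x \<in> char_distribution A f x"
  shows "nabla X Y x \<in> char_distribution A f x"
proof -
  have exp: "W = (\<lambda>x. \<Sum>i\<in>UNIV. \<eta> i x (W x) *\<^sub>R \<xi> i x)" if "\<And>x. W x \<in> char_distribution A f x" for W
    by (intro ext[of W] char_expansion) (use that in \<open>auto simp: char_distribution_def\<close>)
  have 0: "nabla X (\<xi> j) x = 0" for j
  proof -
    have "nabla X (\<xi> j) = nabla (\<lambda>x. \<Sum>i\<in>UNIV. \<eta> i x (X x) *\<^sub>R \<xi> i x) (\<xi> j)"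
      by (rule arg_cong[OF exp[OF X(2)], of "\<lambda>X. nabla X (\<xi> j)"])
    also have "\<dots> = (\<lambda>x. \<Sum>i\<in>UNIV. \<eta> i x (X x) *\<^sub>R nabla (\<xi> i) (\<xi> j) x)"
      by (rule nabla_sum_left[OF finite \<eta>_field[OF X(1)] \<xi> \<xi>])
    finally show ?thesis by (simp add: nabla_\<xi>_\<xi>)
  qed
  have "nabla X Y = nabla X (\<lambda>x. \<Sum>i\<in>UNIV. \<eta> i x (Y x) *\<^sub>R \<xi> i x)"
    by (rule arg_cong[OF exp[OF Y(2)]])
  also have "\<dots> = (\<lambda>x. \<Sum>i\<in>UNIV. (X x (\<lambda>y. \<eta> i y (Y y)) *\<^sub>R \<xi> i x + \<eta> i x (Y x) *\<^sub>R nabla X (\<xi> i) x))"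
    by (rule nabla_sum_right[OF finite \<eta>_field[OF Y(1)] \<xi> X(1)])
  finally have "nabla X Y x = (\<Sum>i\<in>UNIV. X x (\<lambda>y. \<eta> i y (Y y)) *\<^sub>R \<xi> i x)" by (simp add: 0)
  then show ?thesis
    unfolding span_\<xi>[symmetric] by (auto intro!: span_sum span_scale intro: span_base)
qed

lemma totally_geodesic_char: "totally_geodesic A nabla (char_distribution A f)"
  unfolding totally_geodesic_def
  using nabla_char span_add span_\<xi> by (metis plus_fun_apply)

end

end

theorem theorem2p1:
  fixes A :: "('a::{t2_space, second_countable_topology}, 'e::euclidean_space) atlas"
    and n :: nat
    and f Q :: "'a tensor11"
    and \<xi> :: "'p::finite \<Rightarrow> 'a vfield"
    and \<eta> :: "'p \<Rightarrow> 'a oneform"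
    and g :: "'a tensor02"
    and nabla :: "'a vfield \<Rightarrow> 'a vfield \<Rightarrow> 'a vfield"
  assumes "smooth_atlas A"
    and "weak_K_structure A n f Q \<xi> \<eta> g"
    and "levi_civita_connection A g nabla"
  shows "(\<forall>i. killing_field A g (\<xi> i)) \<and>
         (\<forall>k j x. nabla (\<xi> k) (\<xi> j) x = 0) \<and>
         integrable_distribution TYPE(real ^ 'p) A (char_distribution A f) \<and>
         totally_geodesic_foliation TYPE(real ^ 'p) A nabla (char_distribution A f)"
proof -
  interpret weak_K_manifold A n f Q \<xi> \<eta> g
    using assms(1,2) by unfold_locales
  show ?thesis
    unfolding totally_geodesic_foliation_def
    using killing_\<xi> nabla_\<xi>_\<xi>[OF assms(3)] integrable_char_distribution totally_geodesic_char[OF assms(3)]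
    by blast
qed

end
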